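(* For every absolute constant $c>0$ there is a constant $D=D(c)>0$, depending only on $c$, such that the following holds. Let $n,d$ be positive integers and $p\in(0,1)$. Let $X = ZZ^\top\in\mathbb{R}^{n\times n}$ be a random matrix to be estimated, where $Z=[z_1\dots z_n]^\top\in\mathbb{R}^{n\times d}$ has i.i.d. rows $z_1,\dots,z_n$ following either the Gaussian distribution $\mathcal{N}(0,\frac1d I_d)$ or the uniform distribution on the unit sphere $\mathcal{S}^{d-1}\subset\mathbb{R}^d$. For each entry $(i,j)\in[n]^2$, suppose that with probability $p_{ij}$ we have a one-bit observation $A_{ij}\in\{0,1\}$ according to an arbitrary model, and with probability $1-p_{ij}$ we do not have an observation, denoted $A_{ij}=\ast$. Let $p$ be the average probability of observations, i.e., $\sum_{i,j=1}^n p_{ij}=n^2p$. If $d\ge c\,n\,(h(p)+p)$, then for any estimator $\hat X \in \mathbb{R}^{n\times n}$ measurable with respect to $A=(A_{ij})_{i,j=1}^n$, we have $$\mathbb{E}\,L(X,\hat X)\ge D .$$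
   Context: $[n]:=\{1,\dots,n\}$. $h(p):=-p\log p-(1-p)\log(1-p)$ is the binary entropy function. The loss function is $L(X,\hat X):=\frac{d}{n(n+1)}\|X-\hat X\|_F^2$, where $\|\cdot\|_F$ is the Frobenius norm. The observation $A$ takes values in $\{0,1,\ast\}^{n\times n}$, where $\ast$ is a symbol for a missing observation; $\mathbb{P}(A_{ij}\neq\ast)=p_{ij}$, and "arbitrary model" means that the way the observed bits are generated from $X$ is otherwise arbitrary.
   Formalization: For rows uniform on the sphere, n ≥ 2 and d ≥ 2 are required: for n = 1, X = 1 is known, and for d = 1 one observed sign can determine X, so the loss can be 0. D is stated per sample-space type; one D serves all, since only the joint law of Z and A matters. *)

theory Defs
  imports "HOL-Probability.Probability"
begin

(* Dimensions n and d are quantified inside the theorem, so a vector of R^d is a function on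
   {..<d} (extensional, as in a product measure space), and an n x n matrix is a function of two
   indices of which only the values at i, j < n matter.  The index set {1..n} is shifted to {..<n}. *)

abbreviation vec_space :: "nat \<Rightarrow> (nat \<Rightarrow> real) measure" where
  "vec_space d \<equiv> \<Pi>\<^sub>M k\<in>{..<d}. (borel :: real measure)"

definition vec_norm :: "nat \<Rightarrow> (nat \<Rightarrow> real) \<Rightarrow> real" where
  "vec_norm d x = sqrt (\<Sum>k<d. (x k)\<^sup>2)"

(* N(0, (1/d) I_d); the second argument of normal_density is the standard deviation. *)
definition gaussian_law :: "nat \<Rightarrow> (nat \<Rightarrow> real) measure" where
  "gaussian_law d =
     (\<Pi>\<^sub>M k\<in>{..<d}. density lborel (\<lambda>x. ennreal (normal_density 0 (1 / sqrt (real d)) x)))"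

definition unit_ball :: "nat \<Rightarrow> (nat \<Rightarrow> real) set" where
  "unit_ball d = {x \<in> extensional {..<d}. vec_norm d x \<le> 1}"

(* Normalized surface measure on S^(d-1): a Borel set B of the sphere gets the relative volume,
   within the unit ball, of the cone {r u | 0 < r <= 1, u in B}.  This is the image of the uniform
   distribution on the ball under x |-> x / |x|; the origin is a null set.

   The theorem uses this law for n >= 2 and d >= 2 only.  For n = 1 the matrix X is the constant 1,
   so the constant estimator 1 has loss 0; for d = 1 the entries of X are signs, so with n = 2 a
   single bit observed with probability P 0 1 = 1 (the other P i j being 0, hence p = 1/4)
   determines X, although d >= c n (h(p) + p) holds for c <= 1/2. *)
definition sphere_law :: "nat \<Rightarrow> (nat \<Rightarrow> real) measure" where
  "sphere_law d =
     distr (uniform_measure (\<Pi>\<^sub>M k\<in>{..<d}. (lborel :: real measure)) (unit_ball d))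
       (vec_space d) (\<lambda>x. \<lambda>k\<in>{..<d}. x k / vec_norm d x)"

(* X = Z Z^T, where row i of the n x d matrix Z is z i. *)
definition gram :: "nat \<Rightarrow> (nat \<Rightarrow> nat \<Rightarrow> real) \<Rightarrow> nat \<Rightarrow> nat \<Rightarrow> real" where
  "gram d z i j = (\<Sum>k<d. z i k * z j k)"

definition frobenius_norm :: "nat \<Rightarrow> (nat \<Rightarrow> nat \<Rightarrow> real) \<Rightarrow> real" where
  "frobenius_norm n B = sqrt (\<Sum>i<n. \<Sum>j<n. (B i j)\<^sup>2)"

definition loss ::
    "nat \<Rightarrow> nat \<Rightarrow> (nat \<Rightarrow> nat \<Rightarrow> real) \<Rightarrow> (nat \<Rightarrow> nat \<Rightarrow> real) \<Rightarrow> real" where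
  "loss n d X Y =
     real d / (real n * (real n + 1)) * (frobenius_norm n (\<lambda>i j. X i j - Y i j))\<^sup>2"

definition binary_entropy :: "real \<Rightarrow> real" where
  "binary_entropy p = - p * ln p - (1 - p) * ln (1 - p)"

(* An entry of A has type bool option: None is the missing observation, Some False and Some True
   are the bits 0 and 1.  This is the sigma-algebra on the sample space of M generated by
   (A i j) for i, j < n. *)
definition obs_algebra ::
    "'w measure \<Rightarrow> nat \<Rightarrow> (nat \<Rightarrow> nat \<Rightarrow> 'w \<Rightarrow> bool option) \<Rightarrow> 'w measure" where
  "obs_algebra M n A =
     vimage_algebra (space M) (\<lambda>\<omega>. \<lambda>(i, j)\<in>{..<n} \<times> {..<n}. A i j \<omega>)
       (\<Pi>\<^sub>M ij\<in>{..<n} \<times> {..<n}. count_space (UNIV :: bool option set))"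

lemma prob_space_gaussian_law:
  assumes "d > 0"
  shows "prob_space (gaussian_law d)"
proof -
  have "prob_space (density lborel (\<lambda>x. ennreal (normal_density 0 (1 / sqrt (real d)) x)))"
    using assms by (intro prob_space_normal_density) simp
  then show ?thesis
    unfolding gaussian_law_def by (intro prob_space_PiM)
qed

lemma sets_unit_ball: "unit_ball d \<in> sets (\<Pi>\<^sub>M k\<in>{..<d}. (lborel :: real measure))"
proof -
  have "unit_ball d = {x \<in> space (\<Pi>\<^sub>M k\<in>{..<d}. (lborel :: real measure)). vec_norm d x \<le> 1}"
    by (auto simp: unit_ball_def space_PiM PiE_def)
  moreover have "(\<lambda>x. vec_norm d x) \<in> borel_measurable (\<Pi>\<^sub>M k\<in>{..<d}. (lborel :: real measure))"
    unfolding vec_norm_def by measurable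
  ultimately show ?thesis by simp
qed

lemma emeasure_unit_ball:
  "emeasure (\<Pi>\<^sub>M k\<in>{..<d}. (lborel :: real measure)) (unit_ball d) \<noteq> 0"
  "emeasure (\<Pi>\<^sub>M k\<in>{..<d}. (lborel :: real measure)) (unit_ball d) \<noteq> \<infinity>"
proof -
  interpret product_sigma_finite "\<lambda>_::nat. lborel :: real measure"
    by standard
  let ?L = "\<Pi>\<^sub>M k\<in>{..<d}. (lborel :: real measure)"
  have box: "emeasure ?L (\<Pi>\<^sub>E k\<in>{..<d}. {-a..a}) = ennreal ((2 * a) ^ d)" if "a \<ge> 0" for a
    using that by (subst emeasure_PiM) (simp_all add: ennreal_power)
  have boxm: "(\<Pi>\<^sub>E k\<in>{..<d}. {-a..a}) \<in> sets ?L" for a :: real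
    by (intro sets_PiM_I_finite) auto
  have lower: "(\<Pi>\<^sub>E k\<in>{..<d}. {-(1/(real d + 1))..1/(real d + 1)}) \<subseteq> unit_ball d"
  proof
    fix x :: "nat \<Rightarrow> real" assume x: "x \<in> (\<Pi>\<^sub>E k\<in>{..<d}. {-(1/(real d + 1))..1/(real d + 1)})"
    have "(\<Sum>k<d. (x k)\<^sup>2) \<le> (\<Sum>k<d. 1 / (real d + 1))"
    proof (rule sum_mono)
      fix k assume "k \<in> {..<d}"
      with x have "\<bar>x k\<bar> \<le> 1 / (real d + 1)" by (auto simp: PiE_def Pi_def abs_le_iff)
      then have "(x k)\<^sup>2 \<le> (1 / (real d + 1))\<^sup>2" by (metis abs_ge_zero power2_abs power_mono)
      also have "\<dots> \<le> 1 / (real d + 1)"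
        using power_decreasing[of 1 2 "1 / (real d + 1)"] by simp
      finally show "(x k)\<^sup>2 \<le> 1 / (real d + 1)" .
    qed
    also have "\<dots> \<le> 1" by (simp add: field_simps)
    finally show "x \<in> unit_ball d"
      using x by (auto simp: unit_ball_def vec_norm_def PiE_def)
  qed
  have upper: "unit_ball d \<subseteq> (\<Pi>\<^sub>E k\<in>{..<d}. {-1..1})"
  proof
    fix x assume x: "x \<in> unit_ball d"
    have "x k \<in> {-1..1}" if "k < d" for k
    proof -
      have "(x k)\<^sup>2 \<le> (\<Sum>k<d. (x k)\<^sup>2)" using that by (intro member_le_sum) auto
      also have "\<dots> \<le> 1" using x by (simp add: unit_ball_def vec_norm_def)
      finally show ?thesis by (simp add: abs_square_le_1 abs_le_iff)
    qed
    with x show "x \<in> (\<Pi>\<^sub>E k\<in>{..<d}. {-1..1})" by (auto simp: unit_ball_def PiE_def)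
  qed
  have "0 < ennreal ((2 * (1/(real d + 1))) ^ d)" by simp
  also have "\<dots> \<le> emeasure ?L (unit_ball d)"
    using emeasure_mono[OF lower sets_unit_ball] box[of "1/(real d + 1)"] by simp
  finally show "emeasure ?L (unit_ball d) \<noteq> 0" by simp
  have "emeasure ?L (unit_ball d) \<le> ennreal ((2 * 1) ^ d)"
    using emeasure_mono[OF upper boxm] box[of 1] by simp
  then show "emeasure ?L (unit_ball d) \<noteq> \<infinity>" by (auto simp: top_unique)
qed

lemma measurable_normalize:
  "(\<lambda>x. \<lambda>k\<in>{..<d}. x k / vec_norm d x) \<in>
     measurable (\<Pi>\<^sub>M k\<in>{..<d}. (lborel :: real measure)) (vec_space d)"
  unfolding vec_norm_def by measurable

lemma prob_space_sphere_law: "prob_space (sphere_law d)"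
proof -
  interpret U: prob_space "uniform_measure (\<Pi>\<^sub>M k\<in>{..<d}. (lborel :: real measure)) (unit_ball d)"
    by (intro prob_space_uniform_measure emeasure_unit_ball)
  show ?thesis
    unfolding sphere_law_def
    using measurable_normalize[of d] by (intro U.prob_space_distr) simp
qed

lemma AE_sphere_law:
  assumes "d > 0"
  shows "AE x in sphere_law d. vec_norm d x = 1"
proof -
  interpret product_sigma_finite "\<lambda>_::nat. lborel :: real measure"
    by standard
  let ?L = "\<Pi>\<^sub>M k\<in>{..<d}. (lborel :: real measure)"
  have "emeasure ?L (\<Pi>\<^sub>E k\<in>{..<d}. {0}) = (\<Prod>k<d. emeasure lborel {0::real})"
    by (subst emeasure_PiM) auto
  also have "\<dots> = 0" using assms by auto
  finally have "emeasure ?L (\<Pi>\<^sub>E k\<in>{..<d}. {0}) = 0" .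
  moreover have "(\<Pi>\<^sub>E k\<in>{..<d}. {0::real}) \<in> sets ?L"
    by (intro sets_PiM_I_finite) auto
  ultimately have "(\<Pi>\<^sub>E k\<in>{..<d}. {0::real}) \<in> null_sets ?L" by (rule null_setsI)
  then have "AE x in ?L. x \<notin> (\<Pi>\<^sub>E k\<in>{..<d}. {0::real})" by (rule AE_not_in)
  then have "AE x in ?L. x \<in> unit_ball d \<longrightarrow> vec_norm d (\<lambda>k\<in>{..<d}. x k / vec_norm d x) = 1"
  proof (rule AE_mp, intro AE_I2 impI)
    fix x assume "x \<notin> (\<Pi>\<^sub>E k\<in>{..<d}. {0::real})" and b: "x \<in> unit_ball d"
    then obtain k where k: "k < d" "x k \<noteq> 0"
      unfolding unit_ball_def PiE_def Pi_def by blast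
    have "0 < (x k)\<^sup>2" using k by simp
    also have "\<dots> \<le> (\<Sum>k<d. (x k)\<^sup>2)" using k by (intro member_le_sum) auto
    finally have pos: "0 < (\<Sum>k<d. (x k)\<^sup>2)" .
    have "(\<Sum>k<d. ((\<lambda>k\<in>{..<d}. x k / vec_norm d x) k)\<^sup>2) = (\<Sum>k<d. (x k)\<^sup>2 / (\<Sum>k<d. (x k)\<^sup>2))"
      using pos by (intro sum.cong) (auto simp: vec_norm_def power_divide)
    also have "\<dots> = 1" using pos by (simp flip: sum_divide_distrib)
    finally show "vec_norm d (\<lambda>k\<in>{..<d}. x k / vec_norm d x) = 1" unfolding vec_norm_def by simp
  qed
  then have "AE x in uniform_measure ?L (unit_ball d).
      vec_norm d (\<lambda>k\<in>{..<d}. x k / vec_norm d x) = 1"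
    by (intro AE_uniform_measureI sets_unit_ball)
  moreover have "{x \<in> space (vec_space d). vec_norm d x = 1} \<in> sets (vec_space d)"
    unfolding vec_norm_def by measurable
  ultimately show ?thesis
    unfolding sphere_law_def
    using measurable_normalize[of d] by (subst AE_distr_iff) simp_all
qed

end

theory Submission
  imports Defs
begin

text \<open>
  An estimator that depends on \<open>A\<close> only takes one value per observation pattern. By Markov's inequality
  at most \<open>4 n\<^sup>2 p\<close> entries are observed with probability at least \<open>3 / 4\<close>, and weighting every pattern by
  \<open>p\<close> per observed entry shows that there are at most \<open>exp (4 n\<^sup>2 (h(p) + p))\<close> such patterns; trivially there are
  at most \<open>3\<close> to the power \<open>n\<^sup>2\<close>. The dimension hypothesis turns the smaller of the two bounds into
  \<open>exp (K n min(n,d))\<close> with \<open>K\<close> depending on \<open>c\<close> only (\<open>card_sparse_patterns_bound\<close>). A union bound over the patterns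
  therefore reduces the theorem to a small ball estimate for one fixed matrix \<open>Y\<close>: for every \<open>K\<close> there is a
  \<open>\<tau> > 0\<close>, the same for all \<open>n\<close> and \<open>d\<close>, such that \<open>L(X, Y) \<le> \<tau>\<close> has probability at most \<open>exp (- K n min(n,d))\<close>
  (\<open>gram_loss_ball\<close>). The union bound holds for every joint law of \<open>A\<close> and \<open>X\<close>; hence the arbitrary observation model.

  For the small ball estimate the rows are cut into \<open>2 g\<close> blocks of \<open>a\<close> rows, with \<open>a\<close> of the order of
  \<open>min(n,d)\<close>. Pair block \<open>b\<close> of the first half with block \<open>b + \<sigma>\<close> (cyclically) of the second half: the pairs
  belonging to different shifts \<open>\<sigma>\<close> use disjoint entries of the matrix, so some shift carries at most the
  fraction \<open>1 / g\<close> of the squared error, and for one shift the \<open>g\<close> pairs are independent. With the exponential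
  Markov inequality (\<open>gram_small_ball_of_blocks\<close>) it remains to bound
  \<open>E exp (- \<lambda> \<parallel>U V\<^sup>T - Y\<parallel>\<^sup>2) \<le> exp (- L a\<^sup>2)\<close> for two independent blocks of \<open>a\<close> rows.

  Given \<open>U\<close>, the rows \<open>v\<close> of \<open>V\<close> are independent. A Gaussian \<open>v\<close> has density at most of order \<open>\<surd>d\<close> in every direction,
  conditionally on the orthogonal directions: the expectation of \<open>F v \<ge> 0\<close> is at most twice that of the average of
  \<open>F (v + c e)\<close> over \<open>\<bar>c\<bar> \<le> 1 / \<surd>d\<close>, by the Cameron-Martin formula (\<open>gaussian_average_shift\<close>,
  \<open>gaussian_integrate_direction\<close>). Hence adding a row \<open>u\<close> to \<open>U\<close> multiplies the conditional expectation by
  \<open>2 \<epsilon> / \<rho>\<close> for every row of \<open>V\<close>, where \<open>\<rho>\<close> is the distance of \<open>u\<close> from the span of the rows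
  before it; and \<open>\<rho>\<close> is rarely small because the complement of that span has dimension at least \<open>d / 2\<close>
  (\<open>gaussian_small_projection\<close>, \<open>block_affinity_bound\<close>).

  The uniform law on the sphere is the law of the direction of a Gaussian vector \<open>h\<close>, which is independent of \<open>\<bar>h\<bar>\<close>
  (\<open>gaussian_polar\<close>). Conditioning \<open>\<bar>h\<bar>\<close> to a window of width \<open>\<epsilon> / \<surd>d\<close> costs a factor of order
  \<open>1 / \<epsilon>\<close> per row, which the gain of order \<open>\<epsilon>\<close> to the power \<open>a / 2\<close> pays for as soon as \<open>a \<ge> 4\<close>. If
  \<open>min(n,d)\<close> is bounded, blocks of a single row suffice, and one only needs that
  \<open>\<bar>\<langle>u, v\<rangle> - y\<bar> \<le> \<epsilon> / \<surd>d\<close> is unlikely uniformly in \<open>d\<close> and \<open>y\<close>: in high dimension this follows from the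
  Gaussian case, and in each of the finitely many remaining dimensions from the absence of atoms. A single Gaussian
  row, where \<open>X\<close> is the number \<open>\<bar>z\<bar>\<^sup>2\<close>, is treated in the same way with dilations in place of translations.
\<close>

section \<open>Vectors as functions of the coordinate\<close>

definition dot :: "nat \<Rightarrow> (nat \<Rightarrow> real) \<Rightarrow> (nat \<Rightarrow> real) \<Rightarrow> real" where
  "dot d x y = (\<Sum>k<d. x k * y k)"

definition shift :: "nat \<Rightarrow> real \<Rightarrow> (nat \<Rightarrow> real) \<Rightarrow> (nat \<Rightarrow> real) \<Rightarrow> nat \<Rightarrow> real" where
  "shift d c e x = (\<lambda>k\<in>{..<d}. x k + c * e k)"

definition dilate :: "nat \<Rightarrow> real \<Rightarrow> (nat \<Rightarrow> real) \<Rightarrow> nat \<Rightarrow> real" where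
  "dilate d s x = (\<lambda>k\<in>{..<d}. s * x k)"

abbreviation lebesgue_vec :: "nat \<Rightarrow> (nat \<Rightarrow> real) measure" where
  "lebesgue_vec d \<equiv> \<Pi>\<^sub>M k\<in>{..<d}. (lborel :: real measure)"

definition gauss_density :: "nat \<Rightarrow> (nat \<Rightarrow> real) \<Rightarrow> real" where
  "gauss_density d x = (\<Prod>k<d. normal_density 0 (1 / sqrt (real d)) (x k))"

abbreviation rows :: "nat set \<Rightarrow> (nat \<Rightarrow> real) measure \<Rightarrow> (nat \<Rightarrow> nat \<Rightarrow> real) measure" where
  "rows I \<mu> \<equiv> \<Pi>\<^sub>M i\<in>I. \<mu>"

abbreviation slab :: "nat \<Rightarrow> (nat \<Rightarrow> real) \<Rightarrow> real \<Rightarrow> real \<Rightarrow> (nat \<Rightarrow> real) set" where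
  "slab d u y t \<equiv> {v \<in> space (vec_space d). \<bar>dot d u v - y\<bar> \<le> t}"

abbreviation norm_shell :: "nat \<Rightarrow> real \<Rightarrow> real \<Rightarrow> (nat \<Rightarrow> real) set" where
  "norm_shell d y t \<equiv> {h \<in> space (vec_space d). \<bar>dot d h h - y\<bar> \<le> t}"

abbreviation typical_norm :: "nat \<Rightarrow> (nat \<Rightarrow> real) set" where
  "typical_norm d \<equiv> {h \<in> space (vec_space d). \<bar>dot d h h - 1\<bar> < 12 / sqrt (real d)}"

interpretation lborel_product: product_sigma_finite "\<lambda>_::nat. lborel :: real measure"
  by standard

lemma sets_lebesgue_vec: "sets (lebesgue_vec d) = sets (vec_space d)"
  by (intro sets_PiM_cong) auto

lemma sets_gaussian_law: "sets (gaussian_law d) = sets (vec_space d)"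
  unfolding gaussian_law_def by (intro sets_PiM_cong) auto

lemma measurable_lebesgue_vec: "measurable (lebesgue_vec d) N = measurable (vec_space d) N"
  by (intro measurable_cong_sets sets_lebesgue_vec) auto

lemma measurable_shift:
  "shift d c e \<in> measurable (vec_space d) (vec_space d)"
  unfolding shift_def by measurable

lemma measurable_dilate [measurable]:
  "dilate d s \<in> measurable (vec_space d) (vec_space d)"
  unfolding dilate_def by measurable

lemma measurable_dot [measurable]:
  assumes "f \<in> measurable N (vec_space d)" "g \<in> measurable N (vec_space d)"
  shows "(\<lambda>x. dot d (f x) (g x)) \<in> borel_measurable N"
  using assms unfolding dot_def by measurable

lemma measurable_dot_const [measurable]:
  assumes "f \<in> measurable N (vec_space d)"
  shows "(\<lambda>x. dot d (f x) e) \<in> borel_measurable N" "(\<lambda>x. dot d e (f x)) \<in> borel_measurable N"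
  using assms unfolding dot_def by measurable

lemma measurable_vec_norm [measurable]:
  assumes "f \<in> measurable N (vec_space d)"
  shows "(\<lambda>x. vec_norm d (f x)) \<in> borel_measurable N"
  using assms unfolding vec_norm_def by measurable

section \<open>Translations and dilations of the Gaussian law\<close>

text \<open>Translations and dilations act on each coordinate separately, so Fubini reduces their Jacobian to one-dimensional substitutions.\<close>
lemma nn_integral_lebesgue_affine:
  fixes F :: "(nat \<Rightarrow> real) \<Rightarrow> ennreal"
  assumes "finite I" "s > 0" "F \<in> borel_measurable (\<Pi>\<^sub>M k\<in>I. (borel :: real measure))"
  shows "(\<integral>\<^sup>+x. F x \<partial>(\<Pi>\<^sub>M k\<in>I. lborel)) =
         ennreal (s ^ card I) * (\<integral>\<^sup>+x. F (\<lambda>k\<in>I. t k + s * x k) \<partial>(\<Pi>\<^sub>M k\<in>I. lborel))"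
  using assms(1,3)
proof (induction I arbitrary: F)
  case empty
  show ?case by (simp only: lborel_product.nn_integral_empty[OF zero_le] restrict_def) simp
next
  case (insert i I)
  interpret I: sigma_finite_measure "\<Pi>\<^sub>M k\<in>I. (lborel :: real measure)"
    by (rule lborel_product.sigma_finite) fact
  note F [measurable] = insert.prems
  have sets: "sets (\<Pi>\<^sub>M k\<in>J. (lborel :: real measure)) = sets (\<Pi>\<^sub>M k\<in>J. (borel :: real measure))" for J :: "nat set"
    by (intro sets_PiM_cong) auto
  note [measurable_cong] = sets
  have [measurable]: "(\<lambda>x. x(i := y)) \<in> measurable (\<Pi>\<^sub>M k\<in>I. borel) (\<Pi>\<^sub>M k\<in>insert i I. (borel :: real measure))" for y :: real
    by measurable
  have "(\<integral>\<^sup>+x. F x \<partial>(\<Pi>\<^sub>M k\<in>insert i I. lborel)) = (\<integral>\<^sup>+y. (\<integral>\<^sup>+x. F (x(i := y)) \<partial>(\<Pi>\<^sub>M k\<in>I. lborel)) \<partial>lborel)"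
    using insert.hyps by (intro lborel_product.product_nn_integral_insert_rev) auto
  also have "\<dots> = (\<integral>\<^sup>+y. ennreal (s ^ card I) * (\<integral>\<^sup>+x. F ((\<lambda>k\<in>I. t k + s * x k)(i := y)) \<partial>(\<Pi>\<^sub>M k\<in>I. lborel)) \<partial>lborel)"
    by (intro nn_integral_cong insert.IH) measurable
  also have "\<dots> = ennreal (s ^ card I) * (\<integral>\<^sup>+y. (\<integral>\<^sup>+x. F ((\<lambda>k\<in>I. t k + s * x k)(i := y)) \<partial>(\<Pi>\<^sub>M k\<in>I. lborel)) \<partial>lborel)"
    by (intro nn_integral_cmult) measurable
  also have "\<dots> = ennreal (s ^ card I) * (ennreal s * (\<integral>\<^sup>+y. (\<integral>\<^sup>+x. F ((\<lambda>k\<in>I. t k + s * x k)(i := t i + s * y)) \<partial>(\<Pi>\<^sub>M k\<in>I. lborel)) \<partial>lborel))"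
    using assms(2) nn_integral_real_affine[where c=s and t="t i" and f="\<lambda>y. \<integral>\<^sup>+x. F ((\<lambda>k\<in>I. t k + s * x k)(i := y)) \<partial>(\<Pi>\<^sub>M k\<in>I. lborel)"] by simp
  also have "(\<integral>\<^sup>+y. (\<integral>\<^sup>+x. F ((\<lambda>k\<in>I. t k + s * x k)(i := t i + s * y)) \<partial>(\<Pi>\<^sub>M k\<in>I. lborel)) \<partial>lborel)
      = (\<integral>\<^sup>+y. (\<integral>\<^sup>+x. F (\<lambda>k\<in>insert i I. t k + s * (x(i := y)) k) \<partial>(\<Pi>\<^sub>M k\<in>I. lborel)) \<partial>lborel)"
    using insert.hyps by (intro nn_integral_cong arg_cong[where f=F]) auto
  also have "\<dots> = (\<integral>\<^sup>+x. F (\<lambda>k\<in>insert i I. t k + s * x k) \<partial>(\<Pi>\<^sub>M k\<in>insert i I. lborel))"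
    using insert.hyps by (intro lborel_product.product_nn_integral_insert_rev[symmetric]) auto
  finally have "(\<integral>\<^sup>+x. F x \<partial>(\<Pi>\<^sub>M k\<in>insert i I. lborel)) = (ennreal (s ^ card I) * ennreal s) *
      (\<integral>\<^sup>+x. F (\<lambda>k\<in>insert i I. t k + s * x k) \<partial>(\<Pi>\<^sub>M k\<in>insert i I. lborel))"
    by (simp only: mult.assoc)
  moreover have "ennreal (s ^ card I) * ennreal s = ennreal (s ^ card (insert i I))"
    using insert.hyps assms(2) by (simp add: ennreal_mult[symmetric] mult.commute)
  ultimately show ?case by (simp only:)
qed

lemma nn_integral_PiM_density:
  fixes F :: "(nat \<Rightarrow> real) \<Rightarrow> ennreal" and g :: "real \<Rightarrow> real"
  assumes "finite I" and [measurable]: "g \<in> borel_measurable borel"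
    and pr: "prob_space (density lborel (\<lambda>x. ennreal (g x)))"
    and "F \<in> borel_measurable (\<Pi>\<^sub>M k\<in>I. (borel :: real measure))"
  shows "(\<integral>\<^sup>+x. F x \<partial>(\<Pi>\<^sub>M k\<in>I. density lborel (\<lambda>x. ennreal (g x)))) =
         (\<integral>\<^sup>+x. (\<Prod>k\<in>I. ennreal (g (x k))) * F x \<partial>(\<Pi>\<^sub>M k\<in>I. lborel))"
  using assms(1,4)
proof (induction I arbitrary: F)
  case empty
  interpret D: prob_space "density lborel (\<lambda>x. ennreal (g x))" by fact
  interpret D: product_sigma_finite "\<lambda>_::nat. density lborel (\<lambda>x. ennreal (g x))" by standard
  show ?case by (simp add: lborel_product.nn_integral_empty D.nn_integral_empty)
next
  case (insert i I)
  interpret I: sigma_finite_measure "\<Pi>\<^sub>M k\<in>I. (lborel :: real measure)"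
    by (rule lborel_product.sigma_finite) fact
  interpret D: prob_space "density lborel (\<lambda>x. ennreal (g x))" by fact
  interpret D: product_sigma_finite "\<lambda>_::nat. density lborel (\<lambda>x. ennreal (g x))" by standard
  note F [measurable] = insert.prems
  have sets: "sets (\<Pi>\<^sub>M k\<in>J. (lborel :: real measure)) = sets (\<Pi>\<^sub>M k\<in>J. (borel :: real measure))"
   "sets (\<Pi>\<^sub>M k\<in>J. density lborel (\<lambda>x. ennreal (g x))) = sets (\<Pi>\<^sub>M k\<in>J. (borel :: real measure))" for J :: "nat set"
    by (intro sets_PiM_cong; auto)+
  note [measurable_cong] = sets
  have [measurable]: "(\<lambda>x. x(i := y)) \<in> measurable (\<Pi>\<^sub>M k\<in>I. borel) (\<Pi>\<^sub>M k\<in>insert i I. (borel :: real measure))" for y :: real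
    by measurable
  have "(\<integral>\<^sup>+x. F x \<partial>(\<Pi>\<^sub>M k\<in>insert i I. density lborel (\<lambda>x. ennreal (g x)))) = 
     (\<integral>\<^sup>+y. (\<integral>\<^sup>+x. F (x(i := y)) \<partial>(\<Pi>\<^sub>M k\<in>I. density lborel (\<lambda>x. ennreal (g x)))) \<partial>density lborel (\<lambda>x. ennreal (g x)))"
    using insert.hyps by (intro D.product_nn_integral_insert_rev) auto
  also have "\<dots> = (\<integral>\<^sup>+y. (\<integral>\<^sup>+x. (\<Prod>k\<in>I. ennreal (g (x k))) * F (x(i := y)) \<partial>(\<Pi>\<^sub>M k\<in>I. lborel)) \<partial>density lborel (\<lambda>x. ennreal (g x)))"
    by (intro nn_integral_cong insert.IH) measurable
  also have "\<dots> = (\<integral>\<^sup>+y. ennreal (g y) * (\<integral>\<^sup>+x. (\<Prod>k\<in>I. ennreal (g (x k))) * F (x(i := y)) \<partial>(\<Pi>\<^sub>M k\<in>I. lborel)) \<partial>lborel)"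
    by (intro nn_integral_density) measurable
  also have "\<dots> = (\<integral>\<^sup>+y. (\<integral>\<^sup>+x. ennreal (g y) * ((\<Prod>k\<in>I. ennreal (g (x k))) * F (x(i := y))) \<partial>(\<Pi>\<^sub>M k\<in>I. lborel)) \<partial>lborel)"
    by (intro nn_integral_cong nn_integral_cmult[symmetric]) measurable
  also have "\<dots> = (\<integral>\<^sup>+y. (\<integral>\<^sup>+x. (\<Prod>k\<in>insert i I. ennreal (g ((x(i:=y)) k))) * F (x(i := y)) \<partial>(\<Pi>\<^sub>M k\<in>I. lborel)) \<partial>lborel)"
  proof -
    have "(\<Prod>k\<in>I. ennreal (g ((x(i:=y)) k))) = (\<Prod>k\<in>I. ennreal (g (x k)))" for x y
      using insert.hyps by (intro prod.cong) auto
    then show ?thesis using insert.hyps by (simp add: mult.assoc)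
  qed
  also have "\<dots> = (\<integral>\<^sup>+x. (\<Prod>k\<in>insert i I. ennreal (g (x k))) * F x \<partial>(\<Pi>\<^sub>M k\<in>insert i I. lborel))"
    using insert.hyps by (intro lborel_product.product_nn_integral_insert_rev[symmetric]) auto
  finally show ?case .
qed

lemma vec_norm_sq: "(vec_norm d x)\<^sup>2 = dot d x x"
  unfolding vec_norm_def dot_def by (simp add: sum_nonneg power2_eq_square)

lemma dot_nonneg: "dot d x x \<ge> 0"
  unfolding dot_def by (simp add: sum_nonneg)

lemma dot_commute: "dot d x y = dot d y x"
  unfolding dot_def by (simp add: mult.commute)

lemma dot_shift: "dot d (shift d c e x) y = dot d x y + c * dot d e y"
  unfolding dot_def shift_def by (simp add: algebra_simps sum.distrib sum_distrib_left)

lemma dot_shift_right: "dot d y (shift d c e x) = dot d y x + c * dot d y e"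
  by (simp add: dot_commute[of d y] dot_shift)

lemma dot_dilate: "dot d (dilate d s x) y = s * dot d x y"
  unfolding dot_def dilate_def by (simp add: algebra_simps sum_distrib_left)

lemma dot_dilate_right: "dot d y (dilate d s x) = s * dot d y x"
  by (simp add: dot_commute[of d y] dot_dilate)

lemma gauss_density_eq:
  assumes "d > 0"
  shows "gauss_density d x = (1 / sqrt (2 * pi / d)) ^ d * exp (- real d / 2 * dot d x x)"
proof -
  have "normal_density 0 (1 / sqrt (real d)) t = 1 / sqrt (2 * pi / d) * exp (- real d / 2 * (t * t))" for t
    using assms by (simp add: normal_density_def power_divide power2_eq_square)
  then show ?thesis
    unfolding gauss_density_def dot_def
    by (simp only: prod.distrib sum_distrib_left exp_sum finite_lessThan) simp
qed

lemma nn_integral_gaussian_law: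
  assumes "d > 0" and [measurable]: "F \<in> borel_measurable (vec_space d)"
  shows "(\<integral>\<^sup>+x. F x \<partial>gaussian_law d) = (\<integral>\<^sup>+x. ennreal (gauss_density d x) * F x \<partial>lebesgue_vec d)"
proof -
  have "prob_space (density lborel (\<lambda>x. ennreal (normal_density 0 (1 / sqrt (real d)) x)))"
    using assms by (intro prob_space_normal_density) simp
  then have "(\<integral>\<^sup>+x. F x \<partial>gaussian_law d) =
    (\<integral>\<^sup>+x. (\<Prod>k<d. ennreal (normal_density 0 (1 / sqrt (real d)) (x k))) * F x \<partial>lebesgue_vec d)"
    unfolding gaussian_law_def by (intro nn_integral_PiM_density) auto
  then show ?thesis unfolding gauss_density_def by (simp add: prod_ennreal)
qed

lemma measurable_gauss_density: "gauss_density d \<in> borel_measurable (vec_space d)"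
  unfolding gauss_density_def by measurable

text \<open>The Cameron-Martin formula.\<close>
lemma nn_integral_gaussian_shift:
  assumes d: "d > 0" and F [measurable]: "F \<in> borel_measurable (vec_space d)"
  shows "(\<integral>\<^sup>+v. F (shift d c e v) \<partial>gaussian_law d) =
         (\<integral>\<^sup>+v. ennreal (exp (d * c * dot d v e - d * c\<^sup>2 * dot d e e / 2)) * F v \<partial>gaussian_law d)"
proof -
  note [measurable] = measurable_shift measurable_gauss_density
  define w where "w v = exp (d * c * dot d v e - d * c\<^sup>2 * dot d e e / 2)" for v
  have [measurable]: "w \<in> borel_measurable (vec_space d)" unfolding w_def by measurable
  have "(\<integral>\<^sup>+v. ennreal (w v) * F v \<partial>gaussian_law d) =
      (\<integral>\<^sup>+v. ennreal (gauss_density d v) * (ennreal (w v) * F v) \<partial>lebesgue_vec d)"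
    by (intro nn_integral_gaussian_law d) measurable
  also have "\<dots> = (\<integral>\<^sup>+v. ennreal (gauss_density d (shift d c e v)) * (ennreal (w (shift d c e v)) * F (shift d c e v)) \<partial>lebesgue_vec d)"
    using nn_integral_lebesgue_affine[of "{..<d}" 1 "\<lambda>v. ennreal (gauss_density d v) * (ennreal (w v) * F v)" "\<lambda>k. c * e k"]
    by (simp add: shift_def add.commute)
  also have "\<dots> = (\<integral>\<^sup>+v. ennreal (gauss_density d v) * F (shift d c e v) \<partial>lebesgue_vec d)"
  proof (intro nn_integral_cong)
    fix v
    have "gauss_density d (shift d c e v) * w (shift d c e v) = gauss_density d v"
      unfolding gauss_density_eq[OF d] w_def
      by (simp add: dot_shift dot_shift_right mult.assoc mult_exp_exp)
         (simp add: algebra_simps power2_eq_square dot_commute[of d e v])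
    moreover have "w (shift d c e v) \<ge> 0" by (simp add: w_def)
    ultimately show "ennreal (gauss_density d (shift d c e v)) * (ennreal (w (shift d c e v)) * F (shift d c e v)) = ennreal (gauss_density d v) * F (shift d c e v)"
      by (metis ennreal_mult'' mult.assoc)
  qed
  also have "\<dots> = (\<integral>\<^sup>+v. F (shift d c e v) \<partial>gaussian_law d)"
    by (intro nn_integral_gaussian_law[symmetric] d) measurable
  finally show ?thesis by (simp add: w_def)
qed

text \<open>The analogue of the Cameron-Martin formula for dilations. For the constant function \<open>1\<close> the two formulas evaluate the exponential moments of linear forms and of the squared norm.\<close>
lemma nn_integral_gaussian_dilate:
  assumes d: "d > 0" and s: "s > 0" and F [measurable]: "F \<in> borel_measurable (vec_space d)"
  shows "(\<integral>\<^sup>+v. F (dilate d s v) \<partial>gaussian_law d) =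
         (\<integral>\<^sup>+v. ennreal (exp (real d / 2 * dot d v v * (1 - 1 / s\<^sup>2)) / s ^ d) * F v \<partial>gaussian_law d)"
proof -
  note [measurable] = measurable_gauss_density
  define w where "w v = exp (real d / 2 * dot d v v * (1 - 1 / s\<^sup>2)) / s ^ d" for v
  have [measurable]: "w \<in> borel_measurable (vec_space d)" unfolding w_def by measurable
  have "(\<integral>\<^sup>+v. ennreal (w v) * F v \<partial>gaussian_law d) =
      (\<integral>\<^sup>+v. ennreal (gauss_density d v) * (ennreal (w v) * F v) \<partial>lebesgue_vec d)"
    by (intro nn_integral_gaussian_law d) measurable
  also have "\<dots> = ennreal (s ^ d) * (\<integral>\<^sup>+v. ennreal (gauss_density d (dilate d s v)) * (ennreal (w (dilate d s v)) * F (dilate d s v)) \<partial>lebesgue_vec d)"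
    using nn_integral_lebesgue_affine[of "{..<d}" s "\<lambda>v. ennreal (gauss_density d v) * (ennreal (w v) * F v)" "\<lambda>k. 0"] s
    by (simp add: dilate_def)
  also have "\<dots> = (\<integral>\<^sup>+v. ennreal (s ^ d) * (ennreal (gauss_density d (dilate d s v)) * (ennreal (w (dilate d s v)) * F (dilate d s v))) \<partial>lebesgue_vec d)"
    by (intro nn_integral_cmult[symmetric]) (simp add: measurable_lebesgue_vec)
  also have "\<dots> = (\<integral>\<^sup>+v. ennreal (gauss_density d v) * F (dilate d s v) \<partial>lebesgue_vec d)"
  proof (intro nn_integral_cong)
    fix v
    have "s ^ d * (gauss_density d (dilate d s v) * w (dilate d s v)) = gauss_density d v"
      unfolding gauss_density_eq[OF d] w_def using s
      by (simp add: dot_dilate dot_dilate_right mult.assoc mult_exp_exp)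
         (use d in \<open>simp add: field_simps power2_eq_square\<close>)
    moreover have "w (dilate d s v) \<ge> 0" "s ^ d \<ge> 0" using s by (simp_all add: w_def)
    ultimately show "ennreal (s ^ d) * (ennreal (gauss_density d (dilate d s v)) * (ennreal (w (dilate d s v)) * F (dilate d s v))) = ennreal (gauss_density d v) * F (dilate d s v)"
      by (metis ennreal_mult'' ennreal_mult' mult.assoc)
  qed
  also have "\<dots> = (\<integral>\<^sup>+v. F (dilate d s v) \<partial>gaussian_law d)"
    by (intro nn_integral_gaussian_law[symmetric] d) measurable
  finally show ?thesis by (simp add: w_def)
qed

section \<open>Averaging over translations\<close>

text \<open>From \<open>exp x \<ge> 1 + x\<close>, whose linear part integrates to \<open>0\<close>.\<close>
lemma interval_exp_integral:
  fixes A s :: real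
  assumes s: "s > 0"
  shows "ennreal (2 * s) \<le> (\<integral>\<^sup>+c. ennreal (exp (A * c)) * indicator {-s..s} c \<partial>lborel)"
proof -
  have cont: "continuous_on {-s..s} (\<lambda>c. 1 + A * c)" "continuous_on {-s..s} (\<lambda>c. exp (A * c))"
    by (intro continuous_intros)+
  have "ennreal (2 * s) = ennreal (\<integral>c. (1 + A * c) * indicator {-s..s} c \<partial>lborel)"
  proof -
    have "(\<integral>c. (1 + A * c) * indicator {-s..s} c \<partial>lborel) = (s + A * s\<^sup>2 / 2) - (- s + A * (-s)\<^sup>2 / 2)"
      using s by (intro integral_FTC_Icc_real) (auto intro!: derivative_eq_intros continuous_intros)
    then show ?thesis by simp
  qed
  also have "\<dots> \<le> ennreal (\<integral>c. exp (A * c) * indicator {-s..s} c \<partial>lborel)"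
  proof (intro ennreal_leI integral_mono)
    show "integrable lborel (\<lambda>c. (1 + A * c) * indicator {-s..s} c)"
      using borel_integrable_atLeastAtMost'[OF cont(1)] by (simp add: set_integrable_def mult.commute)
    show "integrable lborel (\<lambda>c. exp (A * c) * indicator {-s..s} c)"
      using borel_integrable_atLeastAtMost'[OF cont(2)] by (simp add: set_integrable_def mult.commute)
  qed (auto intro!: mult_right_mono exp_ge_add_one_self)
  also have "\<dots> = (\<integral>\<^sup>+c. ennreal (exp (A * c) * indicator {-s..s} c) \<partial>lborel)"
    using borel_integrable_atLeastAtMost'[OF cont(2)]
    by (intro nn_integral_eq_integral[symmetric]) (auto simp: set_integrable_def mult.commute)
  also have "\<dots> = (\<integral>\<^sup>+c. ennreal (exp (A * c)) * indicator {-s..s} c \<partial>lborel)"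
    by (intro nn_integral_cong) (auto simp: indicator_def)
  finally show ?thesis .
qed

lemma measurable_shift_pair:
  "(\<lambda>(c, v). shift d c e v) \<in> measurable (borel \<Otimes>\<^sub>M vec_space d) (vec_space d)"
  unfolding shift_def by measurable

text \<open>Up to a constant, the law of \<open>v\<close> is dominated by the law of \<open>v + c e\<close> with \<open>c\<close> uniform in
  \<open>[-1/\<surd>d, 1/\<surd>d]\<close>: the relative density is the average of \<open>exp (d c \<langle>v,e\<rangle> - d c\<^sup>2 / 2)\<close>, where the linear part
  of the exponent contributes at least \<open>1\<close> on average (\<open>interval_exp_integral\<close>) and the quadratic part at least \<open>exp (- 1 / 2)\<close>.\<close>
lemma gaussian_average_shift:
  assumes d: "d > 0" and e: "dot d e e = 1" and F [measurable]: "F \<in> borel_measurable (vec_space d)"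
  shows "ennreal (1 / sqrt d) * (\<integral>\<^sup>+v. F v \<partial>gaussian_law d) \<le>
    (\<integral>\<^sup>+v. (\<integral>\<^sup>+c. F (shift d c e v) * indicator {-(1 / sqrt d)..1 / sqrt d} c \<partial>lborel) \<partial>gaussian_law d)"
proof -
  define s where "s = 1 / sqrt (real d)"
  have s: "s > 0" "real d * s\<^sup>2 = 1" using d by (simp_all add: s_def power_divide)
  note [measurable_cong] = sets_gaussian_law
  note [measurable] = measurable_shift_pair
  interpret G: prob_space "gaussian_law d" using d by (rule prob_space_gaussian_law)
  interpret GL: pair_sigma_finite "gaussian_law d" lborel by standard
  have [measurable]: "(\<lambda>(v, c). F (shift d c e v)) \<in> borel_measurable (gaussian_law d \<Otimes>\<^sub>M lborel)"
  proof -
    have "(\<lambda>p. F (case (snd p, fst p) of (c, v) \<Rightarrow> shift d c e v)) \<in> borel_measurable (gaussian_law d \<Otimes>\<^sub>M lborel)"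
      by measurable
    then show ?thesis by (simp add: case_prod_beta)
  qed
  have "ennreal s \<le> ennreal (exp (- (1 / 2))) * ennreal (2 * s)"
  proof -
    have "exp (1 / 2 :: real) \<le> 2"
    proof -
      have "exp (1/2 :: real) ^ 2 = exp 1" by (simp add: exp_of_nat_mult[symmetric])
      also have "\<dots> \<le> 2 ^ 2" using exp_le by simp
      finally show ?thesis by (rule power2_le_imp_le) simp
    qed
    then have "s \<le> exp (- (1 / 2)) * (2 * s)"
      using s by (simp add: exp_minus field_simps)
    then show ?thesis using s by (simp add: ennreal_mult[symmetric])
  qed
  also have "\<dots> \<le> ennreal (exp (- (1 / 2))) * (\<integral>\<^sup>+c. ennreal (exp (A * c)) * indicator {-s..s} c \<partial>lborel)" for A
    by (intro mult_left_mono interval_exp_integral s) auto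
  finally have int: "ennreal s \<le> ennreal (exp (- (1 / 2))) * (\<integral>\<^sup>+c. ennreal (exp (A * c)) * indicator {-s..s} c \<partial>lborel)" for A .
  have "ennreal s * (\<integral>\<^sup>+v. F v \<partial>gaussian_law d) = (\<integral>\<^sup>+v. ennreal s * F v \<partial>gaussian_law d)"
    by (intro nn_integral_cmult[symmetric]) measurable
  also have "\<dots> \<le> (\<integral>\<^sup>+v. (\<integral>\<^sup>+c. (ennreal (exp (d * c * dot d v e - d * c\<^sup>2 * dot d e e / 2)) * F v) * indicator {-s..s} c \<partial>lborel) \<partial>gaussian_law d)"
  proof (intro nn_integral_mono)
    fix v
    have "ennreal s * F v \<le> (ennreal (exp (- (1 / 2))) * (\<integral>\<^sup>+c. ennreal (exp ((d * dot d v e) * c)) * indicator {-s..s} c \<partial>lborel)) * F v"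
      by (intro mult_right_mono int) auto
    also have "\<dots> = (\<integral>\<^sup>+c. ennreal (exp (- (1 / 2))) * (ennreal (exp ((d * dot d v e) * c)) * indicator {-s..s} c) * F v \<partial>lborel)"
      by (subst nn_integral_cmult[symmetric]; (subst nn_integral_multc[symmetric])?) auto
    also have "\<dots> \<le> (\<integral>\<^sup>+c. (ennreal (exp (d * c * dot d v e - d * c\<^sup>2 * dot d e e / 2)) * F v) * indicator {-s..s} c \<partial>lborel)"
    proof (intro nn_integral_mono)
      fix c :: real
      show "ennreal (exp (- (1 / 2))) * (ennreal (exp ((d * dot d v e) * c)) * indicator {-s..s} c) * F v \<le>
        (ennreal (exp (d * c * dot d v e - d * c\<^sup>2 * dot d e e / 2)) * F v) * indicator {-s..s} c"
      proof (cases "c \<in> {-s..s}")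
        case True
        then have "c\<^sup>2 \<le> s\<^sup>2" by (intro abs_le_square_iff[THEN iffD1]) auto
        then have "d * c\<^sup>2 \<le> d * s\<^sup>2" by (intro mult_left_mono) auto
        then have "d * c\<^sup>2 \<le> 1" using s by simp
        then have "exp (- (1 / 2)) * exp ((d * dot d v e) * c) \<le> exp (d * c * dot d v e - d * c\<^sup>2 * dot d e e / 2)"
          using e by (simp add: mult_exp_exp mult.commute mult.left_commute)
        then have "ennreal (exp (- (1 / 2))) * ennreal (exp ((d * dot d v e) * c)) \<le> ennreal (exp (d * c * dot d v e - d * c\<^sup>2 * dot d e e / 2))"
          by (simp add: ennreal_mult[symmetric])
        then show ?thesis using True by (simp add: mult_right_mono)
      qed simp
    qed
    finally show "ennreal s * F v \<le> (\<integral>\<^sup>+c. (ennreal (exp (d * c * dot d v e - d * c\<^sup>2 * dot d e e / 2)) * F v) * indicator {-s..s} c \<partial>lborel)" .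
  qed
  also have "\<dots> = (\<integral>\<^sup>+c. (\<integral>\<^sup>+v. (ennreal (exp (d * c * dot d v e - d * c\<^sup>2 * dot d e e / 2)) * F v) * indicator {-s..s} c \<partial>gaussian_law d) \<partial>lborel)"
    by (rule GL.Fubini'[symmetric]) measurable
  also have "\<dots> = (\<integral>\<^sup>+c. (\<integral>\<^sup>+v. ennreal (exp (d * c * dot d v e - d * c\<^sup>2 * dot d e e / 2)) * F v \<partial>gaussian_law d) * indicator {-s..s} c \<partial>lborel)"
    by (intro nn_integral_cong nn_integral_multc) measurable
  also have "\<dots> = (\<integral>\<^sup>+c. (\<integral>\<^sup>+v. F (shift d c e v) \<partial>gaussian_law d) * indicator {-s..s} c \<partial>lborel)"
    by (simp only: nn_integral_gaussian_shift[OF d F])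
  also have "\<dots> = (\<integral>\<^sup>+c. (\<integral>\<^sup>+v. F (shift d c e v) * indicator {-s..s} c \<partial>gaussian_law d) \<partial>lborel)"
    by (intro nn_integral_cong nn_integral_multc[symmetric]) (use measurable_shift in measurable)
  also have "\<dots> = (\<integral>\<^sup>+v. (\<integral>\<^sup>+c. F (shift d c e v) * indicator {-s..s} c \<partial>lborel) \<partial>gaussian_law d)"
    by (rule GL.Fubini') measurable
  finally show ?thesis by (simp add: s_def)
qed

text \<open>This says that the conditional density of \<open>\<langle>u,v\<rangle>\<close>, given the part of \<open>v\<close> orthogonal to \<open>e\<close>, is at most
  \<open>\<surd>d / \<rho>\<close>. The average over the translations along \<open>e\<close> leaves \<open>H\<close> alone and integrates \<open>g\<close> over a line.\<close>
lemma gaussian_integrate_direction: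
  fixes H :: "(nat \<Rightarrow> real) \<Rightarrow> ennreal" and g :: "real \<Rightarrow> ennreal"
  assumes d: "d > 0" and e: "dot d e e = 1" and H [measurable]: "H \<in> borel_measurable (vec_space d)"
    and inv: "\<And>v c. H (shift d c e v) = H v"
    and g [measurable]: "g \<in> borel_measurable borel"
    and \<rho>: "dot d u e = \<rho>" "\<rho> > 0"
  shows "(\<integral>\<^sup>+v. H v * g (dot d u v) \<partial>gaussian_law d) \<le>
         ennreal (sqrt d / \<rho>) * (\<integral>\<^sup>+x. g x \<partial>lborel) * (\<integral>\<^sup>+v. H v \<partial>gaussian_law d)"
proof -
  define s where "s = 1 / sqrt (real d)"
  note [measurable_cong] = sets_gaussian_law
  have "ennreal s * (\<integral>\<^sup>+v. H v * g (dot d u v) \<partial>gaussian_law d) \<le>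
     (\<integral>\<^sup>+v. (\<integral>\<^sup>+c. (H (shift d c e v) * g (dot d u (shift d c e v))) * indicator {-s..s} c \<partial>lborel) \<partial>gaussian_law d)"
    unfolding s_def by (intro gaussian_average_shift d e) measurable
  also have "\<dots> \<le> (\<integral>\<^sup>+v. (\<integral>\<^sup>+c. H v * g (dot d u v + \<rho> * c) \<partial>lborel) \<partial>gaussian_law d)"
    using \<rho> by (intro nn_integral_mono) (auto simp: inv dot_shift_right mult.commute indicator_def)
  also have "\<dots> = (\<integral>\<^sup>+v. H v * (\<integral>\<^sup>+c. g (dot d u v + \<rho> * c) \<partial>lborel) \<partial>gaussian_law d)"
    by (intro nn_integral_cong nn_integral_cmult) measurable
  also have "\<dots> = (\<integral>\<^sup>+v. H v * (ennreal (1 / \<rho>) * (\<integral>\<^sup>+x. g x \<partial>lborel)) \<partial>gaussian_law d)"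
  proof -
    have "ennreal (1 / \<rho>) * (\<integral>\<^sup>+x. g x \<partial>lborel) = (\<integral>\<^sup>+c. g (t + \<rho> * c) \<partial>lborel)" for t
      using \<rho> by (subst nn_integral_real_affine[of g \<rho> t])
        (auto simp: mult.assoc[symmetric] ennreal_mult[symmetric])
    then show ?thesis by simp
  qed
  also have "\<dots> = (\<integral>\<^sup>+v. H v \<partial>gaussian_law d) * (ennreal (1 / \<rho>) * (\<integral>\<^sup>+x. g x \<partial>lborel))"
    by (intro nn_integral_multc) measurable
  finally have le: "ennreal s * (\<integral>\<^sup>+v. H v * g (dot d u v) \<partial>gaussian_law d) \<le> \<dots>" .
  have "(\<integral>\<^sup>+v. H v * g (dot d u v) \<partial>gaussian_law d) = ennreal (sqrt d) * (ennreal s * (\<integral>\<^sup>+v. H v * g (dot d u v) \<partial>gaussian_law d))"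
    using d by (simp add: s_def mult.assoc[symmetric] ennreal_mult[symmetric])
  also have "\<dots> \<le> ennreal (sqrt d) * ((\<integral>\<^sup>+v. H v \<partial>gaussian_law d) * (ennreal (1 / \<rho>) * (\<integral>\<^sup>+x. g x \<partial>lborel)))"
    by (intro mult_left_mono le) auto
  also have "\<dots> = (ennreal (sqrt d) * ennreal (1 / \<rho>)) * (\<integral>\<^sup>+x. g x \<partial>lborel) * (\<integral>\<^sup>+v. H v \<partial>gaussian_law d)"
    by (simp only: ac_simps)
  also have "ennreal (sqrt d) * ennreal (1 / \<rho>) = ennreal (sqrt d / \<rho>)"
    using \<rho> by (simp add: ennreal_mult[symmetric])
  finally show ?thesis .
qed

definition bump :: "real \<Rightarrow> real \<Rightarrow> real \<Rightarrow> real" where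
  "bump lam y x = exp (- lam * (x - y)\<^sup>2)"

lemma measurable_bump [measurable]: "bump lam y \<in> borel_measurable borel"
  unfolding bump_def by measurable

lemma bump_pos: "bump lam y x > 0" by (simp add: bump_def)

lemma bump_le_1: "lam \<ge> 0 \<Longrightarrow> bump lam y x \<le> 1" by (simp add: bump_def)

lemma nn_integral_bump:
  assumes "lam > 0"
  shows "(\<integral>\<^sup>+x. ennreal (bump lam y x) \<partial>lborel) = ennreal (sqrt (pi / lam))"
proof -
  define \<sigma> where "\<sigma> = 1 / sqrt (2 * lam)"
  have \<sigma>: "\<sigma> > 0" "\<sigma>\<^sup>2 = 1 / (2 * lam)" using assms by (simp_all add: \<sigma>_def power_divide)
  interpret N: prob_space "density lborel (\<lambda>x. ennreal (normal_density y \<sigma> x))"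
    using \<sigma> by (intro prob_space_normal_density)
  have "normal_density y \<sigma> x = sqrt (lam / pi) * bump lam y x" for x
    using assms unfolding normal_density_def bump_def \<sigma>
    by (simp add: real_sqrt_divide field_simps)
  then have "(\<integral>\<^sup>+x. ennreal (sqrt (lam / pi) * bump lam y x) \<partial>lborel) = 1"
    using N.emeasure_space_1 by (simp add: emeasure_density)
  then have *: "ennreal (sqrt (lam / pi)) * (\<integral>\<^sup>+x. ennreal (bump lam y x) \<partial>lborel) = 1"
    using assms by (subst (asm) ennreal_mult) (auto simp: nn_integral_cmult intro: less_imp_le bump_pos)
  have "(\<integral>\<^sup>+x. ennreal (bump lam y x) \<partial>lborel) =
    ennreal (sqrt (pi / lam)) * (ennreal (sqrt (lam / pi)) * (\<integral>\<^sup>+x. ennreal (bump lam y x) \<partial>lborel))"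
    using assms by (simp add: mult.assoc[symmetric] ennreal_mult[symmetric] real_sqrt_mult[symmetric])
  then show ?thesis unfolding * by simp
qed

text \<open>The width of the bump is \<open>\<epsilon> / \<surd>d\<close>, that is \<open>\<epsilon>\<close> times the standard deviation of a coordinate.\<close>
lemma gaussian_integrate_bump:
  fixes H :: "(nat \<Rightarrow> real) \<Rightarrow> ennreal"
  assumes d: "d > 0" and e: "dot d e e = 1" and H [measurable]: "H \<in> borel_measurable (vec_space d)"
    and inv: "\<And>v c. H (shift d c e v) = H v"
    and \<rho>: "dot d u e = \<rho>" "\<rho> > 0" and eps: "eps > 0"
  shows "(\<integral>\<^sup>+v. H v * ennreal (bump (d / eps\<^sup>2) y (dot d u v)) \<partial>gaussian_law d) \<le>
         ennreal (2 * eps / \<rho>) * (\<integral>\<^sup>+v. H v \<partial>gaussian_law d)"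
proof -
  have "(\<integral>\<^sup>+v. H v * ennreal (bump (d / eps\<^sup>2) y (dot d u v)) \<partial>gaussian_law d) \<le>
    ennreal (sqrt d / \<rho>) * (\<integral>\<^sup>+x. ennreal (bump (d / eps\<^sup>2) y x) \<partial>lborel) * (\<integral>\<^sup>+v. H v \<partial>gaussian_law d)"
    by (intro gaussian_integrate_direction[OF d e H inv _ \<rho>]) measurable
  also have "(\<integral>\<^sup>+x. ennreal (bump (d / eps\<^sup>2) y x) \<partial>lborel) = ennreal (sqrt pi * eps / sqrt d)"
    using d eps by (subst nn_integral_bump) (auto simp: real_sqrt_divide real_sqrt_mult)
  also have "ennreal (sqrt d / \<rho>) * ennreal (sqrt pi * eps / sqrt d) \<le> ennreal (2 * eps / \<rho>)"
  proof -
    have "sqrt pi \<le> sqrt 4" using pi_less_4 by (intro real_sqrt_le_mono) simp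
    then have "sqrt d / \<rho> * (sqrt pi * eps / sqrt d) \<le> 2 * eps / \<rho>"
      using d \<rho> eps by (simp add: field_simps)
    then show ?thesis using \<rho> eps by (simp add: ennreal_mult[symmetric])
  qed
  finally show ?thesis by (simp add: mult_right_mono)
qed

section \<open>Orthonormal families and small projections\<close>

lemma dot_Suc: "dot (Suc d) v z = dot d v z + v d * z d"
  by (simp add: dot_def)

lemma dot_fun_upd [simp]: "dot d v (x(d := c)) = dot d v x"
  by (simp add: dot_def)

text \<open>Gaussian elimination: an equation with nonzero last coefficient is used to eliminate the last unknown from the others.\<close>
lemma homogeneous_system_nontrivial:
  assumes "finite V" "card V < d"
  shows "\<exists>x. (\<exists>k<d. x k \<noteq> (0::real)) \<and> (\<forall>v\<in>V. dot d v x = 0)"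
  using assms
proof (induction d arbitrary: V)
  case (Suc d)
  show ?case
  proof (cases "\<forall>v\<in>V. v d = 0")
    case True
    then show ?thesis
      by (intro exI[of _ "\<lambda>k. if k = d then 1 else 0"]) (auto simp: dot_def)
  next
    case False
    then obtain v0 where v0: "v0 \<in> V" "v0 d \<noteq> 0" by auto
    define W where "W = (\<lambda>v k. v k - v d / v0 d * v0 k) ` (V - {v0})"
    have "card W \<le> card (V - {v0})" unfolding W_def using Suc.prems by (intro card_image_le) auto
    also have "\<dots> < card V" using Suc.prems v0 by (intro card_Diff1_less) auto
    also have "\<dots> \<le> d" using Suc.prems by simp
    finally have "card W < d" .
    moreover have "finite W" using Suc.prems by (simp add: W_def)
    ultimately obtain x where x: "\<exists>k<d. x k \<noteq> 0" "\<forall>w\<in>W. dot d w x = 0"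
      using Suc.IH[of W] by blast
    define z where "z = x(d := - dot d v0 x / v0 d)"
    have z: "dot (Suc d) v z = dot d v x - v d / v0 d * dot d v0 x" for v
      by (simp add: z_def dot_Suc)
    have "dot (Suc d) v z = 0" if "v \<in> V" for v
    proof (cases "v = v0")
      case True
      then show ?thesis using v0 by (simp add: z)
    next
      case False
      then have "dot d (\<lambda>k. v k - v d / v0 d * v0 k) x = 0" using x(2) that by (auto simp: W_def)
      then show ?thesis
        unfolding z by (simp add: dot_def algebra_simps sum_subtractf sum_distrib_left)
    qed
    moreover have "\<exists>k<Suc d. z k \<noteq> 0" using x(1) by (auto simp: z_def intro: less_SucI)
    ultimately show ?thesis by blast
  qed
qed simp

lemma dot_scale: "dot d x (\<lambda>k. y k / c) = dot d x y / c"
  by (simp add: dot_def sum_divide_distrib)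

lemma dot_scale_left: "dot d (\<lambda>k. y k / c) x = dot d y x / c"
  by (simp add: dot_def sum_divide_distrib)

lemma dot_pos: "k < d \<Longrightarrow> x k \<noteq> 0 \<Longrightarrow> dot d x x > 0"
  unfolding dot_def by (intro sum_pos2[where i=k]) (auto simp: less_le)

lemma exists_unit_orthogonal:
  assumes "finite V" "card V < d"
  shows "\<exists>x. dot d x x = 1 \<and> (\<forall>v\<in>V. dot d v x = 0)"
proof -
  obtain x k where x: "k < d" "x k \<noteq> 0" "\<forall>v\<in>V. dot d v x = 0"
    using homogeneous_system_nontrivial[OF assms] by blast
  have "dot d x x > 0" using x dot_pos by blast
  then show ?thesis
    using x by (intro exI[of _ "\<lambda>k. x k / sqrt (dot d x x)"]) (simp add: dot_scale dot_scale_left)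
qed

definition orthonormal :: "nat \<Rightarrow> nat \<Rightarrow> (nat \<Rightarrow> nat \<Rightarrow> real) \<Rightarrow> bool" where
  "orthonormal d r f \<longleftrightarrow> (\<forall>l<r. \<forall>l'<r. dot d (f l) (f l') = (if l = l' then 1 else 0))"

lemma exists_orthonormal_complement:
  assumes "finite V" "card V + r \<le> d"
  shows "\<exists>f. orthonormal d r f \<and> (\<forall>l<r. \<forall>v\<in>V. dot d v (f l) = 0)"
  using assms
proof (induction r)
  case 0
  then show ?case by (simp add: orthonormal_def)
next
  case (Suc r)
  then obtain f where f: "orthonormal d r f" "\<forall>l<r. \<forall>v\<in>V. dot d v (f l) = 0" by auto
  have "card (V \<union> f ` {..<r}) \<le> card V + card (f ` {..<r})" by (rule card_Un_le)
  also have "card (f ` {..<r}) \<le> r" using card_image_le[of "{..<r}" f] by simp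
  finally have "card (V \<union> f ` {..<r}) < d" using Suc.prems by simp
  then obtain x where x: "dot d x x = 1" "\<forall>v\<in>V \<union> f ` {..<r}. dot d v x = 0"
    using exists_unit_orthogonal[of "V \<union> f ` {..<r}" d] Suc.prems by auto
  have "dot d x (f l) = 0" if "l < r" for l using x(2) that by (subst dot_commute) auto
  then show ?case
    using f x by (intro exI[of _ "f(r := x)"]) (auto simp: orthonormal_def less_Suc_eq)
qed

definition proj_sq :: "nat \<Rightarrow> nat \<Rightarrow> (nat \<Rightarrow> nat \<Rightarrow> real) \<Rightarrow> (nat \<Rightarrow> real) \<Rightarrow> real" where
  "proj_sq d r f u = (\<Sum>l<r. (dot d (f l) u)\<^sup>2)"

abbreviation thin_set :: "nat \<Rightarrow> nat \<Rightarrow> (nat \<Rightarrow> nat \<Rightarrow> real) \<Rightarrow> real \<Rightarrow> (nat \<Rightarrow> real) set" where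
  "thin_set d r f t \<equiv> {u \<in> space (vec_space d). proj_sq d r f u \<le> t}"

lemma measurable_proj_sq [measurable]:
  "proj_sq d r f \<in> borel_measurable (vec_space d)"
  unfolding proj_sq_def by measurable

text \<open>The unit vector \<open>e\<close> is the normalized projection of \<open>u\<close> to the span of the orthonormal family.\<close>
lemma unit_projection_direction:
  assumes f: "orthonormal d r f" and pos: "proj_sq d r f u > 0"
    and V: "\<forall>l<r. \<forall>v\<in>V. dot d v (f l) = 0"
  obtains e where "dot d e e = 1" "dot d u e = sqrt (proj_sq d r f u)" "\<forall>v\<in>V. dot d v e = 0"
proof
  define R where "R = sqrt (proj_sq d r f u)"
  have R: "R > 0" "R\<^sup>2 = proj_sq d r f u" using pos by (simp_all add: R_def)
  define e where "e = (\<lambda>k. (\<Sum>l<r. dot d (f l) u * f l k) / R)"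
  have dot_e: "dot d x e = (\<Sum>l<r. dot d (f l) u * dot d x (f l)) / R" for x
  proof -
    have "dot d x (\<lambda>k. \<Sum>l<r. dot d (f l) u * f l k) = (\<Sum>l<r. dot d (f l) u * dot d x (f l))"
      unfolding dot_def[of d x] by (simp only: sum_distrib_left) (subst sum.swap, simp add: ac_simps)
    then show ?thesis unfolding e_def by (simp add: dot_scale)
  qed
  show ue: "dot d u e = sqrt (proj_sq d r f u)"
  proof -
    have "dot d u e = proj_sq d r f u / R"
      unfolding dot_e proj_sq_def by (simp add: dot_commute[of d u] power2_eq_square)
    also have "\<dots> = R" unfolding R(2)[symmetric] using R(1) by (simp add: power2_eq_square)
    finally show ?thesis by (simp add: R_def)
  qed
  show "\<forall>v\<in>V. dot d v e = 0" using V by (simp add: dot_e)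
  have fe: "dot d (f l) e = dot d (f l) u / R" if "l < r" for l
  proof -
    have "(\<Sum>l'<r. dot d (f l') u * dot d (f l) (f l')) = (\<Sum>l'<r. if l' = l then dot d (f l) u else 0)"
      using f that by (intro sum.cong) (auto simp: orthonormal_def)
    also have "\<dots> = dot d (f l) u" using that by simp
    finally show ?thesis by (simp add: dot_e)
  qed
  have "dot d e e = (\<Sum>l<r. dot d (f l) u * (dot d (f l) u / R)) / R"
    unfolding dot_e[of e] dot_commute[of d e "f _"] by (simp add: fe)
  also have "\<dots> = proj_sq d r f u / R\<^sup>2"
    by (simp add: proj_sq_def power2_eq_square sum_divide_distrib)
  finally show "dot d e e = 1" using R pos by simp
qed

lemma measurable_prod_bump [measurable]:
  "(\<lambda>v. \<Prod>i\<in>I. ennreal (bump (lam i) (y i) (dot d (x i) v))) \<in> borel_measurable (vec_space d)"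
  by measurable

text \<open>The directions of the family are integrated out one after the other; each contributes the factor \<open>2 \<epsilon>\<close>.\<close>
lemma gaussian_orthonormal_bumps:
  assumes d: "d > 0" and f: "orthonormal d r f" and eps: "eps > 0"
  shows "(\<integral>\<^sup>+v. (\<Prod>l<r. ennreal (bump (d / eps\<^sup>2) 0 (dot d (f l) v))) \<partial>gaussian_law d) \<le> ennreal ((2 * eps) ^ r)"
  using f
proof (induction r)
  case 0
  interpret prob_space "gaussian_law d" using d by (rule prob_space_gaussian_law)
  show ?case by (simp add: emeasure_space_1)
next
  case (Suc r)
  have "(\<integral>\<^sup>+v. (\<Prod>l<Suc r. ennreal (bump (d / eps\<^sup>2) 0 (dot d (f l) v))) \<partial>gaussian_law d)
    \<le> ennreal (2 * eps / 1) * (\<integral>\<^sup>+v. (\<Prod>l<r. ennreal (bump (d / eps\<^sup>2) 0 (dot d (f l) v))) \<partial>gaussian_law d)"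
    unfolding prod.lessThan_Suc
  proof (intro gaussian_integrate_bump[OF d, where e = "f r"])
    show "(\<Prod>l<r. ennreal (bump (real d / eps\<^sup>2) 0 (dot d (f l) (shift d c (f r) v)))) =
         (\<Prod>l<r. ennreal (bump (real d / eps\<^sup>2) 0 (dot d (f l) v)))" for v c
      using Suc.prems by (intro prod.cong) (auto simp: dot_shift_right orthonormal_def)
  qed (use Suc.prems eps in \<open>auto simp: orthonormal_def intro!: measurable_prod_bump\<close>)
  also have "\<dots> \<le> ennreal (2 * eps / 1) * ennreal ((2 * eps) ^ r)"
    using Suc by (intro mult_left_mono) (auto simp: orthonormal_def)
  also have "\<dots> = ennreal ((2 * eps) ^ Suc r)" using eps by (simp add: ennreal_mult[symmetric])
  finally show ?case .
qed

text \<open>Exponential Markov inequality. The factor \<open>exp d\<close> it costs is absorbed in the base of the power, since the dimension \<open>r\<close> of the range is at least \<open>d / 2\<close>.\<close>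
lemma gaussian_small_projection:
  assumes d: "d > 0" and f: "orthonormal d r f" and r: "d \<le> 2 * r" and \<delta>: "\<delta> > 0"
  shows "emeasure (gaussian_law d) {u \<in> space (vec_space d). proj_sq d r f u \<le> \<delta>\<^sup>2} \<le> ennreal ((16 * \<delta>) ^ r)"
proof -
  note [measurable_cong] = sets_gaussian_law
  have sp: "space (gaussian_law d) = space (vec_space d)" by (rule sets_eq_imp_space_eq) (rule sets_gaussian_law)
  have "emeasure (gaussian_law d) {u \<in> space (vec_space d). proj_sq d r f u \<le> \<delta>\<^sup>2} =
    (\<integral>\<^sup>+u. indicator {u \<in> space (vec_space d). proj_sq d r f u \<le> \<delta>\<^sup>2} u \<partial>gaussian_law d)"
    by (intro nn_integral_indicator[symmetric]) (simp add: sets_gaussian_law)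
  also have "\<dots> \<le> (\<integral>\<^sup>+u. ennreal (exp d) * (\<Prod>l<r. ennreal (bump (d / \<delta>\<^sup>2) 0 (dot d (f l) u))) \<partial>gaussian_law d)"
  proof (intro nn_integral_mono)
    fix u
    have "1 \<le> exp (real d) * (\<Prod>l<r. bump (d / \<delta>\<^sup>2) 0 (dot d (f l) u))" if "proj_sq d r f u \<le> \<delta>\<^sup>2"
    proof -
      have "(\<Prod>l<r. bump (d / \<delta>\<^sup>2) 0 (dot d (f l) u)) = exp (- (d / \<delta>\<^sup>2 * proj_sq d r f u))"
        using sum_distrib_left[of "- (d / \<delta>\<^sup>2)" "\<lambda>l. (dot d (f l) u)\<^sup>2" "{..<r}"]
        by (simp add: bump_def exp_sum proj_sq_def)
      moreover have "d / \<delta>\<^sup>2 * proj_sq d r f u \<le> d / \<delta>\<^sup>2 * \<delta>\<^sup>2" using that by (intro mult_left_mono) auto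
      ultimately show ?thesis using \<delta> by (simp add: mult_exp_exp)
    qed
    then have "ennreal 1 \<le> ennreal (exp (real d)) * (\<Prod>l<r. ennreal (bump (d / \<delta>\<^sup>2) 0 (dot d (f l) u)))" if "proj_sq d r f u \<le> \<delta>\<^sup>2"
      using that by (simp add: prod_ennreal bump_pos less_imp_le ennreal_mult[symmetric] prod_nonneg del: ennreal_1)
    then show "indicator {u \<in> space (vec_space d). proj_sq d r f u \<le> \<delta>\<^sup>2} u \<le> ennreal (exp d) * (\<Prod>l<r. ennreal (bump (d / \<delta>\<^sup>2) 0 (dot d (f l) u)))"
      by (auto simp: indicator_def)
  qed
  also have "\<dots> = ennreal (exp d) * (\<integral>\<^sup>+u. (\<Prod>l<r. ennreal (bump (d / \<delta>\<^sup>2) 0 (dot d (f l) u))) \<partial>gaussian_law d)"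
    by (intro nn_integral_cmult) measurable
  also have "\<dots> \<le> ennreal (exp d) * ennreal ((2 * \<delta>) ^ r)"
    by (intro mult_left_mono gaussian_orthonormal_bumps d f \<delta>) auto
  also have "\<dots> \<le> ennreal ((16 * \<delta>) ^ r)"
  proof -
    have "exp (real d) \<le> exp (2 * real r)" using r by simp
    also have "\<dots> = exp 2 ^ r" using exp_of_nat_mult[of r "2::real"] by (simp only: mult.commute)
    also have "\<dots> \<le> 8 ^ r"
    proof (intro power_mono)
      have "exp (2::real) = exp 1 ^ 2" using exp_of_nat_mult[of 2 "1::real"] by simp
      also have "\<dots> \<le> (272 / 100) ^ 2" using e_less_272 by (intro power_mono) auto
      also have "\<dots> \<le> 8" by (simp add: power2_eq_square)
      finally show "exp (2::real) \<le> 8" .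
    qed simp
    finally have "exp (real d) * (2 * \<delta>) ^ r \<le> 8 ^ r * (2 * \<delta>) ^ r" using \<delta> by (intro mult_right_mono) auto
    also have "\<dots> = (16 * \<delta>) ^ r" by (subst power_mult_distrib[symmetric]) simp
    finally show ?thesis using \<delta> by (simp add: ennreal_mult[symmetric] ennreal_leI)
  qed
  finally show ?thesis .
qed

section \<open>Tails of Gaussian vectors\<close>

lemma space_gaussian_law: "space (gaussian_law d) = space (vec_space d)"
  by (rule sets_eq_imp_space_eq) (rule sets_gaussian_law)

lemma emeasure_le_nn_integral:
  assumes "A \<in> sets N" "\<And>x. x \<in> A \<Longrightarrow> 1 \<le> f x"
  shows "emeasure N A \<le> (\<integral>\<^sup>+x. f x \<partial>N)"
proof -
  have "emeasure N A = (\<integral>\<^sup>+x. indicator A x \<partial>N)" using assms(1) by simp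
  also have "\<dots> \<le> (\<integral>\<^sup>+x. f x \<partial>N)" using assms(2) by (intro nn_integral_mono) (auto simp: indicator_def)
  finally show ?thesis .
qed

lemma gaussian_exp_linear:
  assumes d: "d > 0"
  shows "(\<integral>\<^sup>+v. ennreal (exp (d * c * dot d v e - d * c\<^sup>2 * dot d e e / 2)) \<partial>gaussian_law d) = 1"
proof -
  interpret prob_space "gaussian_law d" using d by (rule prob_space_gaussian_law)
  show ?thesis using nn_integral_gaussian_shift[OF d, of "\<lambda>_. 1" c e] by (simp add: emeasure_space_1)
qed

lemma gaussian_exp_square:
  assumes d: "d > 0" and s: "s > 0"
  shows "(\<integral>\<^sup>+v. ennreal (exp (real d / 2 * dot d v v * (1 - 1 / s\<^sup>2)) / s ^ d) \<partial>gaussian_law d) = 1"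
proof -
  interpret prob_space "gaussian_law d" using d by (rule prob_space_gaussian_law)
  show ?thesis using nn_integral_gaussian_dilate[OF d s, of "\<lambda>_. 1"] by (simp add: emeasure_space_1)
qed

text \<open>Chernoff bound; the Cameron-Martin formula evaluates the expectations of \<open>exp (\<surd>d \<langle>u,v\<rangle>)\<close> and \<open>exp (- \<surd>d \<langle>u,v\<rangle>)\<close>.\<close>
lemma gaussian_linear_tail:
  assumes d: "d > 0" and u: "dot d u u \<le> 1"
  shows "emeasure (gaussian_law d) {v \<in> space (vec_space d). B / sqrt d \<le> \<bar>dot d u v\<bar>} \<le> ennreal (2 * exp (1 / 2 - B))"
proof -
  note [measurable_cong] = sets_gaussian_law
  define w where "w c v = exp (d * c * dot d v u - d * c\<^sup>2 * dot d u u / 2)" for c :: real and v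
  have [measurable]: "w c \<in> borel_measurable (vec_space d)" for c unfolding w_def by measurable
  let ?s = "1 / sqrt (real d)" and ?K = "exp (1 / 2 - B)"
  have K: "?K * w c v \<ge> exp (d * c * dot d v u - B)" if "c\<^sup>2 = 1 / d" for c :: real and v
    using u d that by (simp add: w_def mult_exp_exp)
  have dd: "d * ?s = sqrt d" "d * - ?s = - sqrt d" using d by (simp_all add: real_div_sqrt)
  have "emeasure (gaussian_law d) {v \<in> space (vec_space d). B / sqrt d \<le> \<bar>dot d u v\<bar>}
     \<le> (\<integral>\<^sup>+v. ennreal ?K * ennreal (w ?s v) + ennreal ?K * ennreal (w (- ?s) v) \<partial>gaussian_law d)"
  proof (rule emeasure_le_nn_integral)
    fix v assume "v \<in> {v \<in> space (vec_space d). B / sqrt d \<le> \<bar>dot d u v\<bar>}"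
    then have "B \<le> sqrt d * \<bar>dot d v u\<bar>" using d by (simp add: field_simps dot_commute)
    then have "B \<le> d * ?s * dot d v u \<or> B \<le> d * - ?s * dot d v u"
      unfolding dd by (auto simp: abs_if split: if_splits)
    moreover have sq: "?s\<^sup>2 = 1 / real d" "(- ?s)\<^sup>2 = 1 / real d" using d by (simp_all add: power_divide)
    ultimately have "1 \<le> exp (d * ?s * dot d v u - B) \<or> 1 \<le> exp (d * - ?s * dot d v u - B)" by auto
    then have "1 \<le> ?K * w ?s v \<or> 1 \<le> ?K * w (- ?s) v"
      using order_trans[OF _ K[of ?s v]] order_trans[OF _ K[of "- ?s" v]] sq by blast
    moreover have "?K * w c v \<ge> 0" for c by (simp add: w_def)
    ultimately have "1 \<le> ?K * w ?s v + ?K * w (- ?s) v" by (smt (verit))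
    then have "ennreal 1 \<le> ennreal (?K * w ?s v + ?K * w (- ?s) v)" by (rule ennreal_leI)
    then show "1 \<le> ennreal ?K * ennreal (w ?s v) + ennreal ?K * ennreal (w (- ?s) v)"
      by (simp add: w_def ennreal_plus ennreal_mult)
  qed simp
  also have "\<dots> = ennreal ?K * (\<integral>\<^sup>+v. ennreal (w ?s v) \<partial>gaussian_law d) + ennreal ?K * (\<integral>\<^sup>+v. ennreal (w (- ?s) v) \<partial>gaussian_law d)"
    by (subst nn_integral_add; (subst (1 2) nn_integral_cmult)?) measurable
  also have "\<dots> = ennreal ?K + ennreal ?K" unfolding w_def gaussian_exp_linear[OF d] by simp
  also have "\<dots> = ennreal (2 * exp (1 / 2 - B))" by (simp add: ennreal_plus[symmetric] del: ennreal_plus)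
  finally show ?thesis .
qed

lemma one_minus_inverse_square_ge:
  fixes x :: real
  assumes "0 \<le> x"
  shows "2 * x - 3 * x\<^sup>2 \<le> 1 - 1 / (1 + x)\<^sup>2"
proof -
  have "(1 - 2 * x + 3 * x\<^sup>2) * (1 + x)\<^sup>2 = 1 + 4 * x ^ 3 + 3 * x ^ 4"
    by (simp add: power2_eq_square power3_eq_cube power4_eq_xxxx algebra_simps)
  then have "(1 - 2 * x + 3 * x\<^sup>2) * (1 + x)\<^sup>2 \<ge> 1" using assms by simp
  then show ?thesis using assms by (simp add: field_simps)
qed

text \<open>Chernoff bound for the chi-square law: the exponential moments come from the dilations by \<open>1 \<plusminus> 1/\<surd>d\<close>. For \<open>x = 1/\<surd>d\<close>
  the second-order terms \<open>d x\<^sup>2\<close> are equal to \<open>1\<close>, so the fluctuations of \<open>\<bar>v\<bar>\<^sup>2\<close> have order \<open>1/\<surd>d\<close>.\<close>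
lemma gaussian_norm_tail:
  assumes d: "d \<ge> 9" and b: "b \<ge> 0"
  shows "emeasure (gaussian_law d) {v \<in> space (vec_space d). b / sqrt d \<le> \<bar>dot d v v - 1\<bar>} \<le> ennreal (2 * exp (3 - b / 2))"
proof -
  note [measurable_cong] = sets_gaussian_law
  define x where "x = 1 / sqrt (real d)"
  have d0: "d > 0" using d by simp
  have "sqrt 9 \<le> sqrt (real d)" using d by (intro real_sqrt_le_mono) simp
  then have x: "0 < x" "x \<le> 1 / 3" "d * x\<^sup>2 = 1"
    using d0 by (auto simp: x_def power_divide field_simps)
  have dxx: "d * x * x = 1" using x by (simp add: power2_eq_square)
  define w where "w s v = exp (real d / 2 * dot d v v * (1 - 1 / s\<^sup>2)) / s ^ d" for s :: real and v
  have [measurable]: "w s \<in> borel_measurable (vec_space d)" for s unfolding w_def by measurable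
  let ?K = "exp (3 - b / 2)"
  have up: "1 \<le> ?K * w (1 + x) v" if v: "1 + b * x \<le> dot d v v" for v
  proof -
    have t: "2 * x - 3 * x\<^sup>2 \<le> 1 - 1 / (1 + x)\<^sup>2" using x by (intro one_minus_inverse_square_ge) simp
    have t0: "0 \<le> 2 * x - 3 * x\<^sup>2" using x by (simp add: power2_eq_square)
    have "d / 2 * (1 + b * x) * (2 * x - 3 * x\<^sup>2) \<le> real d / 2 * dot d v v * (1 - 1 / (1 + x)\<^sup>2)"
      using v b x t t0 by (intro mult_mono mult_left_mono mult_nonneg_nonneg) (auto simp: dot_nonneg)
    moreover have "d / 2 * (1 + b * x) * (2 * x - 3 * x\<^sup>2) = d * x + b - 3 / 2 - 3 / 2 * b * x"
    proof -
      have "d / 2 * (1 + b * x) * (2 * x - 3 * x\<^sup>2) = d * x + b * (d * x\<^sup>2) - 3 / 2 * (d * x\<^sup>2) - 3 / 2 * b * x * (d * x\<^sup>2)"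
        by (simp add: power2_eq_square field_simps)
      then show ?thesis using x by simp
    qed
    moreover have "b * x \<le> b * (1 / 3)" using b x by (intro mult_left_mono) auto
    ultimately have le: "d * x \<le> 3 - b / 2 + real d / 2 * dot d v v * (1 - 1 / (1 + x)\<^sup>2)" by linarith
    have "(1 + x) ^ d \<le> exp x ^ d" using x by (intro power_mono exp_ge_add_one_self) auto
    also have "\<dots> = exp (d * x)" by (simp add: exp_of_nat_mult)
    also have "\<dots> \<le> exp (3 - b / 2 + real d / 2 * dot d v v * (1 - 1 / (1 + x)\<^sup>2))" using le by simp
    also have "\<dots> = ?K * exp (real d / 2 * dot d v v * (1 - 1 / (1 + x)\<^sup>2))" by (rule exp_add)
    finally show ?thesis using x by (simp add: w_def field_simps)
  qed
  have low: "1 \<le> ?K * w (1 - x) v" if v: "dot d v v \<le> 1 - b * x" for v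
  proof -
    define t where "t = 1 / (1 - x)\<^sup>2 - 1"
    have "(1 + 2 * x + 6 * x\<^sup>2) * (1 - x)\<^sup>2 = 1 + x\<^sup>2 * (3 - 10 * x + 6 * x\<^sup>2)"
      by (simp add: power2_eq_square algebra_simps)
    moreover have "3 - 10 * x + 6 * x\<^sup>2 \<ge> 0"
    proof (cases "x \<le> 3 / 10")
      case False
      then have "(3 / 10)\<^sup>2 \<le> x\<^sup>2" by (intro power_mono) auto
      then show ?thesis using x by (simp add: power_divide)
    qed (use x in simp)
    ultimately have "(1 + 2 * x + 6 * x\<^sup>2) * (1 - x)\<^sup>2 \<ge> 1" by simp
    then have t1: "t \<le> 2 * x + 6 * x\<^sup>2" unfolding t_def using x by (simp add: field_simps)
    have "(1 + 2 * x) * (1 - x)\<^sup>2 = 1 - x\<^sup>2 * (3 - 2 * x)" by (simp add: power2_eq_square algebra_simps)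
    then have "(1 + 2 * x) * (1 - x)\<^sup>2 \<le> 1" using x by simp
    then have t2: "2 * x \<le> t" unfolding t_def using x by (simp add: field_simps)
    have bx: "1 - b * x \<ge> 0" using v dot_nonneg[of d v] by linarith
    have "d / 2 * dot d v v * t \<le> d / 2 * (1 - b * x) * t"
      using v t2 x by (intro mult_right_mono mult_left_mono) auto
    also have "\<dots> = d / 2 * t - d / 2 * (b * x) * t" by (simp add: field_simps)
    also have "\<dots> \<le> d / 2 * (2 * x + 6 * x\<^sup>2) - d / 2 * (b * x) * (2 * x)"
      using t1 t2 b x by (intro diff_mono mult_left_mono) auto
    also have "\<dots> = d * x + 3 * (d * x\<^sup>2) - b * (d * x\<^sup>2)" by (simp add: power2_eq_square field_simps)
    also have "\<dots> = d * x + 3 - b" using x by simp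
    finally have le': "- (d * x) \<le> 3 - b - d / 2 * dot d v v * t" by simp
    have le: "- (d * x) \<le> 3 - b / 2 + real d / 2 * dot d v v * (1 - 1 / (1 - x)\<^sup>2)"
    proof -
      have "1 - 1 / (1 - x)\<^sup>2 = - t" by (simp add: t_def)
      then show ?thesis using le' b by simp
    qed
    have "(1 - x) ^ d \<le> exp (- x) ^ d" using x exp_ge_add_one_self[of "-x"] by (intro power_mono) auto
    also have "\<dots> = exp (- (d * x))" using exp_of_nat_mult[of d "-x"] by simp
    also have "\<dots> \<le> exp (3 - b / 2 + real d / 2 * dot d v v * (1 - 1 / (1 - x)\<^sup>2))" using le by simp
    also have "\<dots> = ?K * exp (real d / 2 * dot d v v * (1 - 1 / (1 - x)\<^sup>2))" by (rule exp_add)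
    finally show ?thesis using x by (simp add: w_def field_simps)
  qed
  have wpos: "w s v \<ge> 0" if "s > 0" for s v using that by (simp add: w_def)
  have "emeasure (gaussian_law d) {v \<in> space (vec_space d). b / sqrt d \<le> \<bar>dot d v v - 1\<bar>}
     \<le> (\<integral>\<^sup>+v. ennreal ?K * ennreal (w (1 + x) v) + ennreal ?K * ennreal (w (1 - x) v) \<partial>gaussian_law d)"
  proof (rule emeasure_le_nn_integral)
    fix v assume "v \<in> {v \<in> space (vec_space d). b / sqrt d \<le> \<bar>dot d v v - 1\<bar>}"
    then have "1 + b * x \<le> dot d v v \<or> dot d v v \<le> 1 - b * x" by (auto simp: x_def abs_if split: if_splits)
    then have "1 \<le> ?K * w (1 + x) v \<or> 1 \<le> ?K * w (1 - x) v" using up low by blast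
    moreover have "?K * w (1 + x) v \<ge> 0" "?K * w (1 - x) v \<ge> 0" using wpos[of "1 + x" v] wpos[of "1 - x" v] x by auto
    ultimately have "1 \<le> ?K * w (1 + x) v + ?K * w (1 - x) v" by (smt (verit))
    then have "ennreal 1 \<le> ennreal (?K * w (1 + x) v + ?K * w (1 - x) v)" by (rule ennreal_leI)
    then show "1 \<le> ennreal ?K * ennreal (w (1 + x) v) + ennreal ?K * ennreal (w (1 - x) v)"
      using wpos[of "1 + x" v] wpos[of "1 - x" v] x by (simp add: ennreal_plus ennreal_mult)
  qed simp
  also have "\<dots> = ennreal ?K * (\<integral>\<^sup>+v. ennreal (w (1 + x) v) \<partial>gaussian_law d) + ennreal ?K * (\<integral>\<^sup>+v. ennreal (w (1 - x) v) \<partial>gaussian_law d)"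
    by (subst nn_integral_add; (subst (1 2) nn_integral_cmult)?) measurable
  also have "\<dots> = ennreal ?K + ennreal ?K"
    using x unfolding w_def by (subst (1 2) gaussian_exp_square[OF d0]) auto
  also have "\<dots> = ennreal (2 * ?K)" by (simp add: ennreal_plus[symmetric] del: ennreal_plus)
  finally show ?thesis .
qed

lemma gaussian_fourth_moment_finite:
  assumes d: "d > 0"
  shows "(\<integral>\<^sup>+v. ennreal ((dot d v v)\<^sup>2) \<partial>gaussian_law d) < \<infinity>"
proof -
  note [measurable_cong] = sets_gaussian_law
  define w where "w v = exp (real d / 2 * dot d v v * (1 - 1 / 2\<^sup>2)) / 2 ^ d" for v
  have [measurable]: "w \<in> borel_measurable (vec_space d)" unfolding w_def by measurable
  have "(\<integral>\<^sup>+v. ennreal ((dot d v v)\<^sup>2) \<partial>gaussian_law d) \<le> (\<integral>\<^sup>+v. ennreal (64 * 2 ^ d) * ennreal (w v) \<partial>gaussian_law d)"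
  proof (intro nn_integral_mono)
    fix v
    let ?y = "dot d v v"
    have y: "?y \<ge> 0" by (rule dot_nonneg)
    have "?y / 8 \<le> exp (?y / 8)" using exp_ge_add_one_self[of "?y / 8"] by linarith
    also have "\<dots> \<le> exp (real d / 2 * ?y * (1 - 1 / 2\<^sup>2) / 2)"
    proof -
      have "1 * ?y \<le> real d * ?y" using y d by (intro mult_right_mono) auto
      then show ?thesis using y by simp
    qed
    finally have "(?y / 8)\<^sup>2 \<le> (exp (real d / 2 * ?y * (1 - 1 / 2\<^sup>2) / 2))\<^sup>2" using y by (intro power_mono) auto
    also have "\<dots> = exp (real d / 2 * ?y * (1 - 1 / 2\<^sup>2))" by (simp add: power2_eq_square mult_exp_exp)
    finally have "?y\<^sup>2 \<le> 64 * 2 ^ d * w v" by (simp add: w_def power_divide)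
    then show "ennreal (?y\<^sup>2) \<le> ennreal (64 * 2 ^ d) * ennreal (w v)"
      by (simp add: ennreal_mult[symmetric] w_def ennreal_leI)
  qed
  also have "\<dots> = ennreal (64 * 2 ^ d) * (\<integral>\<^sup>+v. ennreal (w v) \<partial>gaussian_law d)"
    by (intro nn_integral_cmult) measurable
  also have "\<dots> = ennreal (64 * 2 ^ d)" unfolding w_def using gaussian_exp_square[OF d, of 2] by simp
  finally show ?thesis by (auto simp: less_top[symmetric] top_unique)
qed

section \<open>A block of rows against another block\<close>

text \<open>For a fixed block \<open>x\<close> of rows, the conditional expectation of \<open>exp (- \<lambda> \<Sum>i. (\<langle>x i, v\<rangle> - y i)\<^sup>2)\<close> over one row \<open>v\<close> of the
  opposite block.\<close>
definition row_affinity ::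
    "(nat \<Rightarrow> real) measure \<Rightarrow> nat \<Rightarrow> real \<Rightarrow> nat set \<Rightarrow> (nat \<Rightarrow> real) \<Rightarrow> (nat \<Rightarrow> nat \<Rightarrow> real) \<Rightarrow> ennreal" where
  "row_affinity N d lam I y x = (\<integral>\<^sup>+v. (\<Prod>i\<in>I. ennreal (bump lam (y i) (dot d (x i) v))) \<partial>N)"

lemma sets_PiM_law:
  assumes "sets \<mu> = sets (vec_space d)"
  shows "sets (rows I \<mu>) = sets (rows I (vec_space d))"
  using assms by (intro sets_PiM_cong) auto

lemma measurable_row_affinity:
  assumes N: "sigma_finite_measure N" and s [measurable_cong]: "sets N = sets (vec_space d)"
  shows "row_affinity N d lam I y \<in> borel_measurable (rows I (vec_space d))"
proof -
  interpret sigma_finite_measure N by fact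
  show ?thesis unfolding row_affinity_def by measurable
qed

text \<open>The new row \<open>u\<close> is tested along the direction \<open>e\<close> of its projection to a space orthogonal to the old rows. Translations along
  \<open>e\<close> do not affect the factors of the old rows, so integrating along \<open>e\<close> gains \<open>2 \<epsilon> / \<rho>\<close> with \<open>\<rho> > \<delta>\<close>
  the length of the projection. If the projection is short, the new factor is bounded by \<open>1\<close>.\<close>
lemma row_affinity_insert:
  assumes d: "d > 0" and eps: "eps > 0" and \<delta>: "\<delta> > 0" and I: "finite I" "i \<notin> I"
    and f: "orthonormal d r f" and V: "\<forall>l<r. \<forall>v\<in>x ` I. dot d v (f l) = 0"
  shows "row_affinity (gaussian_law d) d (d / eps\<^sup>2) (insert i I) y (x(i := u)) \<le>
    (if proj_sq d r f u \<le> \<delta>\<^sup>2 then 1 else ennreal (2 * eps / \<delta>)) * row_affinity (gaussian_law d) d (d / eps\<^sup>2) I y x"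
proof -
  let ?lam = "d / eps\<^sup>2"
  let ?H = "\<lambda>v. \<Prod>k\<in>I. ennreal (bump ?lam (y k) (dot d (x k) v))"
  have "(\<Prod>k\<in>insert i I. ennreal (bump ?lam (y k) (dot d ((x(i := u)) k) v))) = ?H v * ennreal (bump ?lam (y i) (dot d u v))" for v
  proof -
    have "(\<Prod>k\<in>I. ennreal (bump ?lam (y k) (dot d ((x(i := u)) k) v))) = ?H v"
      using I by (intro prod.cong) auto
    then show ?thesis using I by (simp add: mult.commute)
  qed
  then have eq: "row_affinity (gaussian_law d) d ?lam (insert i I) y (x(i := u)) =
      (\<integral>\<^sup>+v. ?H v * ennreal (bump ?lam (y i) (dot d u v)) \<partial>gaussian_law d)"
    by (simp add: row_affinity_def)
  show ?thesis
  proof (cases "proj_sq d r f u \<le> \<delta>\<^sup>2")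
    case True
    have "(\<integral>\<^sup>+v. ?H v * ennreal (bump ?lam (y i) (dot d u v)) \<partial>gaussian_law d) \<le> (\<integral>\<^sup>+v. ?H v * 1 \<partial>gaussian_law d)"
      using eps by (intro nn_integral_mono mult_left_mono) (auto simp: bump_le_1)
    with True show ?thesis unfolding eq by (simp add: row_affinity_def)
  next
    case False
    then have gt: "\<delta>\<^sup>2 < proj_sq d r f u" by simp
    then have pos: "0 < proj_sq d r f u" using \<delta> by (meson le_less_trans zero_le_power2)
    from unit_projection_direction[OF f pos V] obtain e where
      e: "dot d e e = 1" "dot d u e = sqrt (proj_sq d r f u)" "\<forall>v\<in>x ` I. dot d v e = 0" .
    have "\<delta> \<le> sqrt (proj_sq d r f u)" using gt \<delta> by (intro real_le_rsqrt) simp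
    have "(\<integral>\<^sup>+v. ?H v * ennreal (bump ?lam (y i) (dot d u v)) \<partial>gaussian_law d) \<le>
        ennreal (2 * eps / sqrt (proj_sq d r f u)) * (\<integral>\<^sup>+v. ?H v \<partial>gaussian_law d)"
    proof (intro gaussian_integrate_bump[OF d e(1) measurable_prod_bump _ e(2)])
      show "?H (shift d c e v) = ?H v" for v c
        using e(3) by (intro prod.cong) (auto simp: dot_shift_right)
    qed (use pos eps in auto)
    also have "\<dots> \<le> ennreal (2 * eps / \<delta>) * (\<integral>\<^sup>+v. ?H v \<partial>gaussian_law d)"
      using \<open>\<delta> \<le> sqrt (proj_sq d r f u)\<close> \<delta> eps pos
      by (intro mult_right_mono ennreal_leI divide_left_mono) auto
    finally show ?thesis using False unfolding eq by (simp add: row_affinity_def)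
  qed
qed

text \<open>The rows of the first block are exposed one at a time. Given the earlier rows, an orthonormal family in their
  complement is fixed before the new row is integrated out, so that it need not depend measurably on them. The first
  block may have any law that puts little mass near subspaces of codimension at least \<open>d / 2\<close>, which is what allows
  spherical rows there. The row gains \<open>2 \<epsilon> / \<delta>\<close> from every row of the second block, or it belongs to the
  exceptional set of measure \<open>\<theta>\<close>.\<close>
lemma block_affinity_bound:
  assumes d: "d > 0" and eps: "eps > 0" and \<delta>: "\<delta> > 0" and \<theta>: "\<theta> \<ge> 0"
    and \<mu>: "prob_space \<mu>" "sets \<mu> = sets (vec_space d)"
    and tail: "\<And>r f. orthonormal d r f \<Longrightarrow> d \<le> 2 * r \<Longrightarrow> a \<le> r \<Longrightarrow>
        emeasure \<mu> {u \<in> space (vec_space d). proj_sq d r f u \<le> \<delta>\<^sup>2} \<le> ennreal \<theta>"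
    and a: "2 * a \<le> d + 1" and J: "finite J"
    and I: "finite I" "card I \<le> a"
  shows "(\<integral>\<^sup>+x. (\<Prod>j\<in>J. row_affinity (gaussian_law d) d (d / eps\<^sup>2) I (\<lambda>i. y i j) x) \<partial>(rows I \<mu>))
    \<le> ennreal (((2 * eps / \<delta>) ^ card J + \<theta>) ^ card I)"
  using I
proof (induction I)
  case empty
  interpret G: prob_space "gaussian_law d" using d by (rule prob_space_gaussian_law)
  interpret prob_space \<mu> by fact
  interpret product_sigma_finite "\<lambda>_::nat. \<mu>" by standard
  show ?case by (subst nn_integral_empty) (auto simp: row_affinity_def G.emeasure_space_1)
next
  case (insert i I)
  note [measurable_cong] = \<mu>(2) sets_PiM_law[OF \<mu>(2)]
  interpret G: prob_space "gaussian_law d" using d by (rule prob_space_gaussian_law)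
  interpret prob_space \<mu> by fact
  interpret product_sigma_finite "\<lambda>_::nat. \<mu>" by standard
  note measurable_row_affinity[OF G.sigma_finite_measure_axioms sets_gaussian_law, measurable]
  let ?\<Phi> = "\<lambda>I j x. row_affinity (gaussian_law d) d (d / eps\<^sup>2) I (\<lambda>i. y i j) x"
  let ?q = "(2 * eps / \<delta>) ^ card J"
  have q: "?q \<ge> 0" using eps \<delta> by simp
  have "(\<integral>\<^sup>+x. (\<Prod>j\<in>J. ?\<Phi> (insert i I) j x) \<partial>(rows (insert i I) \<mu>)) =
     (\<integral>\<^sup>+x. (\<integral>\<^sup>+u. (\<Prod>j\<in>J. ?\<Phi> (insert i I) j (x(i := u))) \<partial>\<mu>) \<partial>(rows I \<mu>))"
    using insert.hyps by (intro product_nn_integral_insert) auto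
  also have "\<dots> \<le> (\<integral>\<^sup>+x. ennreal (?q + \<theta>) * (\<Prod>j\<in>J. ?\<Phi> I j x) \<partial>(rows I \<mu>))"
  proof (intro nn_integral_mono)
    fix x :: "nat \<Rightarrow> nat \<Rightarrow> real"
    have cI: "card (x ` I) \<le> card I" "card I < a" using insert by (auto intro: card_image_le)
    \<comment> \<open>At most \<open>a - 1\<close> rows are present, so \<open>2 a \<le> d + 1\<close> leaves a complement of dimension \<open>r \<ge> d / 2\<close>.\<close>
    define r where "r = d - card (x ` I)"
    have r: "card (x ` I) + r \<le> d" "d \<le> 2 * r" "a \<le> r" using cI a by (auto simp: r_def)
    obtain f where f: "orthonormal d r f" "\<forall>l<r. \<forall>v\<in>x ` I. dot d v (f l) = 0"
      using exists_orthonormal_complement[OF _ r(1)] insert.hyps by auto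
    let ?B = "{u \<in> space (vec_space d). proj_sq d r f u \<le> \<delta>\<^sup>2}"
    have [measurable]: "?B \<in> sets \<mu>" unfolding \<mu>(2) by measurable
    have sp: "space \<mu> = space (vec_space d)" by (rule sets_eq_imp_space_eq) (rule \<mu>(2))
    have "(\<integral>\<^sup>+u. (\<Prod>j\<in>J. ?\<Phi> (insert i I) j (x(i := u))) \<partial>\<mu>) \<le> (\<integral>\<^sup>+u. (ennreal ?q + indicator ?B u) * (\<Prod>j\<in>J. ?\<Phi> I j x) \<partial>\<mu>)"
    proof (intro nn_integral_mono)
      fix u assume u: "u \<in> space \<mu>"
      let ?t = "if proj_sq d r f u \<le> \<delta>\<^sup>2 then 1 else ennreal (2 * eps / \<delta>)"
      have "(\<Prod>j\<in>J. ?\<Phi> (insert i I) j (x(i := u))) \<le> (\<Prod>j\<in>J. ?t * ?\<Phi> I j x)"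
        by (intro prod_mono_ennreal row_affinity_insert d eps \<delta> insert.hyps f)
      also have "\<dots> = ?t ^ card J * (\<Prod>j\<in>J. ?\<Phi> I j x)"
        by (simp add: prod.distrib)
      also have "?t ^ card J \<le> ennreal ?q + indicator ?B u"
        using u sp eps \<delta> by (simp add: ennreal_power indicator_def)
      finally show "(\<Prod>j\<in>J. ?\<Phi> (insert i I) j (x(i := u))) \<le> (ennreal ?q + indicator ?B u) * (\<Prod>j\<in>J. ?\<Phi> I j x)"
        by (simp add: mult_right_mono)
    qed
    also have "\<dots> = (\<integral>\<^sup>+u. ennreal ?q + indicator ?B u \<partial>\<mu>) * (\<Prod>j\<in>J. ?\<Phi> I j x)"
      by (intro nn_integral_multc) measurable
    also have "(\<integral>\<^sup>+u. ennreal ?q + indicator ?B u \<partial>\<mu>) = ennreal ?q + emeasure \<mu> ?B"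
      by (subst nn_integral_add) (auto simp: emeasure_space_1)
    also have "\<dots> \<le> ennreal ?q + ennreal \<theta>"
      by (intro add_left_mono tail f r)
    also have "\<dots> = ennreal (?q + \<theta>)" using q \<theta> by simp
    finally show "(\<integral>\<^sup>+u. (\<Prod>j\<in>J. ?\<Phi> (insert i I) j (x(i := u))) \<partial>\<mu>) \<le> ennreal (?q + \<theta>) * (\<Prod>j\<in>J. ?\<Phi> I j x)"
      by (simp add: mult_right_mono del: fun_upd_apply)
  qed
  also have "\<dots> = ennreal (?q + \<theta>) * (\<integral>\<^sup>+x. (\<Prod>j\<in>J. ?\<Phi> I j x) \<partial>(rows I \<mu>))"
    by (intro nn_integral_cmult) measurable
  also have "\<dots> \<le> ennreal (?q + \<theta>) * ennreal ((?q + \<theta>) ^ card I)"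
    using insert by (intro mult_left_mono) auto
  also have "\<dots> = ennreal ((?q + \<theta>) ^ card (insert i I))"
    using insert.hyps q \<theta> by (simp add: ennreal_mult[symmetric] del: ennreal_plus)
  finally show ?case .
qed

abbreviation affinity ::
    "nat \<Rightarrow> real \<Rightarrow> nat set \<Rightarrow> nat set \<Rightarrow> (nat \<Rightarrow> nat \<Rightarrow> real) \<Rightarrow> (nat \<Rightarrow> nat \<Rightarrow> real) \<Rightarrow> ennreal" where
  "affinity d lam I J Y z \<equiv> \<Prod>j\<in>J. \<Prod>i\<in>I. ennreal (bump lam (Y i j) (dot d (z i) (z j)))"

lemma block_fold:
  assumes \<mu>: "prob_space \<mu>" "sets \<mu> = sets (vec_space d)"
    and I: "finite I" "finite J" "I \<inter> J = {}"
  shows "(\<integral>\<^sup>+z. (affinity d lam I J y z) \<partial>(rows (I \<union> J) \<mu>)) =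
    (\<integral>\<^sup>+x. (\<Prod>j\<in>J. row_affinity \<mu> d lam I (\<lambda>i. y i j) x) \<partial>(rows I \<mu>))"
proof -
  note [measurable_cong] = \<mu>(2) sets_PiM_law[OF \<mu>(2)]
  interpret prob_space \<mu> by fact
  interpret product_sigma_finite "\<lambda>_::nat. \<mu>" by standard
  have "(\<integral>\<^sup>+z. (affinity d lam I J y z) \<partial>(rows (I \<union> J) \<mu>)) =
    (\<integral>\<^sup>+x. (\<integral>\<^sup>+w. (\<Prod>j\<in>J. \<Prod>i\<in>I. ennreal (bump lam (y i j) (dot d (merge I J (x, w) i) (merge I J (x, w) j)))) \<partial>(rows J \<mu>)) \<partial>(rows I \<mu>))"
    using I by (intro product_nn_integral_fold) auto
  also have "\<dots> = (\<integral>\<^sup>+x. (\<integral>\<^sup>+w. (\<Prod>j\<in>J. \<Prod>i\<in>I. ennreal (bump lam (y i j) (dot d (x i) (w j)))) \<partial>(rows J \<mu>)) \<partial>(rows I \<mu>))"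
    using I by (intro nn_integral_cong prod.cong refl) (auto simp: merge_def disjoint_iff)
  also have "\<dots> = (\<integral>\<^sup>+x. (\<Prod>j\<in>J. row_affinity \<mu> d lam I (\<lambda>i. y i j) x) \<partial>(rows I \<mu>))"
    unfolding row_affinity_def using I
    by (intro nn_integral_cong product_nn_integral_prod) auto
  finally show ?thesis .
qed

section \<open>From blocks to the Gram matrix\<close>

text \<open>By induction on the blocks; the rows in \<open>S\<close> that belong to no block integrate to \<open>1\<close>.\<close>
lemma independent_blocks_affinity:
  fixes \<Theta> :: ennreal and S :: "nat set"
  assumes \<mu>: "prob_space \<mu>" "sets \<mu> = sets (vec_space d)"
    and K: "finite K" and S: "finite S" "\<And>b. b \<in> K \<Longrightarrow> I b \<union> J b \<subseteq> S"
    and disj: "disjoint_family_on (\<lambda>b. I b \<union> J b) K"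
    and \<Theta>: "\<And>b. b \<in> K \<Longrightarrow>
      (\<integral>\<^sup>+z. (\<Prod>j\<in>J b. \<Prod>i\<in>I b. ennreal (bump lam (y i j) (dot d (z i) (z j)))) \<partial>(rows (I b \<union> J b) \<mu>)) \<le> \<Theta>"
  shows "(\<integral>\<^sup>+z. (\<Prod>b\<in>K. \<Prod>j\<in>J b. \<Prod>i\<in>I b. ennreal (bump lam (y i j) (dot d (z i) (z j)))) \<partial>(rows S \<mu>)) \<le> \<Theta> ^ card K"
  using K S disj \<Theta>
proof (induction K arbitrary: S)
  case empty
  interpret prob_space \<mu> by fact
  interpret P: product_prob_space "\<lambda>_::nat. \<mu>" S by standard
  show ?case by (simp add: P.emeasure_space_1)
next
  case (insert b K)
  note [measurable_cong] = \<mu>(2) sets_PiM_law[OF \<mu>(2)]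
  interpret prob_space \<mu> by fact
  interpret product_sigma_finite "\<lambda>_::nat. \<mu>" by standard
  define F where "F b z = (\<Prod>j\<in>J b. \<Prod>i\<in>I b. ennreal (bump lam (y i j) (dot d (z i) (z j))))" for b z
  have F_meas [measurable]: "F b' \<in> borel_measurable (rows R (vec_space d))" if "I b' \<union> J b' \<subseteq> R" for b' R
    unfolding F_def
  proof (intro borel_measurable_prod_ennreal)
    fix j i assume "j \<in> J b'" "i \<in> I b'"
    then have "i \<in> R" "j \<in> R" using that by auto
    then show "(\<lambda>x. ennreal (bump lam (y i j) (dot d (x i) (x j)))) \<in> borel_measurable (rows R (vec_space d))"
      by measurable
  qed
  have F_cong: "F b' z = F b' z'" if "\<And>i. i \<in> I b' \<union> J b' \<Longrightarrow> z i = z' i" for b' z z'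
    unfolding F_def using that by (intro prod.cong) auto
  define U where "U = I b \<union> J b"
  define R where "R = S - U"
  have US: "U \<union> R = S" "U \<inter> R = {}" "finite U" "finite R"
    using insert.prems unfolding R_def U_def by (auto intro: finite_subset)
  have KR: "I c \<union> J c \<subseteq> R" if "c \<in> K" for c
  proof -
    have "(I b \<union> J b) \<inter> (I c \<union> J c) = {}"
      using insert.prems(3) insert.hyps that by (intro disjoint_family_onD[of _ "insert b K" b c]) auto
    then show ?thesis using insert.prems(2)[of c] that by (auto simp: R_def U_def)
  qed
  have m1 [measurable]: "F b \<in> borel_measurable (rows U (vec_space d))" by (intro F_meas) (simp add: U_def)
  have m2 [measurable]: "(\<lambda>w. \<Prod>c\<in>K. F c w) \<in> borel_measurable (rows R (vec_space d))"
    using KR by (intro borel_measurable_prod_ennreal F_meas)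
  have m3: "(\<lambda>w. F b w * (\<Prod>c\<in>K. F c w)) \<in> borel_measurable (rows S (vec_space d))"
    using insert.prems(2) by (intro borel_measurable_times_ennreal borel_measurable_prod_ennreal F_meas) auto
  have "(\<integral>\<^sup>+z. (\<Prod>c\<in>insert b K. F c z) \<partial>(rows S \<mu>)) = (\<integral>\<^sup>+z. F b z * (\<Prod>c\<in>K. F c z) \<partial>(rows (U \<union> R) \<mu>))"
    using insert.hyps US by simp
  also have "\<dots> = (\<integral>\<^sup>+x. (\<integral>\<^sup>+w. F b (merge U R (x, w)) * (\<Prod>c\<in>K. F c (merge U R (x, w))) \<partial>(rows R \<mu>)) \<partial>(rows U \<mu>))"
    using US m3 by (intro product_nn_integral_fold) (auto simp: measurable_cong_sets[OF sets_PiM_law[OF \<mu>(2)] refl])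
  also have "\<dots> = (\<integral>\<^sup>+x. (\<integral>\<^sup>+w. F b x * (\<Prod>c\<in>K. F c w) \<partial>(rows R \<mu>)) \<partial>(rows U \<mu>))"
  proof (intro nn_integral_cong arg_cong2[where f = "(*)"] prod.cong refl)
    fix x w c
    show "F b (merge U R (x, w)) = F b x" by (intro F_cong) (auto simp: merge_def U_def)
    assume "c \<in> K"
    then show "F c (merge U R (x, w)) = F c w"
      using KR[of c] US by (intro F_cong) (auto simp: merge_def)
  qed
  also have "\<dots> = (\<integral>\<^sup>+x. F b x \<partial>(rows U \<mu>)) * (\<integral>\<^sup>+w. (\<Prod>c\<in>K. F c w) \<partial>(rows R \<mu>))"
    by (simp add: nn_integral_cmult nn_integral_multc)
  also have "\<dots> \<le> \<Theta> * \<Theta> ^ card K"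
  proof (intro mult_mono)
    show "(\<integral>\<^sup>+x. F b x \<partial>(rows U \<mu>)) \<le> \<Theta>" using insert.prems(4)[of b] by (simp add: F_def U_def)
    show "(\<integral>\<^sup>+w. (\<Prod>c\<in>K. F c w) \<partial>(rows R \<mu>)) \<le> \<Theta> ^ card K"
      unfolding F_def
    proof (rule insert.IH)
      show "disjoint_family_on (\<lambda>b. I b \<union> J b) K"
        using insert.prems(3) by (rule disjoint_family_on_mono[rotated]) auto
    qed (use US KR insert.prems in auto)
  qed auto
  finally show ?case using insert.hyps by (simp add: F_def)
qed

lemma mod_shift_cancel:
  fixes b \<sigma> g :: nat
  assumes "b < g" "\<sigma> < g"
  shows "((b + \<sigma>) mod g + (g - b)) mod g = \<sigma>"
proof -
  have "b + \<sigma> + (g - b) = \<sigma> + g" using assms by linarith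
  then have "((b + \<sigma>) mod g + (g - b)) mod g = (\<sigma> + g) mod g" by (simp only: mod_add_left_eq)
  with assms show ?thesis by (simp only: mod_add_self2 mod_less)
qed

lemma bij_betw_mod_shift:
  fixes b g :: nat
  assumes "b < g"
  shows "bij_betw (\<lambda>\<sigma>. (b + \<sigma>) mod g) {..<g} {..<g}"
proof -
  have inv: "((b + x) mod g + (g - b)) mod g = x" if "x \<in> {..<g}" for x
    using that by (intro mod_shift_cancel assms) simp
  have "inj_on (\<lambda>\<sigma>. (b + \<sigma>) mod g) {..<g}"
    by (rule inj_on_inverseI[where g = "\<lambda>c. (c + (g - b)) mod g"]) (rule inv)
  moreover have "(\<lambda>\<sigma>. (b + \<sigma>) mod g) ` {..<g} \<subseteq> {..<g}"
    using assms by (intro image_subsetI) (simp only: lessThan_iff mod_less_divisor)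
  ultimately show ?thesis unfolding bij_betw_def by (intro conjI endo_inj_surj[OF finite_lessThan])
qed

text \<open>For each \<open>b\<close>, the block paired with it runs through all blocks of the second half as the shift varies; so the sum
  over all shifts counts each entry of the upper right quarter once.\<close>
lemma sum_shifted_blocks_le:
  fixes err :: "nat \<Rightarrow> nat \<Rightarrow> real"
  assumes nonneg: "\<And>i j. err i j \<ge> 0" and n: "2 * g * a \<le> n"
  shows "(\<Sum>\<sigma><g. \<Sum>b<g. \<Sum>j\<in>{g * a + (b + \<sigma>) mod g * a..<g * a + (b + \<sigma>) mod g * a + a}. \<Sum>i\<in>{b * a..<b * a + a}. err i j)
    \<le> (\<Sum>i<n. \<Sum>j<n. err i j)"
proof -
  define T where "T b c = (\<Sum>j\<in>{g * a + c * a..<g * a + c * a + a}. \<Sum>i\<in>{b * a..<b * a + a}. err i j)" for b c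
  have "(\<Sum>\<sigma><g. \<Sum>b<g. T b ((b + \<sigma>) mod g)) = (\<Sum>b<g. \<Sum>\<sigma><g. T b ((b + \<sigma>) mod g))" by (rule sum.swap)
  also have "\<dots> = (\<Sum>b<g. \<Sum>c<g. T b c)"
    by (intro sum.cong refl sum.reindex_bij_betw bij_betw_mod_shift) simp
  also have "\<dots> = (\<Sum>c<g. \<Sum>b<g. T b c)" by (rule sum.swap)
  also have "\<dots> = (\<Sum>c<g. \<Sum>j\<in>{c * a..<c * a + a}. \<Sum>b<g. \<Sum>i\<in>{b * a..<b * a + a}. err i (j + g * a))"
  proof (rule sum.cong[OF refl])
    fix c
    have "(\<Sum>b<g. T b c) = (\<Sum>b<g. \<Sum>j\<in>{c * a..<c * a + a}. \<Sum>i\<in>{b * a..<b * a + a}. err i (j + g * a))"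
    proof (rule sum.cong[OF refl])
      fix b
      have "T b c = (\<Sum>j\<in>{c * a + g * a..<c * a + a + g * a}. \<Sum>i\<in>{b * a..<b * a + a}. err i j)"
        unfolding T_def by (intro sum.cong) auto
      then show "T b c = (\<Sum>j\<in>{c * a..<c * a + a}. \<Sum>i\<in>{b * a..<b * a + a}. err i (j + g * a))"
        by (simp only: sum.shift_bounds_nat_ivl)
    qed
    also have "\<dots> = (\<Sum>j\<in>{c * a..<c * a + a}. \<Sum>b<g. \<Sum>i\<in>{b * a..<b * a + a}. err i (j + g * a))" by (rule sum.swap)
    finally show "(\<Sum>b<g. T b c) = \<dots>" .
  qed
  also have "\<dots> = (\<Sum>j<g * a. \<Sum>i<g * a. err i (j + g * a))" by (simp add: sum.nat_group)
  also have "\<dots> = (\<Sum>i<g * a. \<Sum>j<g * a. err i (j + g * a))" by (rule sum.swap)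
  also have "\<dots> = (\<Sum>i<g * a. \<Sum>j\<in>{g * a..<g * a + g * a}. err i j)"
  proof (rule sum.cong[OF refl])
    fix i
    have "(\<Sum>j\<in>{0 + g * a..<g * a + g * a}. err i j) = (\<Sum>j\<in>{0..<g * a}. err i (j + g * a))"
      by (rule sum.shift_bounds_nat_ivl)
    then show "(\<Sum>j<g * a. err i (j + g * a)) = (\<Sum>j\<in>{g * a..<g * a + g * a}. err i j)"
      by (simp only: atLeast0LessThan add_0)
  qed
  also have "\<dots> \<le> (\<Sum>i<g * a. \<Sum>j<n. err i j)"
    using n nonneg by (intro sum_mono sum_mono2) auto
  also have "\<dots> \<le> (\<Sum>i<n. \<Sum>j<n. err i j)"
    using n nonneg by (intro sum_mono2) (auto intro: sum_nonneg)
  finally show ?thesis by (simp add: T_def)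
qed

lemma block_index_div:
  fixes a b i :: nat
  assumes "i \<in> {b * a..<b * a + a}"
  shows "i div a = b"
  using assms by (intro div_nat_eqI) (auto simp: mult.commute)

text \<open>The pigeonhole over the shifts costs the factor \<open>g\<close> and allows the exponential Markov inequality to be applied with
  error \<open>t / g\<close>. Working with a fixed shift is essential when \<open>d\<close> is much smaller than \<open>n\<close>: all rows must take part, but each of
  them only in a block whose size is comparable with \<open>d\<close>.\<close>
lemma gram_small_ball_of_blocks:
  fixes \<Theta> t lam :: real
  assumes \<mu>: "prob_space \<mu>" "sets \<mu> = sets (vec_space d)"
    and a: "a > 0" and g: "g > 0" and n: "2 * g * a \<le> n" and lam: "lam > 0" and \<Theta>0: "\<Theta> \<ge> 0"
    and \<Theta>: "\<And>I J. finite I \<Longrightarrow> finite J \<Longrightarrow> I \<inter> J = {} \<Longrightarrow> card I = a \<Longrightarrow> card J = a \<Longrightarrow>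
      (\<integral>\<^sup>+z. (affinity d lam I J Y z) \<partial>(rows (I \<union> J) \<mu>)) \<le> ennreal \<Theta>"
  shows "emeasure (\<Pi>\<^sub>M i\<in>{..<n}. \<mu>) {z \<in> space (\<Pi>\<^sub>M i\<in>{..<n}. vec_space d). (\<Sum>i<n. \<Sum>j<n. (dot d (z i) (z j) - Y i j)\<^sup>2) \<le> t}
    \<le> ennreal (g * exp (lam * t / g) * \<Theta> ^ g)"
proof -
  note [measurable_cong] = \<mu>(2) sets_PiM_law[OF \<mu>(2)]
  interpret prob_space \<mu> by fact
  define I where "I b = {b * a..<b * a + a}" for b
  define J where "J \<sigma> b = {g * a + (b + \<sigma>) mod g * a..<g * a + (b + \<sigma>) mod g * a + a}" for \<sigma> b
  have Ib: "i div a = b" if "i \<in> I b" for i b using that by (intro block_index_div) (auto simp: I_def)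
  have Jb: "j div a = g + (b + \<sigma>) mod g" if "j \<in> J \<sigma> b" for j \<sigma> b
    using that by (intro block_index_div) (auto simp: J_def algebra_simps)
  have J_lt: "c * a + a \<le> g * a" if "c < g" for c
  proof -
    have "Suc c * a \<le> g * a" using that by (intro mult_right_mono) auto
    then show ?thesis by simp
  qed
  define E where "E \<sigma> z = (\<Prod>b<g. \<Prod>j\<in>J \<sigma> b. \<Prod>i\<in>I b. ennreal (bump lam (Y i j) (dot d (z i) (z j))))" for \<sigma> z
  have sub: "I b \<union> J \<sigma> b \<subseteq> {..<n}" if "b < g" for \<sigma> b
    using J_lt[OF that] J_lt[of "(b + \<sigma>) mod g"] g n by (auto simp: I_def J_def)
  have [measurable]: "E \<sigma> \<in> borel_measurable (\<Pi>\<^sub>M i\<in>{..<n}. vec_space d)" for \<sigma>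
    unfolding E_def
  proof (intro borel_measurable_prod_ennreal)
    fix b j i assume "b \<in> {..<g}" "j \<in> J \<sigma> b" "i \<in> I b"
    then have "i \<in> {..<n}" "j \<in> {..<n}" using sub[of b \<sigma>] by auto
    then show "(\<lambda>z. ennreal (bump lam (Y i j) (dot d (z i) (z j)))) \<in> borel_measurable (\<Pi>\<^sub>M i\<in>{..<n}. vec_space d)"
      by measurable
  qed
  have E_le: "(\<integral>\<^sup>+z. E \<sigma> z \<partial>(\<Pi>\<^sub>M i\<in>{..<n}. \<mu>)) \<le> ennreal \<Theta> ^ g" if "\<sigma> < g" for \<sigma>
  proof -
    have "(\<integral>\<^sup>+z. E \<sigma> z \<partial>(\<Pi>\<^sub>M i\<in>{..<n}. \<mu>)) \<le> ennreal \<Theta> ^ card {..<g}"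
      unfolding E_def
    proof (rule independent_blocks_affinity[OF \<mu>])
      show "disjoint_family_on (\<lambda>b. I b \<union> J \<sigma> b) {..<g}"
      proof (unfold disjoint_family_on_def, intro ballI impI)
        fix b c assume bc: "b \<in> {..<g}" "c \<in> {..<g}" "b \<noteq> c"
        have ne: "(b + \<sigma>) mod g \<noteq> (c + \<sigma>) mod g"
          using inj_onD[OF bij_betw_imp_inj_on[OF bij_betw_mod_shift[OF that]], of b c] bc by (simp only: add.commute) blast
        show "(I b \<union> J \<sigma> b) \<inter> (I c \<union> J \<sigma> c) = {}"
        proof (intro equals0I)
          fix x assume "x \<in> (I b \<union> J \<sigma> b) \<inter> (I c \<union> J \<sigma> c)"
          then have "x div a = b \<or> x div a = g + (b + \<sigma>) mod g" "x div a = c \<or> x div a = g + (c + \<sigma>) mod g"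
            using Ib Jb by blast+
          moreover have "b < g" "c < g" using bc by auto
          ultimately show False using ne bc(3) by linarith
        qed
      qed
    next
      fix b assume b: "b \<in> {..<g}"
      have "I b \<inter> J \<sigma> b = {}"
      proof (intro equals0I)
        fix x assume "x \<in> I b \<inter> J \<sigma> b"
        then have "x div a = b" "x div a = g + (b + \<sigma>) mod g" using Ib Jb by blast+
        then show False using b by simp
      qed
      then show "(\<integral>\<^sup>+z. (\<Prod>j\<in>J \<sigma> b. \<Prod>i\<in>I b. ennreal (bump lam (Y i j) (dot d (z i) (z j)))) \<partial>(rows (I b \<union> J \<sigma> b) \<mu>)) \<le> ennreal \<Theta>"
        by (intro \<Theta>) (auto simp: I_def J_def)
    qed (use sub in auto)
    then show ?thesis by simp
  qed
  let ?A = "{z \<in> space (\<Pi>\<^sub>M i\<in>{..<n}. vec_space d). (\<Sum>i<n. \<Sum>j<n. (dot d (z i) (z j) - Y i j)\<^sup>2) \<le> t}"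
  have "emeasure (\<Pi>\<^sub>M i\<in>{..<n}. \<mu>) ?A \<le> (\<integral>\<^sup>+z. (\<Sum>\<sigma><g. ennreal (exp (lam * t / g)) * E \<sigma> z) \<partial>(\<Pi>\<^sub>M i\<in>{..<n}. \<mu>))"
  proof (rule emeasure_le_nn_integral)
    show "?A \<in> sets (\<Pi>\<^sub>M i\<in>{..<n}. \<mu>)" unfolding sets_PiM_law[OF \<mu>(2)] by measurable
  next
    fix z assume z: "z \<in> ?A"
    define err where "err i j = (dot d (z i) (z j) - Y i j)\<^sup>2" for i j
    define S where "S \<sigma> = (\<Sum>b<g. \<Sum>j\<in>J \<sigma> b. \<Sum>i\<in>I b. err i j)" for \<sigma>
    have "(\<Sum>\<sigma><g. S \<sigma>) \<le> (\<Sum>i<n. \<Sum>j<n. err i j)"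
      unfolding S_def J_def I_def by (intro sum_shifted_blocks_le n) (simp add: err_def)
    also have "\<dots> \<le> t" using z by (simp add: err_def)
    finally have "(\<Sum>\<sigma><g. S \<sigma>) \<le> t" .
    have "\<exists>\<sigma><g. S \<sigma> \<le> t / g"
    proof (rule ccontr)
      assume "\<not> ?thesis"
      then have "(\<Sum>\<sigma><g. t / g) < (\<Sum>\<sigma><g. S \<sigma>)" using g by (intro sum_strict_mono) auto
      then show False using g \<open>(\<Sum>\<sigma><g. S \<sigma>) \<le> t\<close> by simp
    qed
    then obtain \<sigma> where \<sigma>: "\<sigma> < g" "S \<sigma> \<le> t / g" by blast
    have ES: "E \<sigma> z = ennreal (exp (- lam * S \<sigma>))"
    proof -
      have "E \<sigma> z = ennreal (\<Prod>b<g. \<Prod>j\<in>J \<sigma> b. \<Prod>i\<in>I b. bump lam (Y i j) (dot d (z i) (z j)))"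
        unfolding E_def by (simp add: prod_ennreal prod_nonneg bump_pos less_imp_le)
      also have "(\<Prod>b<g. \<Prod>j\<in>J \<sigma> b. \<Prod>i\<in>I b. bump lam (Y i j) (dot d (z i) (z j))) = exp (- lam * S \<sigma>)"
        unfolding S_def bump_def err_def sum_distrib_left by (simp add: exp_sum I_def J_def)
      finally show ?thesis .
    qed
    have "lam * S \<sigma> \<le> lam * (t / g)" using \<sigma> lam by (intro mult_left_mono) auto
    then have "1 \<le> exp (lam * t / g) * exp (- lam * S \<sigma>)" by (simp add: mult_exp_exp)
    then have "ennreal 1 \<le> ennreal (exp (lam * t / g) * exp (- lam * S \<sigma>))" by (rule ennreal_leI)
    then have "1 \<le> ennreal (exp (lam * t / g)) * E \<sigma> z" unfolding ES by (simp add: ennreal_mult)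
    also have "\<dots> \<le> (\<Sum>\<sigma><g. ennreal (exp (lam * t / g)) * E \<sigma> z)" using \<sigma>(1) by (intro member_le_sum) auto
    finally show "1 \<le> (\<Sum>\<sigma><g. ennreal (exp (lam * t / g)) * E \<sigma> z)" .
  qed
  also have "\<dots> = (\<Sum>\<sigma><g. ennreal (exp (lam * t / g)) * (\<integral>\<^sup>+z. E \<sigma> z \<partial>(\<Pi>\<^sub>M i\<in>{..<n}. \<mu>)))"
    by (subst nn_integral_sum) (auto simp: nn_integral_cmult)
  also have "\<dots> \<le> (\<Sum>\<sigma><g. ennreal (exp (lam * t / g)) * ennreal \<Theta> ^ g)"
    by (intro sum_mono mult_left_mono E_le) auto
  also have "\<dots> = ennreal (g * exp (lam * t / g) * \<Theta> ^ g)"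
    using \<Theta>0 by (simp add: ennreal_mult ennreal_power ennreal_of_nat_eq_real_of_nat mult.assoc)
  finally show ?thesis .
qed

section \<open>Several Gaussian rows\<close>

definition loss_ball :: "nat \<Rightarrow> nat \<Rightarrow> (nat \<Rightarrow> nat \<Rightarrow> real) \<Rightarrow> real \<Rightarrow> (nat \<Rightarrow> nat \<Rightarrow> real) set" where
  "loss_ball n d Y \<tau> = {z \<in> space (\<Pi>\<^sub>M i\<in>{..<n}. vec_space d). loss n d (gram d z) Y \<le> \<tau>}"

lemma gram_eq_dot: "gram d z i j = dot d (z i) (z j)"
  by (simp add: gram_def dot_def)

lemma loss_eq:
  "loss n d X Y = real d / (real n * (real n + 1)) * (\<Sum>i<n. \<Sum>j<n. (X i j - Y i j)\<^sup>2)"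
  unfolding loss_def frobenius_norm_def by (simp add: sum_nonneg)

lemma loss_ball_eq:
  assumes "n > 0" "d > 0"
  shows "loss_ball n d Y \<tau> = {z \<in> space (\<Pi>\<^sub>M i\<in>{..<n}. vec_space d).
    (\<Sum>i<n. \<Sum>j<n. (dot d (z i) (z j) - Y i j)\<^sup>2) \<le> \<tau> * (real n * (real n + 1)) / d}"
proof -
  have "real d / D * S \<le> \<tau> \<longleftrightarrow> S \<le> \<tau> * D / d" if "D > 0" for D S :: real
    using that assms by (simp add: field_simps)
  then show ?thesis unfolding loss_ball_def loss_eq gram_eq_dot using assms by simp
qed

text \<open>With \<open>n \<le> 4 g a\<close> the cost of the exponential Markov inequality is \<open>exp (8 a n)\<close>, whatever \<open>\<Lambda>\<close> is; the gain \<open>exp (- L a\<^sup>2 g)\<close> wins once \<open>L\<close> is large.\<close>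
lemma loss_ball_of_blocks:
  assumes \<mu>: "prob_space \<mu>" "sets \<mu> = sets (vec_space d)"
    and d: "d > 0" and a: "a > 0" "2 * a \<le> n" and \<Lambda>: "\<Lambda> > 0" and L: "L \<ge> 0"
    and \<Theta>: "\<And>I J. finite I \<Longrightarrow> finite J \<Longrightarrow> I \<inter> J = {} \<Longrightarrow> card I = a \<Longrightarrow> card J = a \<Longrightarrow>
      (\<integral>\<^sup>+z. (affinity d (\<Lambda> * real d) I J Y z) \<partial>(rows (I \<union> J) \<mu>)) \<le> ennreal (exp (- L * (real a)\<^sup>2))"
  shows "emeasure (\<Pi>\<^sub>M i\<in>{..<n}. \<mu>) (loss_ball n d Y (1 / \<Lambda>)) \<le> ennreal (exp (9 * real a * real n - L * real a * real n / 4))"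
proof -
  \<comment> \<open>The division loses less than half of the rows: \<open>n \<le> 4 g a\<close>.\<close>
  define g where "g = n div (2 * a)"
  have g: "g > 0" using a by (simp add: g_def div_greater_zero_iff)
  have gn: "2 * g * a \<le> n" using div_times_less_eq_dividend[of n "2 * a"] by (simp add: g_def ac_simps)
  have "n < (g + 1) * (2 * a)" using a dividend_less_div_times[of "2 * a" n] by (simp add: g_def algebra_simps)
  also have "\<dots> \<le> (2 * g) * (2 * a)" using g by (intro mult_right_mono) auto
  finally have ng: "real n \<le> 4 * (real g * real a)"
    using of_nat_mono[of n "2 * g * (2 * a)", where 'a = real] by (simp add: ac_simps)
  have n: "n > 0" using a by simp
  have gle: "real g \<le> real n" unfolding g_def by simp
  let ?t = "1 / \<Lambda> * (real n * (real n + 1)) / d"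
  have "emeasure (\<Pi>\<^sub>M i\<in>{..<n}. \<mu>) (loss_ball n d Y (1 / \<Lambda>)) \<le> ennreal (g * exp (\<Lambda> * d * ?t / g) * exp (- L * (real a)\<^sup>2) ^ g)"
    unfolding loss_ball_eq[OF n d]
  proof (rule gram_small_ball_of_blocks[OF \<mu> a(1) g gn])
    show "\<Lambda> * d > 0" using \<Lambda> d by simp
    show "exp (- L * (real a)\<^sup>2) \<ge> 0" by simp
  qed (rule \<Theta>)
  also have "\<dots> \<le> ennreal (exp (9 * real a * real n - L * real a * real n / 4))"
  proof (intro ennreal_leI)
    have "\<Lambda> * d * ?t / g = real n * (real n + 1) / g" using \<Lambda> d by simp
    also have "\<dots> \<le> real n * (2 * real n) / g" using n by (intro divide_right_mono mult_left_mono) auto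
    also have "\<dots> = 2 * real n * (real n / g)" by simp
    also have "\<dots> \<le> 2 * real n * (4 * real a)"
      using ng g by (intro mult_left_mono) (auto simp: field_simps)
    also have "\<dots> = 8 * real a * real n" by simp
    finally have 1: "exp (\<Lambda> * d * ?t / g) \<le> exp (8 * real a * real n)" by (simp only: exp_le_cancel_iff)
    have "real g \<le> real n" by (rule gle)
    also have "\<dots> \<le> exp (real n)" using exp_ge_add_one_self[of "real n"] by linarith
    also have "\<dots> \<le> exp (real a * real n)" using a n by simp
    finally have 2: "real g \<le> exp (real a * real n)" .
    have 3: "exp (- L * (real a)\<^sup>2) ^ g \<le> exp (- (L * a * n / 4))"
    proof -
      have "(L * a) * real n \<le> (L * a) * (4 * (real g * real a))" using ng L by (intro mult_left_mono) auto
      then have "real g * (- L * (real a)\<^sup>2) \<le> - (L * a * n / 4)" by (simp add: power2_eq_square algebra_simps)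
      then show ?thesis by (simp only: exp_of_nat_mult[symmetric] exp_le_cancel_iff)
    qed
    have "g * exp (\<Lambda> * d * ?t / g) * exp (- L * (real a)\<^sup>2) ^ g \<le> exp (real a * real n) * exp (8 * real a * real n) * exp (- (L * a * n / 4))"
      by (intro mult_mono 1 2 3) auto
    also have "\<dots> = exp (9 * real a * real n - L * real a * real n / 4)" by (simp add: mult_exp_exp)
    finally show "g * exp (\<Lambda> * d * ?t / g) * exp (- L * (real a)\<^sup>2) ^ g \<le> exp (9 * real a * real n - L * real a * real n / 4)" .
  qed
  finally show ?thesis .
qed

lemma block_exponent_bound:
  assumes "min n d \<le> 3 * a" "K > 0" "L = 36 + 12 * K"
  shows "ennreal (exp (9 * real a * real n - L * real a * real n / 4)) \<le> ennreal (exp (- K * real n * real (min n d)))"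
proof (intro ennreal_leI)
  have "real (min n d) \<le> 3 * real a" using assms(1) by linarith
  then have "(K * n) * real (min n d) \<le> (K * n) * (3 * real a)" using assms(2) by (intro mult_left_mono) auto
  then have "9 * real a * real n - L * real a * real n / 4 \<le> - K * real n * real (min n d)"
    unfolding assms(3) by (simp add: algebra_simps)
  then show "exp (9 * real a * real n - L * real a * real n / 4) \<le> exp (- K * real n * real (min n d))"
    by (simp only: exp_le_cancel_iff)
qed

text \<open>The parameters \<open>\<delta> = q / 16\<close> and \<open>\<epsilon> = q\<^sup>2 / 32\<close> make both terms of \<open>block_affinity_bound\<close> equal to \<open>q\<close> to the power \<open>a\<close>.\<close>
lemma gaussian_block_affinity:
  fixes I J :: "nat set"
  assumes d: "d > 0" and q: "0 < q" "q \<le> 1 / 2" and a: "2 * a \<le> d + 1"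
    and I: "finite I" "finite J" "I \<inter> J = {}" "card I = a" "card J = a"
  shows "(\<integral>\<^sup>+z. (affinity d (1024 / q ^ 4 * real d) I J Y z) \<partial>(rows (I \<union> J) (gaussian_law d)))
    \<le> ennreal ((2 * q) ^ (a ^ 2))"
proof -
  have P: "prob_space (gaussian_law d)" using d by (rule prob_space_gaussian_law)
  have lam: "1024 / q ^ 4 * real d = real d / (q\<^sup>2 / 32)\<^sup>2" using q by (simp add: power_divide flip: power_mult)
  have "(\<integral>\<^sup>+x. (\<Prod>j\<in>J. row_affinity (gaussian_law d) d (real d / (q\<^sup>2 / 32)\<^sup>2) I (\<lambda>i. Y i j) x) \<partial>(rows I (gaussian_law d)))
    \<le> ennreal (((2 * (q\<^sup>2 / 32) / (q / 16)) ^ card J + q ^ a) ^ card I)"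
  proof (rule block_affinity_bound[OF d _ _ _ P sets_gaussian_law _ a])
    fix r f assume r: "orthonormal d r f" "d \<le> 2 * r" "a \<le> r"
    have "emeasure (gaussian_law d) {u \<in> space (vec_space d). proj_sq d r f u \<le> (q / 16)\<^sup>2} \<le> ennreal ((16 * (q / 16)) ^ r)"
      using q by (intro gaussian_small_projection d r) auto
    also have "\<dots> \<le> ennreal (q ^ a)" using q r by (intro ennreal_leI) (simp add: power_decreasing)
    finally show "emeasure (gaussian_law d) {u \<in> space (vec_space d). proj_sq d r f u \<le> (q / 16)\<^sup>2} \<le> ennreal (q ^ a)" .
  qed (use q I in auto)
  also have "\<dots> \<le> ennreal ((2 * q) ^ (a ^ 2))"
  proof (intro ennreal_leI)
    have "2 * (q\<^sup>2 / 32) / (q / 16) = q" using q by (simp add: power2_eq_square)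
    then have "((2 * (q\<^sup>2 / 32) / (q / 16)) ^ card J + q ^ a) ^ card I = (2 * q ^ a) ^ a" using I by simp
    also have "\<dots> \<le> ((2 * q) ^ a) ^ a"
    proof (cases "a = 0")
      case False
      then have "(2::real) ^ 1 \<le> 2 ^ a" by (intro power_increasing) auto
      then show ?thesis using q by (intro power_mono) (auto simp: power_mult_distrib)
    qed simp
    also have "\<dots> = (2 * q) ^ (a ^ 2)" by (simp only: power_mult[symmetric] power2_eq_square)
    finally show "((2 * (q\<^sup>2 / 32) / (q / 16)) ^ card J + q ^ a) ^ card I \<le> (2 * q) ^ (a ^ 2)" .
  qed
  finally show ?thesis unfolding block_fold[OF P sets_gaussian_law I(1-3)] lam .
qed

lemma gaussian_loss_ball:
  assumes K: "K > 0"
  obtains \<tau> where "\<tau> > 0" "\<And>n d Y. n \<ge> 2 \<Longrightarrow> d > 0 \<Longrightarrow>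
    emeasure (\<Pi>\<^sub>M i\<in>{..<n}. gaussian_law d) (loss_ball n d Y \<tau>) \<le> ennreal (exp (- K * real n * real (min n d)))"
proof
  \<comment> \<open>\<open>L a n / 4 - 9 a n = 3 K a n\<close>, and \<open>min n d \<le> 3 a\<close> for the block size \<open>a\<close> below.\<close>
  define L where "L = 36 + 12 * K"
  define q where "q = exp (- L) / 2"
  have q: "0 < q" "q \<le> 1 / 2" "2 * q = exp (- L)" using K by (simp_all add: q_def L_def)
  show "1 / (1024 / q ^ 4) > 0" using q by simp
  fix n d :: nat and Y assume n: "n \<ge> 2" and d: "d > 0"
  define a where "a = min (n div 2) ((d + 1) div 2)"
  have a: "a > 0" "2 * a \<le> n" "2 * a \<le> d + 1" "min n d \<le> 3 * a" using n d by (auto simp: a_def)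
  have "emeasure (\<Pi>\<^sub>M i\<in>{..<n}. gaussian_law d) (loss_ball n d Y (1 / (1024 / q ^ 4))) \<le> ennreal (exp (9 * real a * real n - L * real a * real n / 4))"
  proof (rule loss_ball_of_blocks[OF prob_space_gaussian_law[OF d] sets_gaussian_law d a(1,2)])
    fix I J :: "nat set" assume I: "finite I" "finite J" "I \<inter> J = {}" "card I = a" "card J = a"
    have "(2 * q) ^ (a ^ 2) = exp (- L * (real a)\<^sup>2)"
      unfolding q(3) by (subst exp_of_nat_mult[symmetric]) (simp add: mult.commute)
    with gaussian_block_affinity[OF d q(1,2) a(3) I]
    show "(\<integral>\<^sup>+z. (affinity d (1024 / q ^ 4 * real d) I J Y z) \<partial>(rows (I \<union> J) (gaussian_law d))) \<le> ennreal (exp (- L * (real a)\<^sup>2))"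
      by simp
  qed (use q K in \<open>auto simp: L_def\<close>)
  also have "\<dots> \<le> ennreal (exp (- K * real n * real (min n d)))"
    using a(4) K by (intro block_exponent_bound) (auto simp: L_def)
  finally show "emeasure (\<Pi>\<^sub>M i\<in>{..<n}. gaussian_law d) (loss_ball n d Y (1 / (1024 / q ^ 4))) \<le> ennreal (exp (- K * real n * real (min n d)))" .
qed

section \<open>The sphere as the set of directions of a Gaussian vector\<close>

text \<open>At the origin the direction is \<open>0\<close>, by division by zero.\<close>
definition normalize_vec :: "nat \<Rightarrow> (nat \<Rightarrow> real) \<Rightarrow> nat \<Rightarrow> real" where
  "normalize_vec d w = (\<lambda>k\<in>{..<d}. w k / vec_norm d w)"

lemma measurable_normalize_vec [measurable]:
  "normalize_vec d \<in> measurable (vec_space d) (vec_space d)"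
  unfolding normalize_vec_def vec_norm_def by measurable

lemma sets_sphere_law: "sets (sphere_law d) = sets (vec_space d)"
  by (simp add: sphere_law_def)

lemma space_sphere_law: "space (sphere_law d) = space (vec_space d)"
  by (simp add: sphere_law_def)

lemma vec_norm_nonneg: "vec_norm d x \<ge> 0"
  by (simp add: vec_norm_def sum_nonneg)

lemma vec_norm_dilate: "s > 0 \<Longrightarrow> vec_norm d (dilate d s x) = s * vec_norm d x"
proof -
  assume s: "s > 0"
  have "(\<Sum>k<d. (dilate d s x k)\<^sup>2) = s\<^sup>2 * (\<Sum>k<d. (x k)\<^sup>2)"
    by (simp add: dilate_def power_mult_distrib sum_distrib_left)
  then show ?thesis using s by (simp add: vec_norm_def real_sqrt_mult)
qed

lemma normalize_vec_dilate: "s > 0 \<Longrightarrow> normalize_vec d (dilate d s x) = normalize_vec d x"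
  unfolding normalize_vec_def vec_norm_dilate by (auto simp: fun_eq_iff dilate_def)

lemma dot_normalize_vec: "dot d x (normalize_vec d h) = dot d x h / vec_norm d h"
  by (simp add: dot_def normalize_vec_def sum_divide_distrib)

lemma nn_integral_sphere_law_ball:
  assumes [measurable]: "f \<in> borel_measurable (vec_space d)"
  shows "(\<integral>\<^sup>+v. f v \<partial>sphere_law d) =
    (\<integral>\<^sup>+w. f (normalize_vec d w) * indicator {..1} (vec_norm d w) \<partial>lebesgue_vec d) /
    (\<integral>\<^sup>+w. indicator {..1} (vec_norm d w) \<partial>lebesgue_vec d)"
proof -
  note [measurable_cong] = sets_lebesgue_vec
  let ?L = "lebesgue_vec d"
  have ind: "indicator (unit_ball d) w = (indicator {..1} (vec_norm d w) :: ennreal)" if "w \<in> space ?L" for w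
    using that by (auto simp: unit_ball_def indicator_def space_PiM PiE_def)
  have nm: "(\<lambda>x. \<lambda>k\<in>{..<d}. x k / vec_norm d x) = normalize_vec d"
    by (simp add: normalize_vec_def fun_eq_iff)
  have "(\<integral>\<^sup>+v. f v \<partial>sphere_law d) = (\<integral>\<^sup>+w. f (normalize_vec d w) \<partial>uniform_measure ?L (unit_ball d))"
    unfolding sphere_law_def nm by (intro nn_integral_distr) measurable
  also have "\<dots> = (\<integral>\<^sup>+w. f (normalize_vec d w) * indicator (unit_ball d) w \<partial>?L) / emeasure ?L (unit_ball d)"
    by (intro nn_integral_uniform_measure sets_unit_ball) measurable
  also have "emeasure ?L (unit_ball d) = (\<integral>\<^sup>+w. indicator (unit_ball d) w \<partial>?L)"
    by (intro nn_integral_indicator[symmetric] sets_unit_ball)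
  finally show ?thesis by (simp add: ind cong: nn_integral_cong)
qed

text \<open>Dilation by \<open>r\<close>: the part within distance \<open>r\<close> of the origin of a weighted cone scales like the \<open>d\<close>-th power of \<open>r\<close>.\<close>
lemma cone_volume:
  fixes f :: "(nat \<Rightarrow> real) \<Rightarrow> ennreal"
  assumes d: "d > 0" and [measurable]: "f \<in> borel_measurable (vec_space d)"
  shows "(\<integral>\<^sup>+w. f (normalize_vec d w) * indicator {..r} (vec_norm d w) \<partial>lebesgue_vec d) =
    ennreal (max 0 r ^ d) * (\<integral>\<^sup>+w. f (normalize_vec d w) * indicator {..1} (vec_norm d w) \<partial>lebesgue_vec d)"
proof (cases "r > 0")
  case True
  have "(\<integral>\<^sup>+w. f (normalize_vec d w) * indicator {..r} (vec_norm d w) \<partial>lebesgue_vec d) =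
    ennreal (r ^ card {..<d}) * (\<integral>\<^sup>+w. f (normalize_vec d (dilate d r w)) * indicator {..r} (vec_norm d (dilate d r w)) \<partial>lebesgue_vec d)"
    using nn_integral_lebesgue_affine[of "{..<d}" r "\<lambda>w. f (normalize_vec d w) * indicator {..r} (vec_norm d w)" "\<lambda>_. 0"] True
    unfolding dilate_def by (simp add: restrict_def)
  then show ?thesis using True by (simp add: vec_norm_dilate normalize_vec_dilate indicator_def)
next
  case False
  have null: "(\<Pi>\<^sub>E k\<in>{..<d}. {0::real}) \<in> null_sets (lebesgue_vec d)"
  proof (rule null_setsI)
    show "emeasure (lebesgue_vec d) (\<Pi>\<^sub>E k\<in>{..<d}. {0::real}) = 0"
      using d by (subst lborel_product.emeasure_PiM) auto
  qed (intro sets_PiM_I_finite, auto)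
  have "AE w in lebesgue_vec d. f (normalize_vec d w) * indicator {..r} (vec_norm d w) = 0"
  proof (rule AE_I'[OF null], rule subsetI)
    fix w assume "w \<in> {w \<in> space (lebesgue_vec d). f (normalize_vec d w) * indicator {..r} (vec_norm d w) \<noteq> 0}"
    then have w: "w \<in> space (lebesgue_vec d)" and ne: "f (normalize_vec d w) * indicator {..r} (vec_norm d w) \<noteq> 0" by auto
    from ne have "vec_norm d w \<le> 0" using False by (auto simp: indicator_def split: if_splits)
    then have "(\<Sum>k<d. (w k)\<^sup>2) = 0" using vec_norm_nonneg[of d w] by (simp add: vec_norm_def)
    then have "w k = 0" if "k < d" for k using that by (subst (asm) sum_nonneg_eq_0_iff) auto
    then show "w \<in> (\<Pi>\<^sub>E k\<in>{..<d}. {0})" using w by (intro PiE_I) (auto simp: space_PiM PiE_iff extensional_def)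
  qed
  then have "(\<integral>\<^sup>+w. f (normalize_vec d w) * indicator {..r} (vec_norm d w) \<partial>lebesgue_vec d) = (\<integral>\<^sup>+w. 0 \<partial>lebesgue_vec d)"
    by (rule nn_integral_cong_AE)
  then show ?thesis using False d by (simp add: max_def)
qed

lemma measure_eqI_atMost:
  fixes M N :: "real measure"
  assumes "sets M = sets borel" "sets N = sets borel"
    and eq: "\<And>r. emeasure M {..r} = emeasure N {..r}" and fin: "\<And>r. emeasure M {..r} \<noteq> \<infinity>"
  shows "M = N"
proof (rule measure_eqI_generator_eq[where E = "range atMost" and \<Omega> = UNIV and A = "\<lambda>i. {..real i}"])
  show "Int_stable (range (atMost :: real \<Rightarrow> real set))"
    by (auto simp: Int_stable_def)
  show "sets M = sigma_sets UNIV (range atMost)" "sets N = sigma_sets UNIV (range atMost)"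
    using assms by (simp_all add: borel_eq_atMost)
  show "(\<Union>i. {..real i}) = UNIV" using real_arch_simple by auto
qed (use eq fin in auto)

text \<open>Direction and length of a Gaussian vector are independent, and the direction has the law \<open>sphere_law d\<close>. By
  \<open>cone_volume\<close> the image of the \<open>f\<close>-weighted Lebesgue measure under the norm is a multiple of the unweighted one, and the
  Gaussian density is a function of the norm.\<close>
lemma gaussian_polar:
  fixes f :: "(nat \<Rightarrow> real) \<Rightarrow> ennreal" and \<psi> :: "real \<Rightarrow> ennreal"
  assumes d: "d > 0" and f [measurable]: "f \<in> borel_measurable (vec_space d)" and f1: "\<And>v. f v \<le> 1"
    and \<psi> [measurable]: "\<psi> \<in> borel_measurable borel"
  shows "(\<integral>\<^sup>+h. f (normalize_vec d h) * \<psi> (vec_norm d h) \<partial>gaussian_law d) =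
    (\<integral>\<^sup>+v. f v \<partial>sphere_law d) * (\<integral>\<^sup>+h. \<psi> (vec_norm d h) \<partial>gaussian_law d)"
proof -
  note [measurable_cong] = sets_lebesgue_vec
  let ?L = "lebesgue_vec d"
  define M where "M f = distr (density ?L (\<lambda>w. f (normalize_vec d w))) borel (vec_norm d)" for f :: "(nat \<Rightarrow> real) \<Rightarrow> ennreal"
  define C where "C f = (\<integral>\<^sup>+w. f (normalize_vec d w) * indicator {..1} (vec_norm d w) \<partial>?L)" for f :: "(nat \<Rightarrow> real) \<Rightarrow> ennreal"
  have vn [measurable]: "vec_norm d \<in> borel_measurable (vec_space d)" unfolding vec_norm_def by measurable
  have intM: "(\<integral>\<^sup>+r. g r \<partial>M f) = (\<integral>\<^sup>+w. f (normalize_vec d w) * g (vec_norm d w) \<partial>?L)"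
    if [measurable]: "f \<in> borel_measurable (vec_space d)" "g \<in> borel_measurable borel" for f and g :: "real \<Rightarrow> ennreal"
    unfolding M_def by (subst nn_integral_distr) (auto simp: nn_integral_density)
  have atMost: "emeasure (M f) {..r} = ennreal (max 0 r ^ d) * C f"
    if [measurable]: "f \<in> borel_measurable (vec_space d)" for f r
  proof -
    have "emeasure (M f) {..r} = (\<integral>\<^sup>+t. indicator {..r} t \<partial>M f)"
      by (rule nn_integral_indicator[symmetric]) (simp add: M_def)
    also have "\<dots> = (\<integral>\<^sup>+w. f (normalize_vec d w) * indicator {..r} (vec_norm d w) \<partial>?L)"
      by (rule intM[OF that]) simp
    also have "\<dots> = ennreal (max 0 r ^ d) * C f" unfolding C_def by (rule cone_volume[OF d that])
    finally show ?thesis .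
  qed
  have C1: "C (\<lambda>_. 1) = emeasure ?L (unit_ball d)"
  proof -
    have "C (\<lambda>_. 1) = (\<integral>\<^sup>+w. indicator (unit_ball d) w \<partial>?L)"
      unfolding C_def by (intro nn_integral_cong) (auto simp: unit_ball_def indicator_def space_PiM PiE_def)
    then show ?thesis using sets_unit_ball by simp
  qed
  have C1_fin: "C (\<lambda>_. 1) \<noteq> 0" "C (\<lambda>_. 1) \<noteq> \<infinity>" unfolding C1 by (rule emeasure_unit_ball)+
  have "C f \<le> C (\<lambda>_. 1)" unfolding C_def by (intro nn_integral_mono mult_right_mono f1) auto
  then have Cf_fin: "C f \<noteq> \<infinity>" using C1_fin by (auto simp: top_unique)
  have eq: "scale_measure (C (\<lambda>_. 1)) (M f) = scale_measure (C f) (M (\<lambda>_. 1))"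
  proof (rule measure_eqI_atMost)
    show "emeasure (scale_measure (C (\<lambda>_. 1)) (M f)) {..r} = emeasure (scale_measure (C f) (M (\<lambda>_. 1))) {..r}" for r
      by (simp add: atMost ac_simps)
    show "emeasure (scale_measure (C (\<lambda>_. 1)) (M f)) {..r} \<noteq> \<infinity>" for r
      using C1_fin Cf_fin by (simp add: atMost ennreal_mult_eq_top_iff)
  qed (simp_all add: M_def)
  define g where "g r = ennreal ((1 / sqrt (2 * pi / d)) ^ d * exp (- real d / 2 * r\<^sup>2)) * \<psi> r" for r
  have [measurable]: "g \<in> borel_measurable borel" unfolding g_def by measurable
  have G: "(\<integral>\<^sup>+h. F (normalize_vec d h) * \<psi> (vec_norm d h) \<partial>gaussian_law d) = (\<integral>\<^sup>+r. g r \<partial>M F)"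
    if [measurable]: "F \<in> borel_measurable (vec_space d)" for F
  proof -
    have "(\<integral>\<^sup>+h. F (normalize_vec d h) * \<psi> (vec_norm d h) \<partial>gaussian_law d) =
      (\<integral>\<^sup>+h. ennreal (gauss_density d h) * (F (normalize_vec d h) * \<psi> (vec_norm d h)) \<partial>?L)"
      by (intro nn_integral_gaussian_law d) measurable
    also have "\<dots> = (\<integral>\<^sup>+h. F (normalize_vec d h) * g (vec_norm d h) \<partial>?L)"
      by (simp add: gauss_density_eq[OF d] g_def vec_norm_sq ac_simps)
    also have "\<dots> = (\<integral>\<^sup>+r. g r \<partial>M F)" by (rule intM[OF that, symmetric]) simp
    finally show ?thesis .
  qed
  have S: "(\<integral>\<^sup>+v. f v \<partial>sphere_law d) = C f / C (\<lambda>_. 1)"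
    using nn_integral_sphere_law_ball[OF f] by (simp add: C_def)
  have "C (\<lambda>_. 1) * (\<integral>\<^sup>+r. g r \<partial>M f) = C f * (\<integral>\<^sup>+r. g r \<partial>M (\<lambda>_. 1))"
  proof -
    have "g \<in> borel_measurable (M F)" for F by (simp add: M_def)
    note scale = nn_integral_scale_measure[OF this]
    have "(\<integral>\<^sup>+r. g r \<partial>scale_measure (C (\<lambda>_. 1)) (M f)) = (\<integral>\<^sup>+r. g r \<partial>scale_measure (C f) (M (\<lambda>_. 1)))"
      by (simp only: eq)
    then show ?thesis by (simp only: scale)
  qed
  then have "(\<integral>\<^sup>+r. g r \<partial>M f) = (C f / C (\<lambda>_. 1)) * (\<integral>\<^sup>+r. g r \<partial>M (\<lambda>_. 1))"
  proof -
    assume eq: "C (\<lambda>_. 1) * (\<integral>\<^sup>+r. g r \<partial>M f) = C f * (\<integral>\<^sup>+r. g r \<partial>M (\<lambda>_. 1))"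
    have "(\<integral>\<^sup>+r. g r \<partial>M f) = (\<integral>\<^sup>+r. g r \<partial>M f) * C (\<lambda>_. 1) / C (\<lambda>_. 1)"
      using C1_fin by (subst ennreal_mult_divide_eq) auto
    also have "\<dots> = (\<integral>\<^sup>+r. g r \<partial>M (\<lambda>_. 1)) * C f / C (\<lambda>_. 1)"
      using eq by (simp only: mult.commute)
    also have "\<dots> = (\<integral>\<^sup>+r. g r \<partial>M (\<lambda>_. 1)) * (C f / C (\<lambda>_. 1))"
      by (simp only: ennreal_times_divide)
    finally show ?thesis by (simp only: mult.commute)
  qed
  then show ?thesis using G[OF f] G[of "\<lambda>_. 1"] S by simp
qed

lemma nn_integral_sphere_law:
  assumes d: "d > 0" and f: "f \<in> borel_measurable (vec_space d)" "\<And>v. f v \<le> 1"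
  shows "(\<integral>\<^sup>+v. f v \<partial>sphere_law d) = (\<integral>\<^sup>+h. f (normalize_vec d h) \<partial>gaussian_law d)"
proof -
  interpret prob_space "gaussian_law d" using d by (rule prob_space_gaussian_law)
  show ?thesis using gaussian_polar[OF d f, of "\<lambda>_. 1"] by (simp add: emeasure_space_1)
qed

section \<open>Many spherical rows in high dimension\<close>

text \<open>The constant \<open>12\<close> is such that \<open>gaussian_norm_tail\<close> gives \<open>2 exp (- 3) \<le> 1 / 2\<close> for the complement.\<close>
lemma gaussian_norm_typical:
  assumes d: "d \<ge> 9"
  shows "measure (gaussian_law d) (typical_norm d) \<ge> 1 / 2"
proof -
  have d0: "d > 0" using d by simp
  interpret G: prob_space "gaussian_law d" using d0 by (rule prob_space_gaussian_law)
  let ?B = "{h \<in> space (vec_space d). 12 / sqrt d \<le> \<bar>dot d h h - 1\<bar>}"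
  have B: "?B \<in> sets (gaussian_law d)" unfolding sets_gaussian_law by measurable
  have "emeasure (gaussian_law d) ?B \<le> ennreal (2 * exp (3 - 12 / 2))" using d by (intro gaussian_norm_tail) auto
  then have "measure (gaussian_law d) ?B \<le> 2 * exp (- 3)" by (simp add: G.emeasure_eq_measure)
  also have "\<dots> \<le> 1 / 2" using exp_ge_add_one_self[of 3] by (simp add: exp_minus field_simps)
  finally have "measure (gaussian_law d) ?B \<le> 1 / 2" .
  moreover have "measure (gaussian_law d) (space (gaussian_law d) - ?B) = 1 - measure (gaussian_law d) ?B"
    by (rule G.prob_compl[OF B])
  moreover have "space (gaussian_law d) - ?B = (typical_norm d)"
    by (auto simp: space_gaussian_law)
  ultimately show ?thesis by simp
qed

lemma abs_norm_diff_le: "\<bar>vec_norm d h - 1\<bar> \<le> \<bar>dot d h h - 1\<bar>"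
proof -
  have "dot d h h - 1 = (vec_norm d h - 1) * (vec_norm d h + 1)"
    by (simp add: vec_norm_sq[symmetric] power2_eq_square algebra_simps)
  then have "\<bar>dot d h h - 1\<bar> = \<bar>vec_norm d h - 1\<bar> * (vec_norm d h + 1)"
    using vec_norm_nonneg[of d h] by (simp add: abs_mult)
  moreover have "\<bar>vec_norm d h - 1\<bar> * 1 \<le> \<bar>vec_norm d h - 1\<bar> * (vec_norm d h + 1)"
    using vec_norm_nonneg[of d h] by (intro mult_left_mono) auto
  ultimately show ?thesis by simp
qed

lemma sqrt_576: "d \<ge> 576 \<Longrightarrow> 24 \<le> sqrt (real d)"
  using real_sqrt_le_mono[of 576 "real d"] by simp

text \<open>The norm lies in an interval of length \<open>24 / \<surd>d\<close> with probability at least \<open>1 / 2\<close>. One of the \<open>N \<le> 25 / \<eta>\<close> windows that cover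
  this interval carries its share.\<close>
lemma gaussian_norm_window:
  assumes d: "d \<ge> 576" and eta: "0 < eta" "eta \<le> 1"
  obtains s0 where "1 / 2 \<le> s0" "s0 \<le> 3 / 2"
    "ennreal (eta / 50) \<le> emeasure (gaussian_law d) {h \<in> space (vec_space d). s0 \<le> vec_norm d h \<and> vec_norm d h \<le> s0 + eta / sqrt d}"
proof -
  have d0: "d > 0" using d by simp
  interpret G: prob_space "gaussian_law d" using d0 by (rule prob_space_gaussian_law)
  define r where "r = 1 / sqrt (real d)"
  have r: "0 < r" "24 * r \<le> 1" using sqrt_576[OF d] d0 by (auto simp: r_def field_simps)
  have "24 / eta > 0" using eta by simp
  define N where "N = nat \<lceil>24 / eta\<rceil>"
  have N1: "24 / eta \<le> real N" unfolding N_def by linarith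
  have "real N \<le> 24 / eta + 1" unfolding N_def using \<open>24 / eta > 0\<close> by linarith
  also have "\<dots> \<le> 25 / eta" using eta by (simp add: field_simps)
  finally have N2: "real N \<le> 25 / eta" .
  have N0: "N > 0" using N1 eta by (cases N) (auto simp: field_simps)
  define s where "s k = 1 - 12 * r + real k * (eta * r)" for k
  define W where "W k = {h \<in> space (vec_space d). s k \<le> vec_norm d h \<and> vec_norm d h \<le> s k + eta / sqrt d}" for k
  have [measurable]: "W k \<in> sets (gaussian_law d)" for k unfolding W_def sets_gaussian_law by measurable
  have cover: "(typical_norm d) \<subseteq> (\<Union>k<N. W k)"
  proof
    fix h assume "h \<in> (typical_norm d)"
    then have h: "h \<in> space (vec_space d)" "\<bar>vec_norm d h - 1\<bar> < 12 * r"
      using abs_norm_diff_le[of d h] by (auto simp: r_def)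
    define x where "x = (vec_norm d h - (1 - 12 * r)) / (eta * r)"
    have er: "eta * r > 0" using eta r by simp
    have x: "0 \<le> x" using h er by (simp add: x_def)
    have "vec_norm d h - (1 - 12 * r) < 24 * r" using h by linarith
    then have "x < 24 * r / (eta * r)" unfolding x_def using er by (intro divide_strict_right_mono) auto
    also have "\<dots> = 24 / eta" using r by simp
    also have "\<dots> \<le> real N" by (rule N1)
    finally have "nat \<lfloor>x\<rfloor> < N" using x by linarith
    moreover have "h \<in> W (nat \<lfloor>x\<rfloor>)"
    proof -
      have fl: "real (nat \<lfloor>x\<rfloor>) \<le> x" "x \<le> real (nat \<lfloor>x\<rfloor>) + 1" using x by linarith+
      have "x * (eta * r) = vec_norm d h - (1 - 12 * r)"
        unfolding x_def by (rule nonzero_eq_divide_eq[THEN iffD1]) (use er in auto)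
      then have v: "vec_norm d h = 1 - 12 * r + x * (eta * r)" by simp
      have "real (nat \<lfloor>x\<rfloor>) * (eta * r) \<le> x * (eta * r)" using fl er by (intro mult_right_mono) auto
      moreover have "x * (eta * r) \<le> (real (nat \<lfloor>x\<rfloor>) + 1) * (eta * r)" using fl er by (intro mult_right_mono) auto
      ultimately show ?thesis using h v by (simp add: W_def s_def algebra_simps) (simp add: r_def)
    qed
    ultimately show "h \<in> (\<Union>k<N. W k)" by blast
  qed
  have "\<exists>k<N. eta / 50 \<le> measure (gaussian_law d) (W k)"
  proof (rule ccontr)
    assume "\<not> ?thesis"
    then have lt: "measure (gaussian_law d) (W k) < eta / 50" if "k < N" for k using that by force
    have "1 / 2 \<le> measure (gaussian_law d) (typical_norm d)"
      using d by (intro gaussian_norm_typical) simp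
    also have "\<dots> \<le> measure (gaussian_law d) (\<Union>k<N. W k)"
      using cover by (intro G.finite_measure_mono) auto
    also have "\<dots> \<le> (\<Sum>k<N. measure (gaussian_law d) (W k))"
      by (intro G.finite_measure_subadditive_finite) auto
    also have "\<dots> < (\<Sum>k<N. eta / 50)" using N0 lt by (intro sum_strict_mono) auto
    also have "\<dots> = real N * (eta / 50)" by simp
    also have "\<dots> \<le> 25 / eta * (eta / 50)" using N2 eta by (intro mult_right_mono) auto
    also have "\<dots> = 1 / 2" using eta by simp
    finally show False by simp
  qed
  then obtain k where k: "k < N" "eta / 50 \<le> measure (gaussian_law d) (W k)" by blast
  show ?thesis
  proof
    have er: "eta * r > 0" using eta r by simp
    have kn: "0 \<le> real k * (eta * r)" using er by simp
    have "real k \<le> 24 / eta"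
    proof -
      have "k \<le> N - 1" using k by simp
      then have "real k \<le> real N - 1" using N0 by (simp add: of_nat_diff)
      then show ?thesis unfolding N_def using \<open>24 / eta > 0\<close> by linarith
    qed
    then have "real k * (eta * r) \<le> 24 / eta * (eta * r)" using er by (intro mult_right_mono) auto
    also have "\<dots> = 24 * r" using eta by simp
    finally have "real k * (eta * r) \<le> 24 * r" .
    then show "1 / 2 \<le> s k" "s k \<le> 3 / 2" using r kn unfolding s_def by linarith+
    show "ennreal (eta / 50) \<le> emeasure (gaussian_law d) {h \<in> space (vec_space d). s k \<le> vec_norm d h \<and> vec_norm d h \<le> s k + eta / sqrt d}"
      using k(2) unfolding W_def[symmetric] G.emeasure_eq_measure by (intro ennreal_leI)
  qed
qed

lemma dot_Cauchy_Schwarz: "(dot d x y)\<^sup>2 \<le> dot d x x * dot d y y"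
  using Cauchy_Schwarz_ineq_sum[of x y "{..<d}"] by (simp add: dot_def power2_eq_square)

lemma power2_sum_le: "(a + b)\<^sup>2 \<le> 2 * a\<^sup>2 + 2 * b\<^sup>2" for a b :: real
  using zero_le_power2[of "a - b"] by (simp add: power2_eq_square algebra_simps)

text \<open>A point \<open>p = \<langle>x,h\<rangle>\<close> is compared with \<open>p / s\<close>, where \<open>s = \<bar>h\<bar>\<close> lies in the window. Since \<open>\<bar>p\<bar> \<le> s\<close>, the two targets
  \<open>s y\<close> and \<open>s0 y\<close> may be exchanged at the price of an error of the order of the width of the bump.\<close>
lemma bump_rescale:
  assumes d: "d > 0" and eps: "eps > 0" and s: "1 / 2 \<le> s0" "s0 \<le> 3 / 2" "s0 \<le> s" "s \<le> s0 + eps / 3 / sqrt d"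
    and p: "p\<^sup>2 \<le> s\<^sup>2"
  shows "bump (8 * real d / eps\<^sup>2) y (p / s) \<le> exp 1 * bump (real d / eps\<^sup>2) (s0 * y) p"
proof -
  have sp: "s > 0" using s by simp
  have eq: "p - s0 * y = s0 * (p / s - y) + (p / s) * (s - s0)" using sp by (simp add: field_simps)
  have "(p - s0 * y)\<^sup>2 \<le> 2 * (s0 * (p / s - y))\<^sup>2 + 2 * ((p / s) * (s - s0))\<^sup>2"
    unfolding eq by (rule power2_sum_le)
  also have "(s0 * (p / s - y))\<^sup>2 \<le> 4 * (p / s - y)\<^sup>2"
  proof -
    have "s0\<^sup>2 \<le> 2\<^sup>2" using s by (intro power_mono) auto
    then have "s0\<^sup>2 * (p / s - y)\<^sup>2 \<le> 4 * (p / s - y)\<^sup>2" by (intro mult_right_mono) auto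
    then show ?thesis by (simp only: power_mult_distrib)
  qed
  also have "((p / s) * (s - s0))\<^sup>2 \<le> 1 * (eps / 3 / sqrt d)\<^sup>2"
    unfolding power_mult_distrib
  proof (intro mult_mono)
    show "(p / s)\<^sup>2 \<le> 1" using p sp by (simp add: power_divide)
    show "(s - s0)\<^sup>2 \<le> (eps / 3 / sqrt d)\<^sup>2" using s by (intro power_mono) auto
  qed auto
  also have "(eps / 3 / sqrt d)\<^sup>2 = eps\<^sup>2 / (9 * d)" by (simp add: power_divide)
  finally have "(p - s0 * y)\<^sup>2 \<le> 8 * (p / s - y)\<^sup>2 + 2 * (eps\<^sup>2 / (9 * d))" by simp
  then have "real d / eps\<^sup>2 * (p - s0 * y)\<^sup>2 \<le> real d / eps\<^sup>2 * (8 * (p / s - y)\<^sup>2 + 2 * (eps\<^sup>2 / (9 * d)))"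
    by (intro mult_left_mono) auto
  also have "\<dots> = 8 * real d / eps\<^sup>2 * (p / s - y)\<^sup>2 + 2 / 9" using d eps by (simp add: field_simps)
  finally show ?thesis unfolding bump_def mult_exp_exp exp_le_cancel_iff by linarith
qed

text \<open>Restricting the length of \<open>h\<close> to the window replaces a spherical row by a Gaussian one. It costs the inverse of the
  probability of the window, and one factor \<open>exp 1\<close> for each row of the opposite block. The window, hence the factor \<open>s0\<close>, does
  not depend on the rows nor on the target.\<close>
lemma sphere_row_affinity:
  assumes d: "d \<ge> 576" and eps: "0 < eps" "eps \<le> 1"
  obtains s0 where "\<And>I x y. finite I \<Longrightarrow> (\<And>i. i \<in> I \<Longrightarrow> dot d (x i) (x i) \<le> 1) \<Longrightarrow>
    row_affinity (sphere_law d) d (8 * real d / eps\<^sup>2) I y x \<le>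
      ennreal (150 / eps * exp (card I)) * row_affinity (gaussian_law d) d (real d / eps\<^sup>2) I (\<lambda>i. s0 * y i) x"
proof -
  have d0: "d > 0" using d by simp
  note [measurable_cong] = sets_gaussian_law
  obtain s0 where s0: "1 / 2 \<le> s0" "s0 \<le> 3 / 2"
    "ennreal (eps / 3 / 50) \<le> emeasure (gaussian_law d) {h \<in> space (vec_space d). s0 \<le> vec_norm d h \<and> vec_norm d h \<le> s0 + eps / 3 / sqrt d}"
    using gaussian_norm_window[OF d, of "eps / 3"] eps by auto
  let ?W = "{s0..s0 + eps / 3 / sqrt d}"
  have "emeasure (gaussian_law d) {h \<in> space (vec_space d). s0 \<le> vec_norm d h \<and> vec_norm d h \<le> s0 + eps / 3 / sqrt d}
    = (\<integral>\<^sup>+h. indicator {h \<in> space (vec_space d). s0 \<le> vec_norm d h \<and> vec_norm d h \<le> s0 + eps / 3 / sqrt d} h \<partial>gaussian_law d)"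
    by (intro nn_integral_indicator[symmetric]) (unfold sets_gaussian_law, measurable)
  also have "\<dots> = (\<integral>\<^sup>+h. indicator ?W (vec_norm d h) \<partial>gaussian_law d)"
    by (intro nn_integral_cong) (auto simp: indicator_def space_gaussian_law)
  finally have W: "ennreal (eps / 150) \<le> (\<integral>\<^sup>+h. indicator ?W (vec_norm d h) \<partial>gaussian_law d)"
    using s0(3) by simp
  show ?thesis
  proof
    fix I :: "nat set" and x y assume I: "finite I" and x: "\<And>i. i \<in> I \<Longrightarrow> dot d (x i) (x i) \<le> 1"
    let ?f = "\<lambda>v. \<Prod>i\<in>I. ennreal (bump (8 * real d / eps\<^sup>2) (y i) (dot d (x i) v))"
    let ?g = "\<lambda>v. \<Prod>i\<in>I. ennreal (bump (real d / eps\<^sup>2) (s0 * y i) (dot d (x i) v))"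
    have f1: "?f v \<le> 1" for v
    proof -
      have "?f v \<le> (\<Prod>i\<in>I. 1)" by (intro prod_mono_ennreal) (simp add: bump_le_1)
      then show ?thesis by simp
    qed
    have "row_affinity (sphere_law d) d (8 * real d / eps\<^sup>2) I y x * ennreal (eps / 150) \<le>
        (\<integral>\<^sup>+v. ?f v \<partial>sphere_law d) * (\<integral>\<^sup>+h. indicator ?W (vec_norm d h) \<partial>gaussian_law d)"
      unfolding row_affinity_def by (intro mult_left_mono W) auto
    also have "\<dots> = (\<integral>\<^sup>+h. ?f (normalize_vec d h) * indicator ?W (vec_norm d h) \<partial>gaussian_law d)"
      by (rule gaussian_polar[OF d0 _ f1, symmetric]) auto
    also have "\<dots> \<le> (\<integral>\<^sup>+h. ennreal (exp (card I)) * ?g h \<partial>gaussian_law d)"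
    proof (intro nn_integral_mono)
      fix h
      show "?f (normalize_vec d h) * indicator ?W (vec_norm d h) \<le> ennreal (exp (card I)) * ?g h"
      proof (cases "vec_norm d h \<in> ?W")
        case True
        have "?f (normalize_vec d h) \<le> (\<Prod>i\<in>I. ennreal (exp 1) * ennreal (bump (real d / eps\<^sup>2) (s0 * y i) (dot d (x i) h)))"
        proof (intro prod_mono_ennreal)
          fix i assume i: "i \<in> I"
          have "(dot d (x i) h)\<^sup>2 \<le> dot d (x i) (x i) * dot d h h" by (rule dot_Cauchy_Schwarz)
          also have "\<dots> \<le> 1 * dot d h h" using x[OF i] dot_nonneg[of d h] by (intro mult_right_mono)
          finally have "(dot d (x i) h)\<^sup>2 \<le> (vec_norm d h)\<^sup>2" by (simp add: vec_norm_sq)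
          then have "bump (8 * real d / eps\<^sup>2) (y i) (dot d (x i) h / vec_norm d h) \<le> exp 1 * bump (real d / eps\<^sup>2) (s0 * y i) (dot d (x i) h)"
            using True s0 eps d0 by (intro bump_rescale) auto
          then show "ennreal (bump (8 * real d / eps\<^sup>2) (y i) (dot d (x i) (normalize_vec d h))) \<le> ennreal (exp 1) * ennreal (bump (real d / eps\<^sup>2) (s0 * y i) (dot d (x i) h))"
            by (simp add: dot_normalize_vec ennreal_mult[symmetric] bump_pos less_imp_le ennreal_leI)
        qed
        also have "\<dots> = ennreal (exp 1 ^ card I) * ?g h" by (simp add: prod.distrib ennreal_power)
        also have "exp 1 ^ card I = exp (real (card I))" using exp_of_nat_mult[of "card I" "1::real"] by simp
        finally show ?thesis using True by simp
      qed simp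
    qed
    also have "\<dots> = ennreal (exp (card I)) * row_affinity (gaussian_law d) d (real d / eps\<^sup>2) I (\<lambda>i. s0 * y i) x"
      unfolding row_affinity_def by (intro nn_integral_cmult) measurable
    finally have le: "row_affinity (sphere_law d) d (8 * real d / eps\<^sup>2) I y x * ennreal (eps / 150) \<le> \<dots>" .
    have "row_affinity (sphere_law d) d (8 * real d / eps\<^sup>2) I y x =
        ennreal (150 / eps) * (row_affinity (sphere_law d) d (8 * real d / eps\<^sup>2) I y x * ennreal (eps / 150))"
      using eps by (simp add: mult.left_commute[of "ennreal (150 / eps)"] ennreal_mult[symmetric])
    also have "\<dots> \<le> ennreal (150 / eps) * (ennreal (exp (card I)) * row_affinity (gaussian_law d) d (real d / eps\<^sup>2) I (\<lambda>i. s0 * y i) x)"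
      by (intro mult_left_mono le) auto
    also have "\<dots> = (ennreal (150 / eps) * ennreal (exp (card I))) * row_affinity (gaussian_law d) d (real d / eps\<^sup>2) I (\<lambda>i. s0 * y i) x"
      by (simp only: mult.assoc)
    also have "ennreal (150 / eps) * ennreal (exp (card I)) = ennreal (150 / eps * exp (card I))"
      using eps by (intro ennreal_mult[symmetric]) auto
    finally show "row_affinity (sphere_law d) d (8 * real d / eps\<^sup>2) I y x \<le>
      ennreal (150 / eps * exp (card I)) * row_affinity (gaussian_law d) d (real d / eps\<^sup>2) I (\<lambda>i. s0 * y i) x" .
  qed
qed

text \<open>The length of a Gaussian vector is within \<open>12 / \<surd>d\<close> of \<open>1\<close> with probability at least \<open>1 / 2\<close>, independently of its
  direction; this accounts for the factor \<open>2\<close>.\<close>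
lemma sphere_event_le:
  assumes d: "d \<ge> 9" and b: "b \<ge> 0"
    and A [measurable]: "A \<in> sets (vec_space d)" and C: "C \<in> sets (vec_space d)"
    and sub: "\<And>h. h \<in> space (vec_space d) \<Longrightarrow> \<bar>vec_norm d h - 1\<bar> < 12 / sqrt d \<Longrightarrow> normalize_vec d h \<in> A \<Longrightarrow> h \<in> C"
    and le: "emeasure (gaussian_law d) C \<le> ennreal b"
  shows "emeasure (sphere_law d) A \<le> ennreal (2 * b)"
proof -
  have d0: "d > 0" using d by simp
  interpret G: prob_space "gaussian_law d" using d0 by (rule prob_space_gaussian_law)
  note [measurable_cong] = sets_gaussian_law sets_sphere_law
  let ?W = "{1 - 12 / sqrt d<..<1 + 12 / sqrt d}"
  have W_iff: "x \<in> ?W \<longleftrightarrow> \<bar>x - 1\<bar> < 12 / sqrt d" for x by (auto simp: abs_less_iff)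
  have "ennreal (1 / 2) \<le> emeasure (gaussian_law d) (typical_norm d)"
    unfolding G.emeasure_eq_measure using gaussian_norm_typical[OF d] by (rule ennreal_leI)
  also have "\<dots> = (\<integral>\<^sup>+h. indicator (typical_norm d) h \<partial>gaussian_law d)"
    by (rule nn_integral_indicator[symmetric]) measurable
  also have "\<dots> \<le> (\<integral>\<^sup>+h. indicator ?W (vec_norm d h) \<partial>gaussian_law d)"
  proof (intro nn_integral_mono)
    fix h
    have "vec_norm d h \<in> ?W" if "h \<in> typical_norm d"
      unfolding W_iff using that abs_norm_diff_le[of d h] by simp
    then show "indicator (typical_norm d) h \<le> (indicator ?W (vec_norm d h) :: ennreal)"
      by (simp add: indicator_def split: if_splits)
  qed
  finally have W: "ennreal (1 / 2) \<le> (\<integral>\<^sup>+h. indicator ?W (vec_norm d h) \<partial>gaussian_law d)" .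
  have "emeasure (sphere_law d) A * ennreal (1 / 2) \<le> (\<integral>\<^sup>+v. indicator A v \<partial>sphere_law d) * (\<integral>\<^sup>+h. indicator ?W (vec_norm d h) \<partial>gaussian_law d)"
    using W by (subst nn_integral_indicator) (auto intro: mult_left_mono)
  also have "\<dots> = (\<integral>\<^sup>+h. indicator A (normalize_vec d h) * indicator ?W (vec_norm d h) \<partial>gaussian_law d)"
    by (rule gaussian_polar[OF d0, symmetric]) (auto simp: indicator_def)
  also have "\<dots> \<le> (\<integral>\<^sup>+h. indicator C h \<partial>gaussian_law d)"
    using sub by (intro nn_integral_mono) (auto simp: indicator_def space_gaussian_law W_iff simp del: greaterThanLessThan_iff)
  also have "\<dots> = emeasure (gaussian_law d) C" using C by (intro nn_integral_indicator) (simp add: sets_gaussian_law)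
  finally have half: "emeasure (sphere_law d) A * ennreal (1 / 2) \<le> ennreal b" using le by (rule order_trans)
  have "ennreal 2 * ennreal (1 / 2) = ennreal (2 * (1 / 2))" by (rule ennreal_mult[symmetric]) auto
  then have "emeasure (sphere_law d) A = ennreal 2 * (emeasure (sphere_law d) A * ennreal (1 / 2))"
    by (simp only: mult.left_commute[of "ennreal 2"]) simp
  also have "\<dots> \<le> ennreal 2 * ennreal b" by (intro mult_left_mono half) auto
  also have "\<dots> = ennreal (2 * b)" using b by (intro ennreal_mult[symmetric]) auto
  finally show ?thesis .
qed

lemma proj_sq_normalize_vec: "proj_sq d r f (normalize_vec d h) = proj_sq d r f h / (vec_norm d h)\<^sup>2"
  by (simp add: proj_sq_def dot_normalize_vec power_divide sum_divide_distrib)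

lemma sphere_small_projection:
  assumes d: "d \<ge> 576" and f: "orthonormal d r f" and r: "d \<le> 2 * r" and \<delta>: "\<delta> > 0"
  shows "emeasure (sphere_law d) {u \<in> space (vec_space d). proj_sq d r f u \<le> \<delta>\<^sup>2} \<le> ennreal (2 * (32 * \<delta>) ^ r)"
proof (rule sphere_event_le)
  have d0: "d > 0" using d by simp
  show "emeasure (gaussian_law d) (thin_set d r f ((2 * \<delta>)\<^sup>2)) \<le> ennreal ((32 * \<delta>) ^ r)"
    using gaussian_small_projection[OF d0 f r, of "2 * \<delta>"] \<delta> by simp
  fix h assume h: "h \<in> space (vec_space d)" "\<bar>vec_norm d h - 1\<bar> < 12 / sqrt d" "normalize_vec d h \<in> thin_set d r f (\<delta>\<^sup>2)"
  have "12 / sqrt d \<le> 1 / 2" using sqrt_576[OF d] d0 by (simp add: field_simps)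
  then have v: "0 < vec_norm d h" "vec_norm d h \<le> 2" using h(2) by (auto simp: abs_less_iff)
  have "proj_sq d r f h \<le> \<delta>\<^sup>2 * (vec_norm d h)\<^sup>2" using h(3) v by (simp add: proj_sq_normalize_vec field_simps)
  also have "\<dots> \<le> \<delta>\<^sup>2 * 2\<^sup>2" using v by (intro mult_left_mono power_mono) auto
  finally show "h \<in> thin_set d r f ((2 * \<delta>)\<^sup>2)" using h(1) by (simp add: power_mult_distrib mult.commute)
qed (use d \<delta> in auto)

text \<open>The parameters are \<open>\<delta> = q / 32\<close> and \<open>\<epsilon> = q\<^sup>2 / 64\<close>. The factor \<open>q\<close> to the power \<open>-2\<close> is the price of the windows of
  \<open>sphere_row_affinity\<close>, one for each row of the second block.\<close>
lemma sphere_block_affinity: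
  fixes I J :: "nat set"
  assumes d: "d \<ge> 576" and q: "0 < q" "q \<le> 1" and a: "2 * a \<le> d + 1"
    and I: "finite I" "finite J" "I \<inter> J = {}" "card I = a" "card J = a"
  shows "(\<integral>\<^sup>+z. (affinity d (32768 / q ^ 4 * real d) I J Y z) \<partial>(rows (I \<union> J) (sphere_law d)))
    \<le> ennreal ((28800 * exp (real a) / q\<^sup>2 * q ^ a) ^ a)"
proof -
  have d0: "d > 0" using d by simp
  define eps where "eps = q\<^sup>2 / 64"
  have eps: "0 < eps" "eps \<le> 1" using q power_le_one[of q 2] by (auto simp: eps_def)
  have lam: "32768 / q ^ 4 * real d = 8 * real d / eps\<^sup>2"
    using q by (simp add: eps_def power_divide flip: power_mult)
  have S: "prob_space (sphere_law d)" by (rule prob_space_sphere_law)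
  interpret S: prob_space "sphere_law d" by fact
  interpret G: prob_space "gaussian_law d" using d0 by (rule prob_space_gaussian_law)
  note [measurable_cong] = sets_PiM_law[OF sets_sphere_law]
  note measurable_row_affinity[OF G.sigma_finite_measure_axioms sets_gaussian_law, measurable]
  obtain s0 where s0: "\<And>I x y. finite I \<Longrightarrow> (\<And>i. i \<in> I \<Longrightarrow> dot d (x i) (x i) \<le> 1) \<Longrightarrow>
    row_affinity (sphere_law d) d (8 * real d / eps\<^sup>2) I y x \<le>
      ennreal (150 / eps * exp (card I)) * row_affinity (gaussian_law d) d (real d / eps\<^sup>2) I (\<lambda>i. s0 * y i) x"
    using sphere_row_affinity[OF d eps] by blast
  let ?W = "150 / eps * exp (real a)"
  have W0: "?W \<ge> 0" using eps by simp
  have "AE x in (rows I (sphere_law d)). \<forall>i\<in>I. vec_norm d (x i) = 1"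
    using I by (intro AE_finite_allI AE_PiM_component S AE_sphere_law d0)
  then have AE: "AE x in (rows I (sphere_law d)). \<forall>i\<in>I. dot d (x i) (x i) \<le> 1"
    by eventually_elim (auto simp: vec_norm_sq[symmetric])
  have "(\<integral>\<^sup>+x. (\<Prod>j\<in>J. row_affinity (sphere_law d) d (8 * real d / eps\<^sup>2) I (\<lambda>i. Y i j) x) \<partial>(rows I (sphere_law d)))
    \<le> (\<integral>\<^sup>+x. ennreal ?W ^ a * (\<Prod>j\<in>J. row_affinity (gaussian_law d) d (real d / eps\<^sup>2) I (\<lambda>i. s0 * Y i j) x) \<partial>(rows I (sphere_law d)))"
    using AE
  proof (intro nn_integral_mono_AE, eventually_elim)
    case (elim x)
    have "(\<Prod>j\<in>J. row_affinity (sphere_law d) d (8 * real d / eps\<^sup>2) I (\<lambda>i. Y i j) x) \<le>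
      (\<Prod>j\<in>J. ennreal ?W * row_affinity (gaussian_law d) d (real d / eps\<^sup>2) I (\<lambda>i. s0 * Y i j) x)"
      using elim I s0[of I x] by (intro prod_mono_ennreal) auto
    also have "\<dots> = ennreal ?W ^ a * (\<Prod>j\<in>J. row_affinity (gaussian_law d) d (real d / eps\<^sup>2) I (\<lambda>i. s0 * Y i j) x)"
      using I by (simp add: prod.distrib)
    finally show ?case .
  qed
  also have "\<dots> = ennreal ?W ^ a * (\<integral>\<^sup>+x. (\<Prod>j\<in>J. row_affinity (gaussian_law d) d (real d / eps\<^sup>2) I (\<lambda>i. s0 * Y i j) x) \<partial>(rows I (sphere_law d)))"
    by (intro nn_integral_cmult) measurable
  also have "\<dots> \<le> ennreal ?W ^ a * ennreal (((2 * eps / (q / 32)) ^ card J + 2 * q ^ a) ^ card I)"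
  proof (intro mult_left_mono block_affinity_bound[OF d0 eps(1) _ _ S sets_sphere_law _ a])
    fix r f assume r: "orthonormal d r f" "d \<le> 2 * r" "a \<le> r"
    have "emeasure (sphere_law d) {u \<in> space (vec_space d). proj_sq d r f u \<le> (q / 32)\<^sup>2} \<le> ennreal (2 * (32 * (q / 32)) ^ r)"
      using q by (intro sphere_small_projection d r) auto
    also have "\<dots> \<le> ennreal (2 * q ^ a)" using q r by (intro ennreal_leI) (simp add: power_decreasing)
    finally show "emeasure (sphere_law d) {u \<in> space (vec_space d). proj_sq d r f u \<le> (q / 32)\<^sup>2} \<le> ennreal (2 * q ^ a)" .
  qed (use q I in auto)
  also have "\<dots> = ennreal (?W ^ a * ((2 * eps / (q / 32)) ^ card J + 2 * q ^ a) ^ card I)"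
    unfolding ennreal_power[OF W0] using eps q by (intro ennreal_mult[symmetric] zero_le_power) auto
  also have "?W ^ a * ((2 * eps / (q / 32)) ^ card J + 2 * q ^ a) ^ card I = (28800 * exp (real a) / q\<^sup>2 * q ^ a) ^ a"
  proof -
    have "2 * eps / (q / 32) = q" using q by (simp add: eps_def power2_eq_square)
    then have "?W ^ a * ((2 * eps / (q / 32)) ^ card J + 2 * q ^ a) ^ card I = (?W * (3 * q ^ a)) ^ a"
      using I by (simp only: power_mult_distrib) simp
    also have "?W * (3 * q ^ a) = 28800 * exp (real a) / q\<^sup>2 * q ^ a" using q by (simp add: eps_def)
    finally show ?thesis .
  qed
  finally show ?thesis unfolding block_fold[OF S sets_sphere_law I(1-3)] lam .
qed

text \<open>The constant \<open>28800\<close> of \<open>sphere_block_affinity\<close>, in a form that \<open>exp (3 a)\<close> with \<open>a \<ge> 4\<close> absorbs.\<close>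
lemma exp_12_ge: "28800 \<le> exp (12::real)"
proof -
  have "(5 / 2 :: real) \<le> exp 1" using exp_lower_Taylor_quadratic[of 1] by simp
  then have "(5 / 2 :: real) ^ 12 \<le> exp 1 ^ 12" by (intro power_mono) auto
  also have "\<dots> = exp 12" using exp_of_nat_mult[of 12 "1::real"] by simp
  finally have "(5 / 2 :: real) ^ 12 \<le> exp 12" .
  moreover have "28800 \<le> (5 / 2 :: real) ^ 12" by (simp add: power_divide)
  ultimately show ?thesis by linarith
qed

text \<open>The condition \<open>n \<ge> 8\<close> gives blocks of size \<open>a \<ge> 4\<close>, for which \<open>a - 2 \<ge> a / 2\<close>: half of the exponent is left after
  the price of the windows is paid. The condition \<open>d \<ge> 576 = 24\<^sup>2\<close> keeps the typical lengths between \<open>1 / 2\<close> and \<open>3 / 2\<close>.\<close>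
lemma sphere_loss_ball_large:
  assumes K: "K > 0"
  obtains \<tau> where "\<tau> > 0" "\<And>n d Y. n \<ge> 8 \<Longrightarrow> d \<ge> 576 \<Longrightarrow>
    emeasure (\<Pi>\<^sub>M i\<in>{..<n}. sphere_law d) (loss_ball n d Y \<tau>) \<le> ennreal (exp (- K * real n * real (min n d)))"
proof
  define L where "L = 36 + 12 * K"
  \<comment> \<open>Of the exponent \<open>Q (a - 2) \<ge> Q a / 2\<close> the constants of \<open>sphere_block_affinity\<close> use up \<open>4 a\<close>.\<close>
  define Q where "Q = 2 * L + 8"
  define q where "q = exp (- Q)"
  have L: "L > 0" using K by (simp add: L_def)
  have q: "0 < q" "q \<le> 1" using L by (simp_all add: q_def Q_def)
  show "1 / (32768 / q ^ 4) > 0" using q by simp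
  fix n d :: nat and Y assume n: "n \<ge> 8" and d: "d \<ge> 576"
  have d0: "d > 0" using d by simp
  define a where "a = min (n div 2) ((d + 1) div 2)"
  have a: "a > 0" "2 * a \<le> n" "2 * a \<le> d + 1" "min n d \<le> 3 * a" "4 \<le> a" using n d by (auto simp: a_def)
  have "emeasure (\<Pi>\<^sub>M i\<in>{..<n}. sphere_law d) (loss_ball n d Y (1 / (32768 / q ^ 4))) \<le> ennreal (exp (9 * real a * real n - L * real a * real n / 4))"
  proof (rule loss_ball_of_blocks[OF prob_space_sphere_law sets_sphere_law d0 a(1,2)])
    fix I J :: "nat set" assume I: "finite I" "finite J" "I \<inter> J = {}" "card I = a" "card J = a"
    have "28800 * exp (real a) / q\<^sup>2 * q ^ a \<le> exp (- L * a)"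
    proof -
      have "28800 \<le> exp (3 * real a)"
      proof -
        have "exp 12 \<le> exp (3 * real a)" using a(5) by simp
        with exp_12_ge show ?thesis by linarith
      qed
      then have "28800 * exp (real a) \<le> exp (3 * real a) * exp (real a)" by (intro mult_right_mono) auto
      then have 1: "28800 * exp (real a) \<le> exp (4 * real a)" by (simp add: mult_exp_exp)
      have 2: "q ^ a / q\<^sup>2 = exp (- Q * (real a - 2))"
      proof -
        have "q ^ a = exp (- Q * real a)" unfolding q_def using exp_of_nat_mult[of a "- Q"] by (simp add: mult.commute)
        moreover have "q\<^sup>2 = exp (- Q * 2)" unfolding q_def using exp_of_nat_mult[of 2 "- Q"] by (simp add: mult.commute)
        ultimately show ?thesis by (simp add: exp_diff[symmetric] algebra_simps)
      qed
      have "28800 * exp (real a) / q\<^sup>2 * q ^ a = 28800 * exp (real a) * (q ^ a / q\<^sup>2)" by simp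
      also have "\<dots> \<le> exp (4 * real a) * exp (- Q * (real a - 2))"
        unfolding 2 using 1 by (intro mult_right_mono) auto
      also have "\<dots> = exp (4 * real a - Q * (real a - 2))" by (simp add: mult_exp_exp)
      also have "\<dots> \<le> exp (- L * a)"
      proof -
        have "Q * (real a / 2) \<le> Q * (real a - 2)" using a(5) L by (intro mult_left_mono) (auto simp: Q_def)
        then have "4 * real a - Q * (real a - 2) \<le> - L * a" unfolding Q_def by (simp add: algebra_simps)
        then show ?thesis by (simp only: exp_le_cancel_iff)
      qed
      finally show ?thesis .
    qed
    then have "(28800 * exp (real a) / q\<^sup>2 * q ^ a) ^ a \<le> exp (- L * a) ^ a" using q by (intro power_mono) auto
    also have "\<dots> = exp (- L * (real a)\<^sup>2)"
      using exp_of_nat_mult[of a "- L * a"] by (simp add: power2_eq_square mult.left_commute mult.commute)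
    finally have "ennreal ((28800 * exp (real a) / q\<^sup>2 * q ^ a) ^ a) \<le> ennreal (exp (- L * (real a)\<^sup>2))" by (rule ennreal_leI)
    with sphere_block_affinity[OF d q a(3) I, of Y]
    show "(\<integral>\<^sup>+z. (affinity d (32768 / q ^ 4 * real d) I J Y z) \<partial>(rows (I \<union> J) (sphere_law d))) \<le> ennreal (exp (- L * (real a)\<^sup>2))"
      by (rule order_trans)
  qed (use q L in auto)
  also have "\<dots> \<le> ennreal (exp (- K * real n * real (min n d)))"
    using a(4) K by (intro block_exponent_bound) (auto simp: L_def)
  finally show "emeasure (\<Pi>\<^sub>M i\<in>{..<n}. sphere_law d) (loss_ball n d Y (1 / (32768 / q ^ 4))) \<le> ennreal (exp (- K * real n * real (min n d)))" .
qed

section \<open>Laws without atoms\<close>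

text \<open>Compactness: the mass of short intervals is locally small, and a Lebesgue number makes this uniform on a compact interval that carries almost all the mass.\<close>
lemma atomless_uniformly_small:
  fixes N :: "real measure"
  assumes N: "prob_space N" "sets N = sets borel" and atomless: "\<And>x. measure N {x} = 0" and \<eta>: "\<eta> > 0"
  obtains e where "e > 0" "\<And>y. measure N {y - e..y + e} \<le> \<eta>"
proof -
  interpret prob_space N by fact
  note [measurable_cong] = N(2)
  have sp: "space N = UNIV" using sets_eq_imp_space_eq[OF N(2)] by simp
  have msets [simp]: "{a..b} \<in> sets N" "ball x r \<in> sets N" for a b x r :: real by (simp_all add: N(2))
  have "(\<lambda>k. measure N {- real k..real k}) \<longlonglongrightarrow> measure N (\<Union>k. {- real k..real k})"
    by (intro finite_Lim_measure_incseq) (auto simp: incseq_def)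
  moreover have "(\<Union>k. {- real k..real k}) = UNIV"
  proof (intro set_eqI iffI UNIV_I)
    fix x :: real
    obtain k where "\<bar>x\<bar> \<le> real k" using real_arch_simple by blast
    then show "x \<in> (\<Union>k. {- real k..real k})" by (intro UN_I[of k]) auto
  qed
  ultimately have "(\<lambda>k. measure N {- real k..real k}) \<longlonglongrightarrow> 1" using prob_space sp by simp
  then have "eventually (\<lambda>k. 1 - \<eta> < measure N {- real k..real k}) sequentially"
    using \<eta> by (intro order_tendstoD) auto
  then obtain k where k: "1 - \<eta> < measure N {- real k..real k}" by (auto simp: eventually_sequentially)
  define R where "R = real k"
  have loc: "\<exists>r>0. measure N (ball x r) \<le> \<eta>" for x
  proof -
    let ?A = "\<lambda>m. {x - 1 / (real m + 1)..x + 1 / (real m + 1)}"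
    have "(\<lambda>m. measure N (?A m)) \<longlonglongrightarrow> measure N (\<Inter>m. ?A m)"
    proof (intro finite_Lim_measure_decseq)
      show "decseq ?A"
      proof (rule decseq_SucI)
        fix m
        have "1 / (real (Suc m) + 1) \<le> 1 / (real m + 1)" by (intro divide_left_mono) auto
        then show "?A (Suc m) \<subseteq> ?A m" by auto
      qed
    qed auto
    also have "(\<Inter>m. ?A m) = {x}"
    proof (intro equalityI subsetI)
      fix y assume y: "y \<in> (\<Inter>m. ?A m)"
      show "y \<in> {x}"
      proof (rule ccontr)
        assume "y \<notin> {x}"
        then have "\<bar>y - x\<bar> > 0" by simp
        then obtain m where "inverse (real (Suc m)) < \<bar>y - x\<bar>" using reals_Archimedean by blast
        moreover have "y \<in> ?A m" using y by blast
        ultimately show False by (auto simp: inverse_eq_divide abs_if add.commute split: if_splits)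
      qed
    qed auto
    finally have "(\<lambda>m. measure N (?A m)) \<longlonglongrightarrow> 0" by (simp add: atomless)
    then have "eventually (\<lambda>m. measure N (?A m) < \<eta>) sequentially" using \<eta> by (intro order_tendstoD) auto
    then obtain m where m: "measure N (?A m) < \<eta>" by (auto simp: eventually_sequentially)
    have "measure N (ball x (1 / (real m + 1))) \<le> measure N (?A m)"
      by (intro finite_measure_mono) (auto simp: dist_real_def abs_less_iff)
    with m show ?thesis by (intro exI[of _ "1 / (real m + 1)"]) auto
  qed
  define G where "G = {ball x r | x r. measure N (ball x r) \<le> \<eta>}"
  have "compact {- R - 1..R + 1}" by simp
  moreover have "{- R - 1..R + 1} \<subseteq> \<Union>G"
  proof
    fix x assume "x \<in> {- R - 1..R + 1}"
    obtain r where "r > 0" "measure N (ball x r) \<le> \<eta>" using loc by blast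
    then show "x \<in> \<Union>G" unfolding G_def by (intro UnionI[of "ball x r"]) auto
  qed
  moreover have "\<And>T. T \<in> G \<Longrightarrow> open T" by (auto simp: G_def)
  ultimately obtain e where e: "e > 0" "\<And>x. x \<in> {- R - 1..R + 1} \<Longrightarrow> \<exists>T\<in>G. ball x e \<subseteq> T"
    using Heine_Borel_lemma[of "{- R - 1..R + 1}" G] by metis
  \<comment> \<open>With \<open>e' < 1\<close> an interval centred outside \<open>{- R - 1..R + 1}\<close> avoids \<open>{- R..R}\<close>.\<close>
  define e' where "e' = min (e / 2) (1 / 2)"
  have e': "e' > 0" "e' < e" "e' < 1" using e(1) by (auto simp: e'_def)
  show ?thesis
  proof
    show "e' > 0" by fact
    fix y
    show "measure N {y - e'..y + e'} \<le> \<eta>"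
    proof (cases "y \<in> {- R - 1..R + 1}")
      case True
      then obtain x r where T: "ball y e \<subseteq> ball x r" "measure N (ball x r) \<le> \<eta>" using e(2) unfolding G_def by blast
      have "{y - e'..y + e'} \<subseteq> ball y e" using e' by (auto simp: dist_real_def)
      then have "measure N {y - e'..y + e'} \<le> measure N (ball x r)" using T by (intro finite_measure_mono) auto
      with T show ?thesis by simp
    next
      case False
      have "measure N {y - e'..y + e'} \<le> measure N (space N - {- R..R})"
        using False e' by (intro finite_measure_mono) (auto simp: sp N(2))
      also have "\<dots> = 1 - measure N {- R..R}" by (intro prob_compl) simp
      finally show ?thesis using k by (simp add: R_def)
    qed
  qed
qed

lemma quadratic_roots_null:
  fixes b k :: real
  assumes "\<And>c. P c \<Longrightarrow> c\<^sup>2 + b * c = k"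
  shows "(\<integral>\<^sup>+c. (if P c then 1 else 0) * indicator A c \<partial>lborel) = 0"
proof -
  have "{c. P c} \<subseteq> {- b / 2 + sqrt (k + b\<^sup>2 / 4), - b / 2 - sqrt (k + b\<^sup>2 / 4)}"
  proof
    fix c assume "c \<in> {c. P c}"
    then have "(c + b / 2)\<^sup>2 = k + b\<^sup>2 / 4" using assms[of c] by (simp add: power2_eq_square algebra_simps)
    then have "\<bar>c + b / 2\<bar> = sqrt (k + b\<^sup>2 / 4)" by (metis real_sqrt_abs)
    then show "c \<in> {- b / 2 + sqrt (k + b\<^sup>2 / 4), - b / 2 - sqrt (k + b\<^sup>2 / 4)}" by (auto simp: abs_if split: if_splits)
  qed
  then have "finite {c. P c}" by (rule finite_subset) simp
  then have null: "{c. P c} \<in> null_sets lborel" by (rule finite_imp_null_set_lborel)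
  have "AE c in lborel. (if P c then 1 else 0) * indicator A c = (0 :: ennreal)"
    by (rule AE_I'[OF null]) auto
  then have "(\<integral>\<^sup>+c. (if P c then 1 else 0) * indicator A c \<partial>lborel) = (\<integral>\<^sup>+c. 0 \<partial>(lborel :: real measure))"
    by (rule nn_integral_cong_AE)
  then show ?thesis by simp
qed

lemma dot_shift_shift:
  "dot d (shift d c e h) (shift d c e h) = dot d h h + 2 * c * dot d h e + c\<^sup>2 * dot d e e"
  by (simp add: dot_shift dot_shift_right dot_commute[of d e h] power2_eq_square algebra_simps)

text \<open>An event that meets every line of a fixed direction in at most two points has probability \<open>0\<close>, by the average over the translations.\<close>
lemma gaussian_null_of_lines:
  assumes d: "d > 0" and e: "dot d e e = 1" and [measurable]: "Measurable.pred (vec_space d) P"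
    and quad: "\<And>h. \<exists>b k. \<forall>c. P (shift d c e h) \<longrightarrow> c\<^sup>2 + b * c = k"
  shows "(\<integral>\<^sup>+h. (if P h then 1 else 0) \<partial>gaussian_law d) = 0"
proof -
  let ?F = "\<lambda>h. if P h then 1 else (0 :: ennreal)"
  have "ennreal (1 / sqrt d) * (\<integral>\<^sup>+h. ?F h \<partial>gaussian_law d) \<le>
    (\<integral>\<^sup>+h. (\<integral>\<^sup>+c. ?F (shift d c e h) * indicator {-(1 / sqrt d)..1 / sqrt d} c \<partial>lborel) \<partial>gaussian_law d)"
    by (intro gaussian_average_shift d e) measurable
  also have "\<dots> = (\<integral>\<^sup>+h. 0 \<partial>gaussian_law d)"
  proof (intro nn_integral_cong)
    fix h
    obtain b k where "\<forall>c. P (shift d c e h) \<longrightarrow> c\<^sup>2 + b * c = k" using quad by blast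
    then show "(\<integral>\<^sup>+c. ?F (shift d c e h) * indicator {-(1 / sqrt d)..1 / sqrt d} c \<partial>lborel) = 0"
      by (intro quadratic_roots_null[where b = b and k = k]) auto
  qed
  finally show ?thesis using d by (simp add: ennreal_zero_less_divide)
qed

lemma exists_unit: "d > 0 \<Longrightarrow> \<exists>e. dot d e e = 1"
  using exists_unit_orthogonal[of "{}" d] by auto

lemma gaussian_norm_atomless:
  assumes d: "d > 0"
  shows "(\<integral>\<^sup>+h. (if dot d h h = y then 1 else 0) \<partial>gaussian_law d) = 0"
proof -
  obtain e where e: "dot d e e = 1" using exists_unit[OF d] by blast
  show ?thesis
  proof (rule gaussian_null_of_lines[OF d e])
    fix h
    show "\<exists>b k. \<forall>c. dot d (shift d c e h) (shift d c e h) = y \<longrightarrow> c\<^sup>2 + b * c = k"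
      by (rule exI[of _ "2 * dot d h e"], rule exI[of _ "y - dot d h h"]) (auto simp: dot_shift_shift e)
  qed measurable
qed

text \<open>For \<open>y = 0\<close> the lines in direction \<open>u\<close> meet the hyperplane \<open>\<langle>u,h\<rangle> = 0\<close> once. For \<open>y \<noteq> 0\<close> a line in a direction orthogonal
  to \<open>u\<close>, which exists as \<open>d \<ge> 2\<close>, meets the cone \<open>\<langle>u,h\<rangle> = y \<bar>h\<bar>\<close> at most twice.\<close>
lemma sphere_linear_atomless:
  assumes d: "d \<ge> 2" and u: "dot d u u = 1"
  shows "(\<integral>\<^sup>+v. (if dot d u v = y then 1 else 0) \<partial>sphere_law d) = 0"
proof -
  have d0: "d > 0" using d by simp
  have "(\<integral>\<^sup>+v. (if dot d u v = y then 1 else 0) \<partial>sphere_law d) =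
      (\<integral>\<^sup>+h. (if dot d u h / vec_norm d h = y then 1 else 0) \<partial>gaussian_law d)"
    by (subst nn_integral_sphere_law[OF d0]) (auto simp: dot_normalize_vec)
  also have "\<dots> = 0"
  proof (cases "y = 0")
    case True
    show ?thesis
    proof (rule gaussian_null_of_lines[OF d0 u])
      fix h
      have "c\<^sup>2 + dot d u h * c = 0" if "dot d u (shift d c u h) / vec_norm d (shift d c u h) = y" for c
      proof -
        have "dot d u (shift d c u h) = 0"
        proof (cases "vec_norm d (shift d c u h) = 0")
          case z: True
          have "(dot d u (shift d c u h))\<^sup>2 \<le> dot d u u * dot d (shift d c u h) (shift d c u h)" by (rule dot_Cauchy_Schwarz)
          also have "\<dots> = 0" using z by (simp add: vec_norm_sq[symmetric])
          finally show ?thesis by simp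
        qed (use that True in auto)
        then have "c = - dot d u h" by (simp add: dot_shift_right u)
        then show ?thesis by (simp add: power2_eq_square)
      qed
      then show "\<exists>b k. \<forall>c. dot d u (shift d c u h) / vec_norm d (shift d c u h) = y \<longrightarrow> c\<^sup>2 + b * c = k" by blast
    qed measurable
  next
    case False
    obtain e where e: "dot d e e = 1" "dot d u e = 0" using exists_unit_orthogonal[of "{u}" d] d by auto
    show ?thesis
    proof (rule gaussian_null_of_lines[OF d0 e(1)])
      fix h
      have "c\<^sup>2 + (2 * dot d h e) * c = (dot d u h / y)\<^sup>2 - dot d h h"
        if c: "dot d u (shift d c e h) / vec_norm d (shift d c e h) = y" for c
      proof -
        have "vec_norm d (shift d c e h) \<noteq> 0" using c False by auto
        then have "vec_norm d (shift d c e h) = dot d u h / y"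
          using c False by (simp add: dot_shift_right e field_simps)
        then have "dot d (shift d c e h) (shift d c e h) = (dot d u h / y)\<^sup>2" by (simp add: vec_norm_sq[symmetric])
        then have "dot d h h + 2 * c * dot d h e + c\<^sup>2 = (dot d u h / y)\<^sup>2" by (simp add: dot_shift_shift e)
        then show ?thesis by (simp add: algebra_simps)
      qed
      then show "\<exists>b k. \<forall>c. dot d u (shift d c e h) / vec_norm d (shift d c e h) = y \<longrightarrow> c\<^sup>2 + b * c = k" by blast
    qed measurable
  qed
  finally show ?thesis .
qed

text \<open>The form of the two uniform small ball estimates below: a quantitative bound in high dimension, and finitely many remaining dimensions with a bound of their own.\<close>
lemma uniform_over_dimensions:
  fixes Q :: "nat \<Rightarrow> real \<Rightarrow> bool"
  assumes anti: "\<And>d e e'. Q d e \<Longrightarrow> 0 < e' \<Longrightarrow> e' \<le> e \<Longrightarrow> Q d e'"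
    and large: "e1 > 0" "\<And>d. d \<ge> d1 \<Longrightarrow> Q d e1"
    and single: "\<And>d. d \<ge> d0 \<Longrightarrow> \<exists>e>0. Q d e"
  shows "\<exists>e>0. \<forall>d\<ge>d0. Q d e"
proof -
  have "\<exists>e>0. \<forall>d\<in>F. Q d e" if "finite F" "F \<subseteq> {d0..}" for F
    using that
  proof (induction F)
    case empty
    show ?case by (intro exI[of _ 1]) simp
  next
    case (insert d F)
    then obtain e e' where "e > 0" "\<forall>d\<in>F. Q d e" "e' > 0" "Q d e'" using single[of d] by auto
    then show ?case by (intro exI[of _ "min e e'"]) (auto intro: anti)
  qed
  moreover have "{d0..<d1} \<subseteq> {d0..}" by auto
  ultimately obtain e2 where e2: "e2 > 0" "\<forall>d\<in>{d0..<d1}. Q d e2" by blast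
  have "Q d (min e1 e2)" if "d \<ge> d0" for d
  proof (cases "d \<ge> d1")
    case True
    show ?thesis by (rule anti[OF large(2)[OF True]]) (use large e2 in auto)
  next
    case False
    then have "Q d e2" using e2 that by auto
    then show ?thesis by (rule anti) (use large e2 in auto)
  qed
  then show ?thesis using large e2 by (intro exI[of _ "min e1 e2"]) auto
qed

lemma gaussian_norm_small_ball_fixed_dim:
  assumes d: "d > 0" and \<kappa>: "\<kappa> > 0"
  shows "\<exists>e>0. \<forall>y. emeasure (gaussian_law d) (norm_shell d y (e / sqrt d)) \<le> ennreal \<kappa>"
proof -
  interpret G: prob_space "gaussian_law d" using d by (rule prob_space_gaussian_law)
  note [measurable_cong] = sets_gaussian_law
  have [measurable]: "(\<lambda>h. dot d h h) \<in> borel_measurable (gaussian_law d)" by measurable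
  define N where "N = distr (gaussian_law d) borel (\<lambda>h. dot d h h)"
  have N: "prob_space N" "sets N = sets borel" unfolding N_def by (auto intro!: G.prob_space_distr)
  have mN: "measure N A = measure (gaussian_law d) {h \<in> space (vec_space d). dot d h h \<in> A}" if "A \<in> sets borel" for A
    unfolding N_def using that by (subst measure_distr) (auto intro!: arg_cong[where f = "measure _"] simp: space_gaussian_law)
  have "measure N {y} = 0" for y
  proof -
    have "emeasure (gaussian_law d) {h \<in> space (vec_space d). dot d h h = y} =
        (\<integral>\<^sup>+h. indicator {h \<in> space (vec_space d). dot d h h = y} h \<partial>gaussian_law d)"
      by (rule nn_integral_indicator[symmetric]) measurable
    also have "\<dots> = (\<integral>\<^sup>+h. (if dot d h h = y then 1 else 0) \<partial>gaussian_law d)"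
      by (intro nn_integral_cong) (auto simp: space_gaussian_law)
    also have "\<dots> = 0" by (rule gaussian_norm_atomless[OF d])
    finally show ?thesis by (subst mN) (auto simp: measure_def)
  qed
  then obtain e where e: "e > 0" "\<And>y. measure N {y - e..y + e} \<le> \<kappa>"
    using atomless_uniformly_small[OF N _ \<kappa>] by blast
  show ?thesis
  proof (intro exI[of _ "e * sqrt d"] conjI allI)
    show "e * sqrt d > 0" using e d by simp
    fix y
    have "(norm_shell d y (e * sqrt d / sqrt d)) = {h \<in> space (vec_space d). dot d h h \<in> {y - e..y + e}}"
      using d by auto
    then show "emeasure (gaussian_law d) (norm_shell d y (e * sqrt d / sqrt d)) \<le> ennreal \<kappa>"
      using e(2)[of y] by (simp add: G.emeasure_eq_measure mN ennreal_leI)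
  qed
qed

section \<open>A single Gaussian row\<close>

lemma measurable_dilate_pair:
  "(\<lambda>(c, v). dilate d (1 + c) v) \<in> measurable (borel \<Otimes>\<^sub>M vec_space d) (vec_space d)"
  unfolding dilate_def by measurable

text \<open>Dilations by \<open>1 + c\<close> with \<open>0 \<le> c \<le> 1/\<surd>d\<close> play the role of the translations. On the typical set, where \<open>\<bar>h\<bar>\<^sup>2\<close> is within
  \<open>B/\<surd>d\<close> of \<open>1\<close>, they decrease the density by a bounded factor at most, and they move \<open>\<bar>h\<bar>\<^sup>2\<close> with speed
  bounded below.\<close>
lemma gaussian_norm_small_ball_large_dim:
  assumes d: "d \<ge> 9" and B: "B > 0" "4 * B\<^sup>2 \<le> d" and eps: "eps > 0"
  shows "emeasure (gaussian_law d) (norm_shell d y (eps / sqrt d))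
    \<le> ennreal (16 * eps * exp (B + 3 / 2)) + ennreal (2 * exp (3 - B / 2))"
proof -
  have d0: "d > 0" using d by simp
  interpret G: prob_space "gaussian_law d" using d0 by (rule prob_space_gaussian_law)
  interpret GL: pair_sigma_finite "gaussian_law d" lborel by standard
  note [measurable_cong] = sets_gaussian_law
  note [measurable] = measurable_dilate_pair
  define s where "s = 1 / sqrt (real d)"
  have "sqrt 9 \<le> sqrt (real d)" using d by (intro real_sqrt_le_mono) simp
  then have s: "0 < s" "s \<le> 1 / 3" "d * s\<^sup>2 = 1" using d0 by (auto simp: s_def power_divide field_simps)
  have Bs: "B * s \<le> 1 / 2"
  proof -
    have "(B * s)\<^sup>2 * 4 \<le> d * s\<^sup>2" using B(2) by (simp add: power_mult_distrib mult.assoc[symmetric] mult.commute[of _ 4] mult_right_mono)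
    then have "(B * s)\<^sup>2 \<le> (1 / 2)\<^sup>2" using s by (simp add: power_divide)
    then show ?thesis by (rule power2_le_imp_le) simp
  qed
  define P where "P h \<longleftrightarrow> \<bar>dot d h h - y\<bar> \<le> eps * s \<and> \<bar>dot d h h - 1\<bar> < B * s" for h
  have [measurable]: "Measurable.pred (vec_space d) P" unfolding P_def by measurable
  define F where "F h = (if P h then 1 else (0 :: ennreal))" for h
  have F [measurable]: "F \<in> borel_measurable (vec_space d)" unfolding F_def by measurable
  have weight: "ennreal (exp (- (B + 3 / 2))) * (\<integral>\<^sup>+h. F h \<partial>gaussian_law d) \<le> (\<integral>\<^sup>+h. F (dilate d (1 + c) h) \<partial>gaussian_law d)"
    if c: "c \<in> {0..s}" for c
  proof -
    have c': "0 \<le> c" "c \<le> s" "c \<le> 1 / 3" using c s by auto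
    have "ennreal (exp (- (B + 3 / 2))) * (\<integral>\<^sup>+h. F h \<partial>gaussian_law d) = (\<integral>\<^sup>+h. ennreal (exp (- (B + 3 / 2))) * F h \<partial>gaussian_law d)"
      by (intro nn_integral_cmult[symmetric]) measurable
    also have "\<dots> \<le> (\<integral>\<^sup>+h. ennreal (exp (real d / 2 * dot d h h * (1 - 1 / (1 + c)\<^sup>2)) / (1 + c) ^ d) * F h \<partial>gaussian_law d)"
    proof (intro nn_integral_mono)
      fix h
      show "ennreal (exp (- (B + 3 / 2))) * F h \<le> ennreal (exp (real d / 2 * dot d h h * (1 - 1 / (1 + c)\<^sup>2)) / (1 + c) ^ d) * F h"
      proof (cases "P h")
        case True
        then have R: "1 - B * s \<le> dot d h h" by (auto simp: P_def)
        have t: "2 * c - 3 * c\<^sup>2 \<le> 1 - 1 / (1 + c)\<^sup>2" using c' by (intro one_minus_inverse_square_ge)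
        have "c * (3 * c) \<le> c * 2" using c' by (intro mult_left_mono) auto
        then have t0: "0 \<le> 2 * c - 3 * c\<^sup>2" by (simp add: power2_eq_square)
        have "d / 2 * (1 - B * s) * (2 * c - 3 * c\<^sup>2) \<le> real d / 2 * dot d h h * (1 - 1 / (1 + c)\<^sup>2)"
          using R t t0 Bs by (intro mult_mono mult_left_mono mult_nonneg_nonneg) (auto simp: dot_nonneg)
        moreover have "d / 2 * (1 - B * s) * (2 * c - 3 * c\<^sup>2) = d * c - 3 / 2 * (d * c\<^sup>2) - B * (d * (s * c)) + 3 / 2 * (B * s) * (d * c\<^sup>2)"
          by (simp add: power2_eq_square field_simps)
        moreover have dc: "d * c\<^sup>2 \<le> 1"
        proof -
          have "d * c\<^sup>2 \<le> d * s\<^sup>2" using c' by (intro mult_left_mono power_mono) auto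
          then show ?thesis using s by simp
        qed
        moreover have "B * (d * (s * c)) \<le> B * 1"
        proof (intro mult_left_mono)
          have "d * (s * c) \<le> d * (s * s)" using c' s by (intro mult_left_mono) auto
          then show "d * (s * c) \<le> 1" using s by (simp add: power2_eq_square)
        qed (use B in auto)
        moreover have "0 \<le> 3 / 2 * (B * s) * (d * c\<^sup>2)" using B s by simp
        ultimately have le: "- (B + 3 / 2) + d * c \<le> real d / 2 * dot d h h * (1 - 1 / (1 + c)\<^sup>2)" by linarith
        have "exp (- (B + 3 / 2)) * (1 + c) ^ d \<le> exp (- (B + 3 / 2)) * exp c ^ d"
          using c' by (intro mult_left_mono power_mono exp_ge_add_one_self) auto
        also have "\<dots> = exp (- (B + 3 / 2) + d * c)" by (simp only: exp_of_nat_mult[symmetric] mult_exp_exp)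
        also have "\<dots> \<le> exp (real d / 2 * dot d h h * (1 - 1 / (1 + c)\<^sup>2))" using le by (simp only: exp_le_cancel_iff)
        finally have "exp (- (B + 3 / 2)) \<le> exp (real d / 2 * dot d h h * (1 - 1 / (1 + c)\<^sup>2)) / (1 + c) ^ d"
          using c' by (subst pos_le_divide_eq) auto
        then show ?thesis by (intro mult_right_mono ennreal_leI) auto
      qed (simp add: F_def)
    qed
    also have "\<dots> = (\<integral>\<^sup>+h. F (dilate d (1 + c) h) \<partial>gaussian_law d)"
      using c' by (intro nn_integral_gaussian_dilate[symmetric] d0) auto
    finally show ?thesis .
  qed
  have meas2: "(\<lambda>(h, c). F (dilate d (1 + c) h) * indicator {0..s} c) \<in> borel_measurable (gaussian_law d \<Otimes>\<^sub>M lborel)"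
  proof -
    have "(\<lambda>p. F (case (snd p, fst p) of (c, v) \<Rightarrow> dilate d (1 + c) v) * indicator {0..s} (snd p)) \<in> borel_measurable (gaussian_law d \<Otimes>\<^sub>M lborel)"
      by measurable
    then show ?thesis by (simp add: case_prod_beta)
  qed
  have "ennreal s * (ennreal (exp (- (B + 3 / 2))) * (\<integral>\<^sup>+h. F h \<partial>gaussian_law d)) =
      (\<integral>\<^sup>+c. (ennreal (exp (- (B + 3 / 2))) * (\<integral>\<^sup>+h. F h \<partial>gaussian_law d)) * indicator {0..s} c \<partial>lborel)"
    using s by (subst nn_integral_cmult) (auto simp: mult.commute)
  also have "\<dots> \<le> (\<integral>\<^sup>+c. (\<integral>\<^sup>+h. F (dilate d (1 + c) h) \<partial>gaussian_law d) * indicator {0..s} c \<partial>lborel)"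
    using weight by (intro nn_integral_mono) (auto simp: indicator_def)
  also have "\<dots> = (\<integral>\<^sup>+c. (\<integral>\<^sup>+h. F (dilate d (1 + c) h) * indicator {0..s} c \<partial>gaussian_law d) \<partial>lborel)"
    by (intro nn_integral_cong nn_integral_multc[symmetric]) measurable
  also have "\<dots> = (\<integral>\<^sup>+h. (\<integral>\<^sup>+c. F (dilate d (1 + c) h) * indicator {0..s} c \<partial>lborel) \<partial>gaussian_law d)"
    by (rule GL.Fubini'[OF meas2])
  also have "\<dots> \<le> (\<integral>\<^sup>+h. ennreal (16 * (eps * s)) \<partial>gaussian_law d)"
  proof (intro nn_integral_mono)
    fix h
    let ?R = "dot d h h" and ?C = "{c \<in> {0..s}. P (dilate d (1 + c) h)}"
    have C: "\<bar>(1 + c)\<^sup>2 * ?R - y\<bar> \<le> eps * s" "0 \<le> c" "1 / 8 \<le> ?R" if "c \<in> ?C" for c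
    proof -
      have c: "0 \<le> c" "c \<le> 1" using that s by auto
      have eq: "dot d (dilate d (1 + c) h) (dilate d (1 + c) h) = (1 + c)\<^sup>2 * ?R"
        by (simp add: dot_dilate dot_dilate_right power2_eq_square)
      have P: "P (dilate d (1 + c) h)" using that by simp
      show "\<bar>(1 + c)\<^sup>2 * ?R - y\<bar> \<le> eps * s" using P by (simp add: P_def eq)
      have "1 / 2 \<le> (1 + c)\<^sup>2 * ?R" using P Bs unfolding P_def eq by (auto simp: abs_if split: if_splits)
      also have "\<dots> \<le> 2\<^sup>2 * ?R" using c by (intro mult_right_mono power_mono dot_nonneg) auto
      finally show "1 / 8 \<le> ?R" by simp
      show "0 \<le> c" by fact
    qed
    have close: "\<bar>c - c'\<bar> \<le> 8 * (eps * s)" if "c \<in> ?C" "c' \<in> ?C" for c c'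
    proof -
      have "((1 + c)\<^sup>2 - (1 + c')\<^sup>2) * ?R = ((1 + c)\<^sup>2 * ?R - y) - ((1 + c')\<^sup>2 * ?R - y)" by (simp add: algebra_simps)
      then have "\<bar>((1 + c)\<^sup>2 - (1 + c')\<^sup>2) * ?R\<bar> \<le> 2 * (eps * s)" using C(1)[OF that(1)] C(1)[OF that(2)] by linarith
      moreover have "((1 + c)\<^sup>2 - (1 + c')\<^sup>2) * ?R = (c - c') * ((2 + c + c') * ?R)" by (simp add: power2_eq_square algebra_simps)
      moreover have "\<bar>c - c'\<bar> * (1 / 4) \<le> \<bar>(c - c') * ((2 + c + c') * ?R)\<bar>"
      proof -
        have "2 * (1 / 8) \<le> (2 + c + c') * ?R" using C[OF that(1)] C[OF that(2)] by (intro mult_mono) auto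
        then have "\<bar>c - c'\<bar> * (1 / 4) \<le> \<bar>c - c'\<bar> * \<bar>(2 + c + c') * ?R\<bar>" by (intro mult_left_mono) auto
        then show ?thesis by (simp only: abs_mult)
      qed
      ultimately show ?thesis by simp
    qed
    have "\<exists>c0. ?C \<subseteq> {c0 - 8 * (eps * s)..c0 + 8 * (eps * s)}"
    proof (cases "?C = {}")
      case False
      then obtain c0 where c0: "c0 \<in> ?C" by blast
      have "c \<in> {c0 - 8 * (eps * s)..c0 + 8 * (eps * s)}" if "c \<in> ?C" for c
        using close[OF that c0] by (auto simp: abs_le_iff)
      then show ?thesis by blast
    qed auto
    then obtain c0 where c0: "?C \<subseteq> {c0 - 8 * (eps * s)..c0 + 8 * (eps * s)}" by blast
    have "(\<integral>\<^sup>+c. F (dilate d (1 + c) h) * indicator {0..s} c \<partial>lborel) \<le> (\<integral>\<^sup>+c. indicator {c0 - 8 * (eps * s)..c0 + 8 * (eps * s)} c \<partial>lborel)"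
      using c0 by (intro nn_integral_mono) (auto simp: F_def indicator_def split: if_splits)
    also have "\<dots> = ennreal (16 * (eps * s))" using eps s by simp
    finally show "(\<integral>\<^sup>+c. F (dilate d (1 + c) h) * indicator {0..s} c \<partial>lborel) \<le> ennreal (16 * (eps * s))" .
  qed
  also have "\<dots> = ennreal (16 * (eps * s))" by (simp add: G.emeasure_space_1)
  finally have le: "ennreal s * (ennreal (exp (- (B + 3 / 2))) * (\<integral>\<^sup>+h. F h \<partial>gaussian_law d)) \<le> ennreal (16 * (eps * s))" .
  let ?c = "1 / s * exp (B + 3 / 2)"
  have "(\<integral>\<^sup>+h. F h \<partial>gaussian_law d) = ennreal ?c * (ennreal s * (ennreal (exp (- (B + 3 / 2))) * (\<integral>\<^sup>+h. F h \<partial>gaussian_law d)))"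
  proof -
    have "?c * s * exp (- (B + 3 / 2)) = 1" using s by (simp add: mult_exp_exp)
    moreover have "ennreal ?c * ennreal s * ennreal (exp (- (B + 3 / 2))) = ennreal (?c * s * exp (- (B + 3 / 2)))"
    proof -
      have "ennreal (?c * s * exp (- (B + 3 / 2))) = ennreal (?c * s) * ennreal (exp (- (B + 3 / 2)))"
        using s by (intro ennreal_mult) auto
      also have "ennreal (?c * s) = ennreal ?c * ennreal s" using s by (intro ennreal_mult) auto
      finally show ?thesis by (rule sym)
    qed
    ultimately have "ennreal ?c * ennreal s * ennreal (exp (- (B + 3 / 2))) = 1" by simp
    then show ?thesis by (simp only: mult.assoc[symmetric] mult_1_left)
  qed
  also have "\<dots> \<le> ennreal ?c * ennreal (16 * (eps * s))" by (intro mult_left_mono le) auto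
  also have "\<dots> = ennreal (?c * (16 * (eps * s)))" using s eps by (intro ennreal_mult[symmetric]) auto
  also have "?c * (16 * (eps * s)) = 16 * eps * exp (B + 3 / 2)" using s by simp
  finally have Fle: "(\<integral>\<^sup>+h. F h \<partial>gaussian_law d) \<le> ennreal (16 * eps * exp (B + 3 / 2))" .
  let ?T = "{h \<in> space (vec_space d). B / sqrt d \<le> \<bar>dot d h h - 1\<bar>}"
  have [measurable]: "?T \<in> sets (gaussian_law d)" unfolding sets_gaussian_law by measurable
  have "emeasure (gaussian_law d) (norm_shell d y (eps / sqrt d)) \<le> (\<integral>\<^sup>+h. F h + indicator ?T h \<partial>gaussian_law d)"
  proof (rule emeasure_le_nn_integral)
    show "(norm_shell d y (eps / sqrt d)) \<in> sets (gaussian_law d)"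
      unfolding sets_gaussian_law by measurable
    show "1 \<le> F h + indicator ?T h" if "h \<in> (norm_shell d y (eps / sqrt d))" for h
      using that by (auto simp: F_def P_def indicator_def s_def)
  qed
  also have "\<dots> = (\<integral>\<^sup>+h. F h \<partial>gaussian_law d) + emeasure (gaussian_law d) ?T"
    by (subst nn_integral_add) auto
  also have "\<dots> \<le> ennreal (16 * eps * exp (B + 3 / 2)) + ennreal (2 * exp (3 - B / 2))"
    using d B by (intro add_mono Fle gaussian_norm_tail) auto
  finally show ?thesis .
qed

lemma gaussian_norm_small_ball:
  assumes \<kappa>: "\<kappa> > 0"
  obtains e where "e > 0" "\<And>d y. d > 0 \<Longrightarrow>
    emeasure (gaussian_law d) (norm_shell d y (e / sqrt d)) \<le> ennreal \<kappa>"
proof -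
  define Q where "Q d e \<longleftrightarrow> (\<forall>y. emeasure (gaussian_law d) (norm_shell d y (e / sqrt d)) \<le> ennreal \<kappa>)" for d e
  have anti: "Q d e'" if "Q d e" "0 < e'" "e' \<le> e" for d e e'
    unfolding Q_def
  proof
    fix y
    have "emeasure (gaussian_law d) (norm_shell d y (e' / sqrt d)) \<le>
      emeasure (gaussian_law d) (norm_shell d y (e / sqrt d))"
    proof (rule emeasure_mono)
      show "(norm_shell d y (e' / sqrt d)) \<subseteq> (norm_shell d y (e / sqrt d))"
        using that divide_right_mono[of e' e "sqrt d"] by (auto intro: order_trans)
    qed (unfold sets_gaussian_law, measurable)
    also have "\<dots> \<le> ennreal \<kappa>" using that by (simp add: Q_def)
    finally show "emeasure (gaussian_law d) (norm_shell d y (e' / sqrt d)) \<le> ennreal \<kappa>" .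
  qed
  \<comment> \<open>The two terms of the bound in high dimension get \<open>\<kappa> / 2\<close> each.\<close>
  obtain B where B: "B > 0" "2 * exp (3 - B / 2) \<le> \<kappa> / 2"
  proof
    define B where "B = max 1 (2 * (3 - ln (\<kappa> / 4)))"
    show "B > 0" by (simp add: B_def)
    have "2 * (3 - ln (\<kappa> / 4)) \<le> B" unfolding B_def by (rule max.cobounded2)
    then have "3 - B / 2 \<le> ln (\<kappa> / 4)" by argo
    then have "exp (3 - B / 2) \<le> exp (ln (\<kappa> / 4))" by (simp only: exp_le_cancel_iff)
    then show "2 * exp (3 - B / 2) \<le> \<kappa> / 2" using \<kappa> by simp
  qed
  define e1 where "e1 = \<kappa> / 2 / (16 * exp (B + 3 / 2))"
  have e1: "e1 > 0" "16 * e1 * exp (B + 3 / 2) = \<kappa> / 2" using \<kappa> by (simp_all add: e1_def)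
  define d1 where "d1 = max 9 (nat \<lceil>4 * B\<^sup>2\<rceil>)"
  have large: "Q d e1" if "d \<ge> d1" for d
    unfolding Q_def
  proof
    fix y
    have "4 * B\<^sup>2 \<le> real d" using that unfolding d1_def by linarith
    then have "emeasure (gaussian_law d) (norm_shell d y (e1 / sqrt d)) \<le>
        ennreal (16 * e1 * exp (B + 3 / 2)) + ennreal (2 * exp (3 - B / 2))"
      using that B e1 by (intro gaussian_norm_small_ball_large_dim) (auto simp: d1_def)
    also have "\<dots> \<le> ennreal (\<kappa> / 2) + ennreal (\<kappa> / 2)"
      unfolding e1(2) using B by (intro add_left_mono ennreal_leI)
    also have "\<dots> = ennreal \<kappa>" using \<kappa> by (subst ennreal_plus[symmetric]) auto
    finally show "emeasure (gaussian_law d) (norm_shell d y (e1 / sqrt d)) \<le> ennreal \<kappa>" .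
  qed
  have "\<exists>e>0. \<forall>d\<ge>1. Q d e"
  proof (rule uniform_over_dimensions[where Q = Q, OF _ e1(1) large])
    show "\<exists>e>0. Q d e" if "d \<ge> 1" for d
      using gaussian_norm_small_ball_fixed_dim[OF _ \<kappa>, of d] that by (auto simp: Q_def)
  qed (use anti in auto)
  then show ?thesis using that by (auto simp: Q_def Suc_le_eq)
qed

section \<open>A pair of spherical rows\<close>

lemma gaussian_linear_small_ball:
  assumes d: "d > 0" and u: "dot d u u = 1" and t: "t \<ge> 0"
  shows "emeasure (gaussian_law d) (slab d u y (t)) \<le> ennreal (2 * sqrt d * t)"
proof -
  interpret G: prob_space "gaussian_law d" using d by (rule prob_space_gaussian_law)
  have "emeasure (gaussian_law d) (slab d u y (t)) \<le>
    (\<integral>\<^sup>+h. 1 * indicator {y - t..y + t} (dot d u h) \<partial>gaussian_law d)"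
    by (rule emeasure_le_nn_integral) (unfold sets_gaussian_law, measurable, auto simp: abs_le_iff)
  also have "\<dots> \<le> ennreal (sqrt d / 1) * (\<integral>\<^sup>+x. indicator {y - t..y + t} x \<partial>lborel) * (\<integral>\<^sup>+v. 1 \<partial>gaussian_law d)"
    by (rule gaussian_integrate_direction[OF d u]) (auto simp: u)
  also have "\<dots> = ennreal (2 * sqrt d * t)"
    using t by (simp add: G.emeasure_space_1 ennreal_mult[symmetric] mult.commute mult.left_commute)
  finally show ?thesis .
qed

text \<open>With \<open>s = \<bar>h\<bar>\<close> and \<open>x = \<langle>u,h\<rangle>\<close>, the quantities \<open>x\<close> and \<open>x / s\<close> differ by \<open>O (1 / d)\<close> when \<open>s = 1 + O (1/\<surd>d)\<close> and
  \<open>x = O (1/\<surd>d)\<close>; so the density bound for \<open>x\<close> carries over.\<close>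
lemma sphere_linear_small_ball_large_dim:
  assumes d: "d \<ge> 576" and u: "dot d u u = 1" and B: "B > 0" and eps: "eps > 0"
  shows "emeasure (sphere_law d) (slab d u y (eps / sqrt d)) \<le>
    ennreal (4 * exp (1 / 2 - B) + 4 * (eps + 24 * B / sqrt d))"
proof -
  have d0: "d > 0" using d by simp
  note [measurable_cong] = sets_gaussian_law
  define r where "r = 1 / sqrt (real d)"
  have r: "0 < r" "24 * r \<le> 1" using sqrt_576[OF d] d0 by (auto simp: r_def field_simps)
  have rd: "sqrt d * r = 1" using d0 by (simp add: r_def)
  let ?T = "{h \<in> space (vec_space d). B / sqrt d \<le> \<bar>dot d u h\<bar>}"
  let ?t = "(eps + 24 * B * r) * r"
  have "emeasure (sphere_law d) (slab d u y (eps / sqrt d)) \<le> ennreal (2 * (2 * exp (1 / 2 - B) + 2 * (eps + 24 * B * r)))"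
  proof (rule sphere_event_le)
    fix h assume h: "h \<in> space (vec_space d)" "\<bar>vec_norm d h - 1\<bar> < 12 / sqrt d" "normalize_vec d h \<in> slab d u y (eps / sqrt d)"
    define s where "s = vec_norm d h"
    define x where "x = dot d u h"
    have "12 / sqrt d = 12 * r" by (simp add: r_def)
    then have s12: "\<bar>s - 1\<bar> \<le> 12 * r" "1 / 2 \<le> s" using h(2) r unfolding s_def by linarith+
    have y: "\<bar>x / s - y\<bar> \<le> eps * r" using h(3) by (simp add: dot_normalize_vec x_def s_def r_def)
    have "\<bar>x - y\<bar> \<le> ?t" if xB: "\<bar>x\<bar> < B * r"
    proof -
      have "x - x / s = x * (s - 1) / s" using s12 by (simp add: field_simps)
      then have "\<bar>x - x / s\<bar> = \<bar>x\<bar> * \<bar>s - 1\<bar> * (1 / s)" using s12 by (simp add: abs_mult)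
      also have "\<dots> \<le> (B * r) * (12 * r) * 2"
        using s12 xB B r by (intro mult_mono) (auto simp: field_simps)
      finally show ?thesis using y by (simp add: algebra_simps)
    qed
    then show "h \<in> ?T \<union> slab d u y ?t"
      using h(1) by (cases "\<bar>x\<bar> < B * r") (auto simp: x_def r_def)
  next
    have "emeasure (gaussian_law d) (?T \<union> slab d u y ?t) \<le> emeasure (gaussian_law d) ?T + emeasure (gaussian_law d) (slab d u y ?t)"
      by (intro emeasure_subadditive) (unfold sets_gaussian_law, measurable)
    also have "\<dots> \<le> ennreal (2 * exp (1 / 2 - B)) + ennreal (2 * sqrt d * ?t)"
      using u eps B r by (intro add_mono gaussian_linear_tail gaussian_linear_small_ball d0 mult_nonneg_nonneg) auto
    also have "\<dots> = ennreal (2 * exp (1 / 2 - B) + 2 * sqrt d * ?t)"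
      using eps B r by (intro ennreal_plus[symmetric]) auto
    also have "2 * sqrt d * ?t = 2 * (eps + 24 * B * r) * (sqrt d * r)" by (simp only: ac_simps)
    also have "\<dots> = 2 * (eps + 24 * B * r)" using rd by simp
    finally show "emeasure (gaussian_law d) (?T \<union> slab d u y ?t) \<le> ennreal (2 * exp (1 / 2 - B) + 2 * (eps + 24 * B * r))" .
  qed (use d eps B r in auto)
  then show ?thesis by (simp add: r_def)
qed

lemma AE_sphere_unit: "d > 0 \<Longrightarrow> AE u in sphere_law d. dot d u u = 1"
  using AE_sphere_law[of d] by (auto elim!: eventually_mono simp: vec_norm_sq[symmetric])

lemma measurable_sphere_pair_event:
  "(\<lambda>u. emeasure (sphere_law d) (slab d u y (t))) \<in> borel_measurable (sphere_law d)"
proof -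
  interpret S: prob_space "sphere_law d" by (rule prob_space_sphere_law)
  note [measurable_cong] = sets_sphere_law
  have "(slab d u y (t)) \<in> sets (sphere_law d)" for u
    unfolding sets_sphere_law by measurable
  then have "emeasure (sphere_law d) (slab d u y (t)) =
      (\<integral>\<^sup>+v. indicator (slab d u y (t)) v \<partial>sphere_law d)" for u
    by (rule nn_integral_indicator[symmetric])
  also have "(\<integral>\<^sup>+v. indicator (slab d u y (t)) v \<partial>sphere_law d) =
      (\<integral>\<^sup>+v. (if \<bar>dot d u v - y\<bar> \<le> t then 1 else 0) \<partial>sphere_law d)" for u
    by (intro nn_integral_cong) (auto simp: space_sphere_law)
  finally show ?thesis by simp
qed

lemma sphere_pair_small_ball_fixed_dim:
  assumes d: "d \<ge> 2" and \<kappa>: "\<kappa> > 0"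
  shows "\<exists>e>0. \<forall>y. (\<integral>\<^sup>+u. emeasure (sphere_law d) (slab d u y (e / sqrt d)) \<partial>sphere_law d) \<le> ennreal \<kappa>"
proof -
  have d0: "d > 0" using d by simp
  interpret S: prob_space "sphere_law d" by (rule prob_space_sphere_law)
  note [measurable_cong] = sets_sphere_law
  interpret SS: pair_prob_space "sphere_law d" "sphere_law d" by standard
  let ?S2 = "sphere_law d \<Otimes>\<^sub>M sphere_law d"
  have [measurable]: "(\<lambda>p. dot d (fst p) (snd p)) \<in> borel_measurable ?S2" by measurable
  define N where "N = distr ?S2 borel (\<lambda>p. dot d (fst p) (snd p))"
  have N: "prob_space N" "sets N = sets borel" unfolding N_def by (auto intro!: SS.prob_space_distr)
  interpret N: prob_space N by (rule N)
  have eN: "emeasure N A = (\<integral>\<^sup>+u. (\<integral>\<^sup>+v. indicator A (dot d u v) \<partial>sphere_law d) \<partial>sphere_law d)" if [measurable]: "A \<in> sets borel" for A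
  proof -
    have "emeasure N A = (\<integral>\<^sup>+t. indicator A t \<partial>N)" using N by (intro nn_integral_indicator[symmetric]) simp
    also have "\<dots> = (\<integral>\<^sup>+p. indicator A (dot d (fst p) (snd p)) \<partial>?S2)" unfolding N_def by (intro nn_integral_distr) measurable
    also have "\<dots> = (\<integral>\<^sup>+u. (\<integral>\<^sup>+v. indicator A (dot d u v) \<partial>sphere_law d) \<partial>sphere_law d)"
      by (subst S.nn_integral_fst[symmetric]) auto
    finally show ?thesis .
  qed
  have "measure N {y} = 0" for y
  proof -
    have "emeasure N {y} = (\<integral>\<^sup>+u. (\<integral>\<^sup>+v. indicator {y} (dot d u v) \<partial>sphere_law d) \<partial>sphere_law d)" by (intro eN) simp
    also have "\<dots> = (\<integral>\<^sup>+u. 0 \<partial>sphere_law d)"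
    proof (rule nn_integral_cong_AE, use AE_sphere_unit[OF d0] in eventually_elim)
      fix u assume "dot d u u = 1"
      have "(\<integral>\<^sup>+v. indicator {y} (dot d u v) \<partial>sphere_law d) = (\<integral>\<^sup>+v. (if dot d u v = y then 1 else 0) \<partial>sphere_law d)"
        by (intro nn_integral_cong) (auto simp: indicator_def)
      then show "(\<integral>\<^sup>+v. indicator {y} (dot d u v) \<partial>sphere_law d) = 0"
        using sphere_linear_atomless[OF d \<open>dot d u u = 1\<close>] by simp
    qed
    finally show ?thesis by (simp add: measure_def)
  qed
  then obtain e where e: "e > 0" "\<And>y. measure N {y - e..y + e} \<le> \<kappa>"
    using atomless_uniformly_small[OF N _ \<kappa>] by blast
  show ?thesis
  proof (intro exI[of _ "e * sqrt d"] conjI allI)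
    show "e * sqrt d > 0" using e d0 by simp
    fix y
    have "emeasure (sphere_law d) (slab d u y (e * sqrt d / sqrt d)) =
        (\<integral>\<^sup>+v. indicator {y - e..y + e} (dot d u v) \<partial>sphere_law d)" for u
    proof -
      have "(slab d u y (e * sqrt d / sqrt d)) \<in> sets (sphere_law d)"
        unfolding sets_sphere_law by measurable
      then have "emeasure (sphere_law d) (slab d u y (e * sqrt d / sqrt d)) =
        (\<integral>\<^sup>+v. indicator (slab d u y (e * sqrt d / sqrt d)) v \<partial>sphere_law d)"
        by (rule nn_integral_indicator[symmetric])
      also have "\<dots> = (\<integral>\<^sup>+v. indicator {y - e..y + e} (dot d u v) \<partial>sphere_law d)"
        using d0 by (intro nn_integral_cong) (auto simp: indicator_def space_sphere_law abs_le_iff)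
      finally show ?thesis .
    qed
    then have "(\<integral>\<^sup>+u. emeasure (sphere_law d) (slab d u y (e * sqrt d / sqrt d)) \<partial>sphere_law d) = emeasure N {y - e..y + e}"
      by (simp only: eN[of "{y - e..y + e}"] atLeastAtMost_borel)
    also have "\<dots> \<le> ennreal \<kappa>" using e(2)[of y] by (simp add: N.emeasure_eq_measure ennreal_leI)
    finally show "(\<integral>\<^sup>+u. emeasure (sphere_law d) (slab d u y (e * sqrt d / sqrt d)) \<partial>sphere_law d) \<le> ennreal \<kappa>" .
  qed
qed

lemma sphere_pair_small_ball:
  assumes \<kappa>: "\<kappa> > 0"
  obtains e where "e > 0" "\<And>d y. d \<ge> 2 \<Longrightarrow>
    (\<integral>\<^sup>+u. emeasure (sphere_law d) (slab d u y (e / sqrt d)) \<partial>sphere_law d) \<le> ennreal \<kappa>"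
proof -
  define Q where "Q d e \<longleftrightarrow> (\<forall>y. (\<integral>\<^sup>+u. emeasure (sphere_law d) (slab d u y (e / sqrt d)) \<partial>sphere_law d) \<le> ennreal \<kappa>)" for d e
  have anti: "Q d e'" if "Q d e" "0 < e'" "e' \<le> e" for d e e'
    unfolding Q_def
  proof
    fix y
    have "(\<integral>\<^sup>+u. emeasure (sphere_law d) (slab d u y (e' / sqrt d)) \<partial>sphere_law d) \<le>
      (\<integral>\<^sup>+u. emeasure (sphere_law d) (slab d u y (e / sqrt d)) \<partial>sphere_law d)"
    proof (intro nn_integral_mono emeasure_mono)
      fix u
      show "(slab d u y (e' / sqrt d)) \<subseteq> (slab d u y (e / sqrt d))"
        using that divide_right_mono[of e' e "sqrt d"] by (auto intro: order_trans)
    qed (unfold sets_sphere_law, measurable)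
    also have "\<dots> \<le> ennreal \<kappa>" using that by (simp add: Q_def)
    finally show "(\<integral>\<^sup>+u. emeasure (sphere_law d) (slab d u y (e' / sqrt d)) \<partial>sphere_law d) \<le> ennreal \<kappa>" .
  qed
  \<comment> \<open>The three terms of the bound in high dimension get \<open>\<kappa> / 3\<close> each.\<close>
  obtain B where B: "B > 0" "4 * exp (1 / 2 - B) \<le> \<kappa> / 3"
  proof
    define B where "B = max 1 (1 / 2 - ln (\<kappa> / 12))"
    show "B > 0" by (simp add: B_def)
    have "1 / 2 - ln (\<kappa> / 12) \<le> B" unfolding B_def by (rule max.cobounded2)
    then have "1 / 2 - B \<le> ln (\<kappa> / 12)" by argo
    then have "exp (1 / 2 - B) \<le> exp (ln (\<kappa> / 12))" by (simp only: exp_le_cancel_iff)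
    then show "4 * exp (1 / 2 - B) \<le> \<kappa> / 3" using \<kappa> by simp
  qed
  define e1 where "e1 = \<kappa> / 12"
  have e1: "e1 > 0" using \<kappa> by (simp add: e1_def)
  define d1 where "d1 = max 576 (nat \<lceil>(288 * B / \<kappa>)\<^sup>2\<rceil>)"
  have large: "Q d e1" if "d \<ge> d1" for d
    unfolding Q_def
  proof
    fix y
    have d: "d \<ge> 576" "d > 0" using that by (auto simp: d1_def)
    have "(288 * B / \<kappa>)\<^sup>2 \<le> real d" using that unfolding d1_def by linarith
    then have "288 * B / \<kappa> \<le> sqrt d" by (rule real_le_rsqrt)
    then have small: "4 * (24 * B / sqrt d) \<le> \<kappa> / 3" using \<kappa> d by (simp add: field_simps)
    have "(\<integral>\<^sup>+u. emeasure (sphere_law d) (slab d u y (e1 / sqrt d)) \<partial>sphere_law d) \<le> (\<integral>\<^sup>+u. ennreal \<kappa> \<partial>sphere_law d)"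
    proof (rule nn_integral_mono_AE, use AE_sphere_unit[OF d(2)] in eventually_elim)
      fix u assume u: "dot d u u = 1"
      have "emeasure (sphere_law d) (slab d u y (e1 / sqrt d)) \<le>
          ennreal (4 * exp (1 / 2 - B) + 4 * (e1 + 24 * B / sqrt d))"
        by (intro sphere_linear_small_ball_large_dim d u B e1)
      also have "\<dots> \<le> ennreal \<kappa>" using B small by (intro ennreal_leI) (simp add: e1_def)
      finally show "emeasure (sphere_law d) (slab d u y (e1 / sqrt d)) \<le> ennreal \<kappa>" .
    qed
    also have "\<dots> = ennreal \<kappa>" using prob_space.emeasure_space_1[OF prob_space_sphere_law] by simp
    finally show "(\<integral>\<^sup>+u. emeasure (sphere_law d) (slab d u y (e1 / sqrt d)) \<partial>sphere_law d) \<le> ennreal \<kappa>" .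
  qed
  have "\<exists>e>0. \<forall>d\<ge>2. Q d e"
  proof (rule uniform_over_dimensions[where Q = Q, OF _ e1 large])
    show "\<exists>e>0. Q d e" if "d \<ge> 2" for d
      using sphere_pair_small_ball_fixed_dim[OF that \<kappa>] by (auto simp: Q_def)
  qed (use anti in auto)
  then show ?thesis using that by (auto simp: Q_def)
qed

lemma sphere_pair_affinity:
  assumes \<kappa>: "\<kappa> > 0"
  obtains \<Lambda> where "\<Lambda> > 0" "\<And>d y. d \<ge> 2 \<Longrightarrow>
    (\<integral>\<^sup>+u. (\<integral>\<^sup>+v. ennreal (bump (\<Lambda> * real d) y (dot d u v)) \<partial>sphere_law d) \<partial>sphere_law d) \<le> ennreal \<kappa>"
proof -
  obtain e where e: "e > 0" "\<And>d y. d \<ge> 2 \<Longrightarrow>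
    (\<integral>\<^sup>+u. emeasure (sphere_law d) (slab d u y (e / sqrt d)) \<partial>sphere_law d) \<le> ennreal (\<kappa> / 2)"
    using sphere_pair_small_ball[of "\<kappa> / 2"] \<kappa> by auto
  define \<Lambda> where "\<Lambda> = max 1 (- ln (\<kappa> / 2)) / e\<^sup>2"
  have \<Lambda>: "\<Lambda> > 0" using e by (simp add: \<Lambda>_def)
  have small: "exp (- (\<Lambda> * e\<^sup>2)) \<le> \<kappa> / 2"
  proof -
    have "- ln (\<kappa> / 2) \<le> \<Lambda> * e\<^sup>2" using e by (simp add: \<Lambda>_def)
    then have "exp (- (\<Lambda> * e\<^sup>2)) \<le> exp (ln (\<kappa> / 2))" by simp
    then show ?thesis using \<kappa> by simp
  qed
  show ?thesis
  proof
    show "\<Lambda> > 0" by fact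
    fix d :: nat and y assume d: "d \<ge> 2"
    interpret S: prob_space "sphere_law d" by (rule prob_space_sphere_law)
    note [measurable_cong] = sets_sphere_law
    let ?A = "\<lambda>u. (slab d u y (e / sqrt d))"
    have A [measurable]: "?A u \<in> sets (sphere_law d)" for u unfolding sets_sphere_law by measurable
    have "(\<integral>\<^sup>+u. (\<integral>\<^sup>+v. ennreal (bump (\<Lambda> * real d) y (dot d u v)) \<partial>sphere_law d) \<partial>sphere_law d) \<le>
      (\<integral>\<^sup>+u. (\<integral>\<^sup>+v. indicator (?A u) v + ennreal (\<kappa> / 2) \<partial>sphere_law d) \<partial>sphere_law d)"
    proof (intro nn_integral_mono)
      fix u v assume v: "v \<in> space (sphere_law d)"
      show "ennreal (bump (\<Lambda> * real d) y (dot d u v)) \<le> indicator (?A u) v + ennreal (\<kappa> / 2)"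
      proof (cases "v \<in> ?A u")
        case True
        have "ennreal (bump (\<Lambda> * real d) y (dot d u v)) \<le> 1" using \<Lambda> by (simp add: bump_le_1)
        also have "\<dots> \<le> 1 + ennreal (\<kappa> / 2)" by simp
        finally show ?thesis using True by simp
      next
        case False
        then have "e / sqrt d \<le> \<bar>dot d u v - y\<bar>" using v by (auto simp: space_sphere_law)
        then have "(e / sqrt d)\<^sup>2 \<le> \<bar>dot d u v - y\<bar>\<^sup>2" using e by (intro power_mono) auto
        then have "\<Lambda> * real d * (e / sqrt d)\<^sup>2 \<le> \<Lambda> * real d * (dot d u v - y)\<^sup>2" using \<Lambda> by (intro mult_left_mono) auto
        moreover have "\<Lambda> * real d * (e / sqrt d)\<^sup>2 = \<Lambda> * e\<^sup>2" using d by (simp add: power_divide)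
        ultimately have "bump (\<Lambda> * real d) y (dot d u v) \<le> exp (- (\<Lambda> * e\<^sup>2))" by (simp add: bump_def)
        then have "bump (\<Lambda> * real d) y (dot d u v) \<le> \<kappa> / 2" using small by simp
        then show ?thesis using False by (simp add: ennreal_leI)
      qed
    qed
    also have "\<dots> = (\<integral>\<^sup>+u. emeasure (sphere_law d) (?A u) + ennreal (\<kappa> / 2) \<partial>sphere_law d)"
      by (intro nn_integral_cong) (simp add: nn_integral_add S.emeasure_space_1)
    also have "\<dots> = (\<integral>\<^sup>+u. emeasure (sphere_law d) (?A u) \<partial>sphere_law d) + ennreal (\<kappa> / 2)"
      by (subst nn_integral_add) (auto simp: S.emeasure_space_1 measurable_sphere_pair_event)
    also have "\<dots> \<le> ennreal (\<kappa> / 2) + ennreal (\<kappa> / 2)" by (intro add_right_mono e d)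
    also have "\<dots> = ennreal \<kappa>" using \<kappa> by (subst ennreal_plus[symmetric]) auto
    finally show "(\<integral>\<^sup>+u. (\<integral>\<^sup>+v. ennreal (bump (\<Lambda> * real d) y (dot d u v)) \<partial>sphere_law d) \<partial>sphere_law d) \<le> ennreal \<kappa>" .
  qed
qed

section \<open>The small ball estimate for the Gram matrix\<close>

text \<open>Blocks of a single row: since \<open>min(n,d)\<close> is bounded, a gain of \<open>exp (- L)\<close> per pair of rows is enough.\<close>
lemma sphere_loss_ball_small:
  assumes K: "K > 0"
  obtains \<tau> where "\<tau> > 0" "\<And>n d Y. n \<ge> 2 \<Longrightarrow> d \<ge> 2 \<Longrightarrow> min n d \<le> 576 \<Longrightarrow>
    emeasure (\<Pi>\<^sub>M i\<in>{..<n}. sphere_law d) (loss_ball n d Y \<tau>) \<le> ennreal (exp (- K * real n * real (min n d)))"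
proof -
  \<comment> \<open>\<open>2304 = 4 * 576\<close>: then \<open>L n / 4 - 9 n = 576 K n\<close>, the largest exponent that \<open>min n d \<le> 576\<close> requires.\<close>
  define L where "L = 36 + 2304 * K"
  have L: "L > 0" using K by (simp add: L_def)
  obtain \<Lambda> where \<Lambda>: "\<Lambda> > 0" "\<And>d y. d \<ge> 2 \<Longrightarrow>
    (\<integral>\<^sup>+u. (\<integral>\<^sup>+v. ennreal (bump (\<Lambda> * real d) y (dot d u v)) \<partial>sphere_law d) \<partial>sphere_law d) \<le> ennreal (exp (- L))"
    using sphere_pair_affinity[of "exp (- L)"] by auto
  show ?thesis
  proof
    show "1 / \<Lambda> > 0" using \<Lambda> by simp
    fix n d :: nat and Y assume n: "n \<ge> 2" and d: "d \<ge> 2" and m: "min n d \<le> 576"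
    have d0: "d > 0" using d by simp
    interpret S: prob_space "sphere_law d" by (rule prob_space_sphere_law)
    interpret PS: product_sigma_finite "\<lambda>_::nat. sphere_law d" by standard
    note [measurable_cong] = sets_sphere_law
    have "emeasure (\<Pi>\<^sub>M i\<in>{..<n}. sphere_law d) (loss_ball n d Y (1 / \<Lambda>)) \<le> ennreal (exp (9 * real 1 * real n - L * real 1 * real n / 4))"
    proof (rule loss_ball_of_blocks[OF prob_space_sphere_law sets_sphere_law d0])
      fix I J :: "nat set" assume IJ: "finite I" "finite J" "I \<inter> J = {}" "card I = 1" "card J = 1"
      then obtain i j where ij: "I = {i}" "J = {j}" by (auto simp: card_1_singleton_iff)
      have "(\<integral>\<^sup>+z. (affinity d (\<Lambda> * real d) I J Y z) \<partial>(rows (I \<union> J) (sphere_law d))) =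
        (\<integral>\<^sup>+x. (\<Prod>j\<in>J. row_affinity (sphere_law d) d (\<Lambda> * real d) I (\<lambda>i. Y i j) x) \<partial>(rows I (sphere_law d)))"
        by (rule block_fold[OF prob_space_sphere_law sets_sphere_law IJ(1-3)])
      also have "\<dots> = (\<integral>\<^sup>+x. (\<integral>\<^sup>+v. ennreal (bump (\<Lambda> * real d) (Y i j) (dot d (x i) v)) \<partial>sphere_law d) \<partial>(rows {i} (sphere_law d)))"
        unfolding ij by (simp add: row_affinity_def)
      also have "\<dots> = (\<integral>\<^sup>+u. (\<integral>\<^sup>+v. ennreal (bump (\<Lambda> * real d) (Y i j) (dot d u v)) \<partial>sphere_law d) \<partial>sphere_law d)"
        by (rule PS.product_nn_integral_singleton) measurable
      also have "\<dots> \<le> ennreal (exp (- L))" by (rule \<Lambda>(2)[OF d])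
      finally show "(\<integral>\<^sup>+z. (affinity d (\<Lambda> * real d) I J Y z) \<partial>(rows (I \<union> J) (sphere_law d))) \<le> ennreal (exp (- L * (real 1)\<^sup>2))"
        by simp
    qed (use n \<Lambda> L in auto)
    also have "\<dots> \<le> ennreal (exp (- K * real n * real (min n d)))"
    proof (intro ennreal_leI)
      have "K * real n * real (min n d) \<le> K * real n * 576" using m K by (intro mult_left_mono) auto
      then show "exp (9 * real 1 * real n - L * real 1 * real n / 4) \<le> exp (- K * real n * real (min n d))"
        by (simp add: L_def algebra_simps)
    qed
    finally show "emeasure (\<Pi>\<^sub>M i\<in>{..<n}. sphere_law d) (loss_ball n d Y (1 / \<Lambda>)) \<le> ennreal (exp (- K * real n * real (min n d)))" .
  qed
qed

lemma sets_loss_ball: "loss_ball n d Y \<tau> \<in> sets (\<Pi>\<^sub>M i\<in>{..<n}. vec_space d)"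
  unfolding loss_ball_def loss_eq gram_eq_dot by measurable

lemma emeasure_loss_ball_mono:
  assumes "sets \<mu> = sets (vec_space d)" "\<tau> \<le> \<tau>'"
  shows "emeasure (\<Pi>\<^sub>M i\<in>{..<n}. \<mu>) (loss_ball n d Y \<tau>) \<le> emeasure (\<Pi>\<^sub>M i\<in>{..<n}. \<mu>) (loss_ball n d Y \<tau>')"
  using assms by (intro emeasure_mono) (auto simp: loss_ball_def sets_PiM_law[OF assms(1)] sets_loss_ball[unfolded loss_ball_def])

lemma gaussian_loss_ball_single_row:
  assumes K: "K > 0"
  obtains \<tau> where "\<tau> > 0" "\<And>d Y. d > 0 \<Longrightarrow>
    emeasure (\<Pi>\<^sub>M i\<in>{..<Suc 0}. gaussian_law d) (loss_ball (Suc 0) d Y \<tau>) \<le> ennreal (exp (- K))"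
proof -
  obtain e where e: "e > 0" "\<And>d y. d > 0 \<Longrightarrow>
    emeasure (gaussian_law d) (norm_shell d y (e / sqrt d)) \<le> ennreal (exp (- K))"
    using gaussian_norm_small_ball[of "exp (- K)"] by auto
  show ?thesis
  proof
    show "e\<^sup>2 / 2 > 0" using e by simp
    fix d :: nat and Y :: "nat \<Rightarrow> nat \<Rightarrow> real" assume d: "d > 0"
    interpret G: prob_space "gaussian_law d" using d by (rule prob_space_gaussian_law)
    interpret PG: product_sigma_finite "\<lambda>_::nat. gaussian_law d" by standard
    note [measurable_cong] = sets_gaussian_law sets_PiM_law[OF sets_gaussian_law]
    let ?B = "{h \<in> space (vec_space d). \<bar>dot d h h - Y 0 0\<bar> \<le> e / sqrt d}"
    have B [measurable]: "?B \<in> sets (gaussian_law d)" unfolding sets_gaussian_law by measurable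
    have "emeasure (\<Pi>\<^sub>M i\<in>{..<Suc 0}. gaussian_law d) (loss_ball (Suc 0) d Y (e\<^sup>2 / 2)) \<le>
        (\<integral>\<^sup>+z. indicator ?B (z 0) \<partial>(\<Pi>\<^sub>M i\<in>{..<Suc 0}. gaussian_law d))"
    proof (rule emeasure_le_nn_integral)
      show "loss_ball (Suc 0) d Y (e\<^sup>2 / 2) \<in> sets (\<Pi>\<^sub>M i\<in>{..<Suc 0}. gaussian_law d)"
        unfolding sets_PiM_law[OF sets_gaussian_law] by (rule sets_loss_ball)
      fix z assume z: "z \<in> loss_ball (Suc 0) d Y (e\<^sup>2 / 2)"
      then have "(dot d (z 0) (z 0) - Y 0 0)\<^sup>2 \<le> e\<^sup>2 / d"
        using d by (simp add: loss_ball_eq)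
      also have "\<dots> = (e / sqrt d)\<^sup>2" by (simp add: power_divide)
      finally have "\<bar>dot d (z 0) (z 0) - Y 0 0\<bar> \<le> \<bar>e / sqrt d\<bar>" by (simp only: abs_le_square_iff)
      moreover have "z 0 \<in> space (vec_space d)" using z by (auto simp: loss_ball_def space_PiM)
      ultimately show "1 \<le> (indicator ?B (z 0) :: ennreal)" using e by (simp add: indicator_def)
    qed
    also have "\<dots> = (\<integral>\<^sup>+h. indicator ?B h \<partial>gaussian_law d)"
      unfolding lessThan_Suc lessThan_0 by (rule PG.product_nn_integral_singleton) measurable
    also have "\<dots> = emeasure (gaussian_law d) ?B" by (rule nn_integral_indicator) measurable
    also have "\<dots> \<le> ennreal (exp (- K))" by (rule e(2)[OF d])
    finally show "emeasure (\<Pi>\<^sub>M i\<in>{..<Suc 0}. gaussian_law d) (loss_ball (Suc 0) d Y (e\<^sup>2 / 2)) \<le> ennreal (exp (- K))" .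
  qed
qed

definition row_law :: "nat \<Rightarrow> nat \<Rightarrow> (nat \<Rightarrow> real) measure \<Rightarrow> bool" where
  "row_law n d \<mu> \<longleftrightarrow> n > 0 \<and> d > 0 \<and> (\<mu> = gaussian_law d \<or> n \<ge> 2 \<and> d \<ge> 2 \<and> \<mu> = sphere_law d)"

lemma row_law_sets: "row_law n d \<mu> \<Longrightarrow> sets \<mu> = sets (vec_space d)"
  by (auto simp: row_law_def sets_gaussian_law sets_sphere_law simp del: sets_PiM_cong)

text \<open>Four cases: Gaussian rows with \<open>n \<ge> 2\<close> and with \<open>n = 1\<close>, spherical rows with both \<open>n\<close> and \<open>d\<close> large, and
  spherical rows with \<open>min(n,d)\<close> bounded.\<close>
theorem gram_loss_ball:
  assumes K: "K > 0"
  obtains \<tau> where "\<tau> > 0" "\<And>n d \<mu> Y. row_law n d \<mu> \<Longrightarrow>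
    emeasure (\<Pi>\<^sub>M i\<in>{..<n}. \<mu>) (loss_ball n d Y \<tau>) \<le> ennreal (exp (- K * real n * real (min n d)))"
proof -
  obtain t1 where t1: "t1 > 0" "\<And>n d Y. n \<ge> 2 \<Longrightarrow> d > 0 \<Longrightarrow>
    emeasure (\<Pi>\<^sub>M i\<in>{..<n}. gaussian_law d) (loss_ball n d Y t1) \<le> ennreal (exp (- K * real n * real (min n d)))"
    using gaussian_loss_ball[OF K] by blast
  obtain t2 where t2: "t2 > 0" "\<And>d Y. d > 0 \<Longrightarrow>
    emeasure (\<Pi>\<^sub>M i\<in>{..<Suc 0}. gaussian_law d) (loss_ball (Suc 0) d Y t2) \<le> ennreal (exp (- K))"
    using gaussian_loss_ball_single_row[OF K] by blast
  obtain t3 where t3: "t3 > 0" "\<And>n d Y. n \<ge> 8 \<Longrightarrow> d \<ge> 576 \<Longrightarrow>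
    emeasure (\<Pi>\<^sub>M i\<in>{..<n}. sphere_law d) (loss_ball n d Y t3) \<le> ennreal (exp (- K * real n * real (min n d)))"
    using sphere_loss_ball_large[OF K] by blast
  obtain t4 where t4: "t4 > 0" "\<And>n d Y. n \<ge> 2 \<Longrightarrow> d \<ge> 2 \<Longrightarrow> min n d \<le> 576 \<Longrightarrow>
    emeasure (\<Pi>\<^sub>M i\<in>{..<n}. sphere_law d) (loss_ball n d Y t4) \<le> ennreal (exp (- K * real n * real (min n d)))"
    using sphere_loss_ball_small[OF K] by blast
  define \<tau> where "\<tau> = min (min t1 t2) (min t3 t4)"
  have le: "\<tau> \<le> t1" "\<tau> \<le> t2" "\<tau> \<le> t3" "\<tau> \<le> t4" by (auto simp: \<tau>_def)
  show ?thesis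
  proof
    show "\<tau> > 0" using t1 t2 t3 t4 by (simp add: \<tau>_def)
    fix n d \<mu> Y assume law: "row_law n d \<mu>"
    note mono = order_trans[OF emeasure_loss_ball_mono[OF row_law_sets[OF law]]]
    consider "\<mu> = gaussian_law d" "d > 0" "n = Suc 0" | "\<mu> = gaussian_law d" "d > 0" "n \<ge> 2"
      | "\<mu> = sphere_law d" "n \<ge> 8" "d \<ge> 576" | "\<mu> = sphere_law d" "n \<ge> 2" "d \<ge> 2" "min n d \<le> 576"
    proof -
      have "n = Suc 0 \<or> n \<ge> 2" "n \<ge> 8 \<and> d \<ge> 576 \<or> min n d \<le> 576" using law by (auto simp: row_law_def)
      then show ?thesis using law that unfolding row_law_def by blast
    qed
    then show "emeasure (\<Pi>\<^sub>M i\<in>{..<n}. \<mu>) (loss_ball n d Y \<tau>) \<le> ennreal (exp (- K * real n * real (min n d)))"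
    proof cases
      case 1
      then have "min n d = 1" by simp
      then show ?thesis using mono[OF le(2)] t2(2)[of d Y] 1 by simp
    next
      case 2
      then show ?thesis using mono[OF le(1)] t1(2)[of n d Y] by simp
    next
      case 3
      then show ?thesis using mono[OF le(3)] t3(2)[of n d Y] by simp
    next
      case 4
      then show ?thesis using mono[OF le(4)] t4(2)[of n d Y] by simp
    qed
  qed
qed

section \<open>Counting observation patterns\<close>

definition num_observed :: "nat \<Rightarrow> (nat \<times> nat \<Rightarrow> bool option) \<Rightarrow> nat" where
  "num_observed n a = card {x \<in> {..<n} \<times> {..<n}. a x \<noteq> None}"

definition patterns :: "nat \<Rightarrow> (nat \<times> nat \<Rightarrow> bool option) set" where
  "patterns n = (\<Pi>\<^sub>E x\<in>{..<n} \<times> {..<n}. UNIV)"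

text \<open>The bound \<open>m\<close> is real, since it will be \<open>4 n\<^sup>2 p\<close>.\<close>
definition sparse_patterns :: "nat \<Rightarrow> real \<Rightarrow> (nat \<times> nat \<Rightarrow> bool option) set" where
  "sparse_patterns n m = {a \<in> patterns n. real (num_observed n a) \<le> m}"

lemma finite_patterns: "finite (patterns n)"
  unfolding patterns_def by (intro finite_PiE) auto

lemma card_patterns: "real (card (patterns n)) \<le> exp (2 * (real n)\<^sup>2)"
proof -
  have "card (UNIV :: bool option set) = 3" by (simp add: UNIV_option_conv card_image)
  then have "card (patterns n) = 3 ^ (n * n)" unfolding patterns_def by (simp add: card_PiE card_cartesian_product)
  then have "real (card (patterns n)) = 3 ^ (n * n)" by simp
  also have "\<dots> \<le> exp 2 ^ (n * n)" using exp_ge_add_one_self[of 2] by (intro power_mono) auto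
  also have "\<dots> = exp (2 * (real n)\<^sup>2)"
    using exp_of_nat_mult[of "n * n" "2::real"] by (simp add: power2_eq_square mult.commute)
  finally show ?thesis .
qed

text \<open>A pattern with at most \<open>m\<close> observed entries has weight at least \<open>p powr m\<close> when every observed entry weighs \<open>p\<close>; the total weight of
  all patterns is a product over the entries, each with one unobserved and two observed values.\<close>
lemma card_sparse_patterns_le:
  assumes p: "0 < p" "p < 1"
  shows "real (card (sparse_patterns n m)) \<le> p powr (- m) * (1 + 2 * p) ^ (n * n)"
proof -
  let ?I = "{..<n} \<times> {..<n}"
  have w: "(\<Prod>x\<in>?I. if a x = None then 1 else p) = p powr real (num_observed n a)" for a :: "nat \<times> nat \<Rightarrow> bool option"
  proof -
    have "(\<Prod>x\<in>?I. if a x = None then 1 else p) = (\<Prod>x\<in>?I. if a x \<noteq> None then p else 1)" by (intro prod.cong) auto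
    also have "\<dots> = p ^ card {x \<in> ?I. a x \<noteq> None}" by (subst prod.inter_filter[symmetric]) auto
    finally show ?thesis using p by (simp add: num_observed_def powr_realpow)
  qed
  have "real (card (sparse_patterns n m)) = (\<Sum>a\<in>sparse_patterns n m. 1)" by simp
  also have "\<dots> \<le> (\<Sum>a\<in>sparse_patterns n m. p powr (- m) * (\<Prod>x\<in>?I. if a x = None then 1 else p))"
  proof (intro sum_mono)
    fix a assume "a \<in> sparse_patterns n m"
    then have "real (num_observed n a) - m \<le> 0" by (simp add: sparse_patterns_def)
    then have "p powr 0 \<le> p powr (real (num_observed n a) - m)" using p by (intro powr_mono') auto
    also have "\<dots> = p powr (- m) * p powr real (num_observed n a)" by (simp add: powr_add[symmetric])
    finally show "1 \<le> p powr (- m) * (\<Prod>x\<in>?I. if a x = None then 1 else p)" using p by (simp add: w)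
  qed
  also have "\<dots> \<le> (\<Sum>a\<in>patterns n. p powr (- m) * (\<Prod>x\<in>?I. if a x = None then 1 else p))"
    using p by (intro sum_mono2 finite_patterns) (auto simp: sparse_patterns_def intro!: mult_nonneg_nonneg prod_nonneg)
  also have "\<dots> = p powr (- m) * (\<Sum>a\<in>patterns n. \<Prod>x\<in>?I. if a x = None then 1 else p)"
    by (simp only: sum_distrib_left)
  also have "(\<Sum>a\<in>patterns n. \<Prod>x\<in>?I. if a x = None then 1 else p) = (\<Prod>x\<in>?I. \<Sum>b\<in>UNIV. if b = (None :: bool option) then 1 else p)"
    unfolding patterns_def by (rule prod_sum_PiE[of ?I "\<lambda>_. UNIV" "\<lambda>x b. if b = None then 1 else p", symmetric]) auto
  also have "(\<Sum>b\<in>UNIV. if b = (None :: bool option) then 1 else p) = 1 + 2 * p"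
    by (simp add: UNIV_option_conv UNIV_bool)
  finally show ?thesis by (simp add: card_cartesian_product)
qed

lemma binary_entropy_ge:
  assumes "0 < p" "p < 1"
  shows "- p * ln p \<le> binary_entropy p"
proof -
  have "(1 - p) * ln (1 - p) \<le> 0" using assms by (intro mult_nonneg_nonpos) auto
  then show ?thesis by (simp add: binary_entropy_def)
qed

lemma card_sparse_patterns_entropy:
  assumes p: "0 < p" "p < 1"
  shows "real (card (sparse_patterns n (4 * (real n)\<^sup>2 * p))) \<le> exp (4 * (real n)\<^sup>2 * (binary_entropy p + p))"
proof -
  let ?m = "4 * (real n)\<^sup>2 * p"
  have "(1 + 2 * p) ^ (n * n) \<le> exp (2 * p) ^ (n * n)" using p by (intro power_mono exp_ge_add_one_self) auto
  also have "\<dots> = exp (2 * (real n)\<^sup>2 * p)"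
  proof -
    have "exp (real (n * n) * (2 * p)) = exp (2 * p) ^ (n * n)" by (rule exp_of_nat_mult)
    moreover have "real (n * n) * (2 * p) = 2 * (real n)\<^sup>2 * p" by (simp add: power2_eq_square)
    ultimately show ?thesis by (simp only:)
  qed
  finally have 1: "(1 + 2 * p) ^ (n * n) \<le> exp (2 * (real n)\<^sup>2 * p)" .
  have "real (card (sparse_patterns n ?m)) \<le> p powr (- ?m) * (1 + 2 * p) ^ (n * n)"
    by (rule card_sparse_patterns_le[OF p])
  also have "\<dots> \<le> p powr (- ?m) * exp (2 * (real n)\<^sup>2 * p)" by (intro mult_left_mono 1) auto
  also have "p powr (- ?m) = exp (4 * (real n)\<^sup>2 * (- p * ln p))"
  proof -
    have "- ?m * ln p = 4 * (real n)\<^sup>2 * (- p * ln p)" by simp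
    then show ?thesis using p by (simp only: powr_def) simp
  qed
  also have "\<dots> * exp (2 * (real n)\<^sup>2 * p) = exp (4 * (real n)\<^sup>2 * (- p * ln p) + 2 * (real n)\<^sup>2 * p)"
    by (rule mult_exp_exp)
  also have "\<dots> \<le> exp (4 * (real n)\<^sup>2 * (binary_entropy p + p))"
  proof -
    have "4 * (real n)\<^sup>2 * (- p * ln p) \<le> 4 * (real n)\<^sup>2 * binary_entropy p"
      using binary_entropy_ge[OF p] by (intro mult_left_mono) auto
    moreover have "2 * (real n)\<^sup>2 * p \<le> 4 * (real n)\<^sup>2 * p" using p by (intro mult_right_mono) auto
    ultimately show ?thesis by (simp only: exp_le_cancel_iff distrib_left)
  qed
  finally show ?thesis .
qed

text \<open>The entropy bound gives the factor \<open>d\<close>, by the dimension hypothesis, and the bound by the number of all patterns gives the factor \<open>n\<close>.\<close>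
lemma card_sparse_patterns_bound:
  assumes p: "0 < p" "p < 1" and c: "c > 0" and d: "real d \<ge> c * real n * (binary_entropy p + p)"
  shows "real (card (sparse_patterns n (4 * (real n)\<^sup>2 * p))) \<le> exp (max (4 / c) 2 * real n * real (min n d))"
proof -
  let ?N = "real (card (sparse_patterns n (4 * (real n)\<^sup>2 * p)))"
  have "c * real n * (binary_entropy p + p) * (4 / c * real n) \<le> real d * (4 / c * real n)"
    using d c by (intro mult_right_mono) auto
  then have e1: "4 * (real n)\<^sup>2 * (binary_entropy p + p) \<le> 4 / c * real n * real d"
  proof -
    have "c * real n * (binary_entropy p + p) * (4 / c * real n) = (c * (1 / c)) * (4 * (real n * real n) * (binary_entropy p + p))"
      by simp
    moreover have "real d * (4 / c * real n) = 4 / c * real n * real d" by simp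
    ultimately show ?thesis using c
      \<open>c * real n * (binary_entropy p + p) * (4 / c * real n) \<le> real d * (4 / c * real n)\<close>
      by (simp only: power2_eq_square) simp
  qed
  have n1: "?N \<le> exp (max (4 / c) 2 * real n * real d)"
  proof -
    have "4 / c * (real n * real d) \<le> max (4 / c) 2 * (real n * real d)" by (intro mult_right_mono) auto
    then have "exp (4 * (real n)\<^sup>2 * (binary_entropy p + p)) \<le> exp (max (4 / c) 2 * real n * real d)"
      using e1 by (simp add: mult.assoc)
    with card_sparse_patterns_entropy[OF p, of n] show ?thesis by (rule order_trans)
  qed
  have "?N \<le> real (card (patterns n))"
    unfolding of_nat_le_iff by (intro card_mono finite_patterns) (auto simp: sparse_patterns_def)
  also have "\<dots> \<le> exp (2 * (real n)\<^sup>2)" by (rule card_patterns)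
  also have "\<dots> \<le> exp (max (4 / c) 2 * real n * real n)"
  proof -
    have "2 * (real n * real n) \<le> max (4 / c) 2 * (real n * real n)" by (intro mult_right_mono) auto
    then show ?thesis by (simp add: power2_eq_square mult.assoc)
  qed
  finally show ?thesis using n1 by (cases "n \<le> d") (auto simp: min_def)
qed

section \<open>Estimators as functions of the pattern\<close>

lemma row_law_fourth_moment:
  assumes "row_law n d \<mu>"
  shows "(\<integral>\<^sup>+v. ennreal ((dot d v v)\<^sup>2) \<partial>\<mu>) < \<infinity>"
proof -
  have d: "d > 0" using assms by (simp add: row_law_def)
  have "(\<integral>\<^sup>+v. ennreal ((dot d v v)\<^sup>2) \<partial>sphere_law d) = (\<integral>\<^sup>+v. 1 \<partial>sphere_law d)"
    by (rule nn_integral_cong_AE, use AE_sphere_unit[OF d] in eventually_elim) simp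
  also have "\<dots> < \<infinity>" using prob_space.emeasure_space_1[OF prob_space_sphere_law] by simp
  finally show ?thesis using assms gaussian_fourth_moment_finite[OF d] by (auto simp: row_law_def)
qed

definition observation :: "nat \<Rightarrow> (nat \<Rightarrow> nat \<Rightarrow> 'w \<Rightarrow> bool option) \<Rightarrow> 'w \<Rightarrow> nat \<times> nat \<Rightarrow> bool option" where
  "observation n A \<omega> = (\<lambda>(i, j)\<in>{..<n} \<times> {..<n}. A i j \<omega>)"

lemma obs_algebra_eq:
  "obs_algebra M n A = vimage_algebra (space M) (observation n A) (\<Pi>\<^sub>M ij\<in>{..<n} \<times> {..<n}. count_space UNIV)"
  unfolding obs_algebra_def observation_def ..

lemma observation_in_space:
  "observation n A \<in> space M \<rightarrow> space (\<Pi>\<^sub>M ij\<in>{..<n} \<times> {..<n}. count_space UNIV)"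
  by (auto simp: observation_def space_PiM PiE_def)

lemma observation_pattern: "observation n A \<omega> \<in> patterns n"
  by (auto simp: observation_def patterns_def)

lemma observation_apply: "i < n \<Longrightarrow> j < n \<Longrightarrow> observation n A \<omega> (i, j) = A i j \<omega>"
  by (simp add: observation_def)

lemma obs_algebra_subalgebra:
  assumes "\<And>i j. i < n \<Longrightarrow> j < n \<Longrightarrow> A i j \<in> measurable M (count_space UNIV)"
  shows "subalgebra M (obs_algebra M n A)"
proof -
  have "observation n A \<in> measurable M (\<Pi>\<^sub>M ij\<in>{..<n} \<times> {..<n}. count_space UNIV)"
  proof -
    have "(\<lambda>\<omega>. \<lambda>x\<in>{..<n} \<times> {..<n}. (case x of (i, j) \<Rightarrow> A i j \<omega>)) \<in> measurable M (\<Pi>\<^sub>M ij\<in>{..<n} \<times> {..<n}. count_space UNIV)"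
    proof (rule measurable_restrict)
      fix x assume "x \<in> {..<n} \<times> {..<n}"
      then show "(\<lambda>\<omega>. case x of (i, j) \<Rightarrow> A i j \<omega>) \<in> measurable M (count_space UNIV)"
        using assms by (cases x) auto
    qed
    then show ?thesis by (simp add: observation_def[abs_def])
  qed
  then show ?thesis
    unfolding subalgebra_def obs_algebra_eq
    by (auto simp: sets_vimage_algebra2[OF observation_in_space] dest: measurable_sets)
qed

text \<open>Level sets of \<open>f\<close> are preimages of sets of patterns.\<close>
lemma obs_algebra_measurable_factors:
  fixes f :: "'w \<Rightarrow> real"
  assumes f: "f \<in> borel_measurable (obs_algebra M n A)"
    and w: "\<omega> \<in> space M" "\<omega>' \<in> space M" "observation n A \<omega> = observation n A \<omega>'"
  shows "f \<omega> = f \<omega>'"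
proof -
  have sp: "space (obs_algebra M n A) = space M" by (simp add: obs_algebra_eq)
  have "f -` {f \<omega>} \<inter> space M \<in> sets (obs_algebra M n A)"
    using measurable_sets[OF f, of "{f \<omega>}"] by (simp add: sp)
  then obtain B where B: "f -` {f \<omega>} \<inter> space M = observation n A -` B \<inter> space M"
    unfolding obs_algebra_eq sets_vimage_algebra2[OF observation_in_space] by blast
  have "\<omega> \<in> observation n A -` B \<inter> space M" using w B by blast
  then have "\<omega>' \<in> observation n A -` B \<inter> space M" using w by simp
  then have "\<omega>' \<in> f -` {f \<omega>} \<inter> space M" using B by blast
  then show ?thesis by simp
qed

section \<open>The lower bound for the expected loss\<close>

lemma loss_cong:
  assumes "\<And>i j. i < n \<Longrightarrow> j < n \<Longrightarrow> X i j = X' i j" "\<And>i j. i < n \<Longrightarrow> j < n \<Longrightarrow> Y i j = Y' i j"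
  shows "loss n d X Y = loss n d X' Y'"
  unfolding loss_eq using assms by (intro arg_cong2[where f = "(*)"] refl sum.cong) auto

lemma loss_nonneg: "loss n d X Y \<ge> 0"
  unfolding loss_eq by (intro mult_nonneg_nonneg sum_nonneg) auto

text \<open>Integrability of the loss has to be established because the Bochner integral of a non-integrable function is \<open>0\<close>. The
  estimator is bounded as it takes finitely many values, and the entries of \<open>X\<close> have second moments.\<close>
theorem expected_loss_lower_bound:
  fixes M :: "'w measure"
  assumes c: "c > 0" and \<tau>: "\<tau> > 0"
    and small: "\<And>Y. emeasure (\<Pi>\<^sub>M i\<in>{..<n}. \<mu>) (loss_ball n d Y \<tau>) \<le> ennreal (exp (- (max (4 / c) 2 + 2) * real n * real (min n d)))"
    and law: "row_law n d \<mu>" and p: "0 < p" "p < 1"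
    and M: "prob_space M" and indep: "prob_space.indep_vars M (\<lambda>_. vec_space d) Z {..<n}"
    and distr: "\<And>i. i < n \<Longrightarrow> distr M (vec_space d) (Z i) = \<mu>"
    and A: "\<And>i j. i < n \<Longrightarrow> j < n \<Longrightarrow> A i j \<in> measurable M (count_space UNIV)"
    and P: "\<And>i j. i < n \<Longrightarrow> j < n \<Longrightarrow> measure M {\<omega> \<in> space M. A i j \<omega> \<noteq> None} = P i j"
    and Psum: "(\<Sum>i<n. \<Sum>j<n. P i j) = (real n)\<^sup>2 * p"
    and dim: "real d \<ge> c * real n * (binary_entropy p + p)"
    and Xhat: "\<And>i j. i < n \<Longrightarrow> j < n \<Longrightarrow> (\<lambda>\<omega>. Xhat \<omega> i j) \<in> borel_measurable (obs_algebra M n A)"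
  shows "prob_space.expectation M (\<lambda>\<omega>. loss n d (gram d (\<lambda>i. Z i \<omega>)) (Xhat \<omega>)) \<ge> \<tau> / 2"
proof -
  interpret prob_space M by fact
  have nd: "n > 0" "d > 0" using law by (auto simp: row_law_def)
  let ?K = "max (4 / c) 2"
  have Zm: "Z i \<in> measurable M (vec_space d)" if "i < n" for i
    using indep that by (auto simp: indep_vars_def)
  have Xm: "(\<lambda>\<omega>. Xhat \<omega> i j) \<in> borel_measurable M" if "i < n" "j < n" for i j
    by (rule measurable_from_subalg[OF obs_algebra_subalgebra[OF A] Xhat]) (use that in auto)
  define err where "err \<omega> = loss n d (gram d (\<lambda>i. Z i \<omega>)) (Xhat \<omega>)" for \<omega>
  have term_meas: "(\<lambda>\<omega>. (dot d (Z i \<omega>) (Z j \<omega>) - Xhat \<omega> i j)\<^sup>2) \<in> borel_measurable M" if "i < n" "j < n" for i j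
    using Zm[OF that(1)] Zm[OF that(2)] Xm[OF that] by measurable
  have err_meas [measurable]: "err \<in> borel_measurable M"
    unfolding err_def loss_eq gram_eq_dot by (intro borel_measurable_times borel_measurable_const borel_measurable_sum term_meas) auto

  \<comment> \<open>\<open>Y a\<close> is the value of the estimator for the pattern \<open>a\<close>; for patterns that do not occur it is arbitrary.\<close>
  define Y where "Y a i j = Xhat (SOME \<omega>. \<omega> \<in> space M \<and> observation n A \<omega> = a) i j" for a i j
  have Y: "Xhat \<omega> i j = Y (observation n A \<omega>) i j" if "\<omega> \<in> space M" "i < n" "j < n" for \<omega> i j
  proof -
    define \<omega>' where "\<omega>' = (SOME \<omega>'. \<omega>' \<in> space M \<and> observation n A \<omega>' = observation n A \<omega>)"
    have "\<omega>' \<in> space M \<and> observation n A \<omega>' = observation n A \<omega>"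
      unfolding \<omega>'_def by (rule someI[of _ \<omega>]) (use that in auto)
    then show ?thesis
      using obs_algebra_measurable_factors[OF Xhat[OF that(2,3)] that(1), of \<omega>'] unfolding Y_def \<omega>'_def[symmetric] by metis
  qed
  define C where "C = (\<Sum>a\<in>patterns n. \<Sum>i<n. \<Sum>j<n. \<bar>Y a i j\<bar>)"
  have XC: "\<bar>Xhat \<omega> i j\<bar> \<le> C" if w: "\<omega> \<in> space M" and ij: "i < n" "j < n" for \<omega> i j
  proof -
    let ?a = "observation n A \<omega>"
    have "\<bar>Xhat \<omega> i j\<bar> = \<bar>Y ?a i j\<bar>" using Y[OF that] by simp
    also have "\<dots> \<le> (\<Sum>j<n. \<bar>Y ?a i j\<bar>)" using ij by (intro member_le_sum) auto
    also have "\<dots> \<le> (\<Sum>i<n. \<Sum>j<n. \<bar>Y ?a i j\<bar>)" using ij by (intro member_le_sum[of i "{..<n}" "\<lambda>i. \<Sum>j<n. \<bar>Y ?a i j\<bar>"]) (auto intro: sum_nonneg)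
    also have "\<dots> \<le> C" unfolding C_def
      by (intro member_le_sum[of ?a "patterns n" "\<lambda>a. \<Sum>i<n. \<Sum>j<n. \<bar>Y a i j\<bar>"] observation_pattern finite_patterns) (auto intro!: sum_nonneg)
    finally show ?thesis .
  qed

  have R_int: "integrable M (\<lambda>\<omega>. (dot d (Z i \<omega>) (Z i \<omega>))\<^sup>2)" if "i < n" for i
  proof (rule integrableI_bounded)
    show "(\<lambda>\<omega>. (dot d (Z i \<omega>) (Z i \<omega>))\<^sup>2) \<in> borel_measurable M" using Zm[OF that] by measurable
    have "(\<integral>\<^sup>+\<omega>. ennreal ((dot d (Z i \<omega>) (Z i \<omega>))\<^sup>2) \<partial>M) = (\<integral>\<^sup>+v. ennreal ((dot d v v)\<^sup>2) \<partial>distr M (vec_space d) (Z i))"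
      by (rule nn_integral_distr[symmetric, OF Zm[OF that]]) measurable
    also have "\<dots> < \<infinity>" unfolding distr[OF that] by (rule row_law_fourth_moment[OF law])
    finally show "(\<integral>\<^sup>+\<omega>. ennreal (norm ((dot d (Z i \<omega>) (Z i \<omega>))\<^sup>2)) \<partial>M) < \<infinity>" by simp
  qed
  have term_int: "integrable M (\<lambda>\<omega>. (dot d (Z i \<omega>) (Z j \<omega>) - Xhat \<omega> i j)\<^sup>2)" if ij: "i < n" "j < n" for i j
  proof (rule Bochner_Integration.integrable_bound)
    show "integrable M (\<lambda>\<omega>. 2 * ((dot d (Z i \<omega>) (Z i \<omega>))\<^sup>2 + (dot d (Z j \<omega>) (Z j \<omega>))\<^sup>2) + 2 * C\<^sup>2)"
      using R_int ij by (intro Bochner_Integration.integrable_add integrable_mult_right) auto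
    show "AE \<omega> in M. norm ((dot d (Z i \<omega>) (Z j \<omega>) - Xhat \<omega> i j)\<^sup>2) \<le>
        norm (2 * ((dot d (Z i \<omega>) (Z i \<omega>))\<^sup>2 + (dot d (Z j \<omega>) (Z j \<omega>))\<^sup>2) + 2 * C\<^sup>2)"
    proof (rule AE_I2)
      fix \<omega> assume w: "\<omega> \<in> space M"
      let ?x = "dot d (Z i \<omega>) (Z i \<omega>)" and ?y = "dot d (Z j \<omega>) (Z j \<omega>)"
      have "(dot d (Z i \<omega>) (Z j \<omega>) - Xhat \<omega> i j)\<^sup>2 \<le> 2 * (dot d (Z i \<omega>) (Z j \<omega>))\<^sup>2 + 2 * (Xhat \<omega> i j)\<^sup>2"
        using power2_sum_le[of "dot d (Z i \<omega>) (Z j \<omega>)" "- Xhat \<omega> i j"] by simp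
      also have "(dot d (Z i \<omega>) (Z j \<omega>))\<^sup>2 \<le> ?x * ?y" by (rule dot_Cauchy_Schwarz)
      also have "?x * ?y \<le> ?x\<^sup>2 + ?y\<^sup>2"
      proof -
        have "2 * (?x * ?y) \<le> ?x\<^sup>2 + ?y\<^sup>2" using zero_le_power2[of "?x - ?y"] by (simp add: power2_diff)
        moreover have "0 \<le> ?x * ?y" by (intro mult_nonneg_nonneg dot_nonneg)
        ultimately show ?thesis by linarith
      qed
      also have "(Xhat \<omega> i j)\<^sup>2 \<le> C\<^sup>2" 
        by (rule abs_le_square_iff[THEN iffD1]) (use XC[OF w ij] in linarith)
      finally have "(dot d (Z i \<omega>) (Z j \<omega>) - Xhat \<omega> i j)\<^sup>2 \<le> 2 * (?x\<^sup>2 + ?y\<^sup>2) + 2 * C\<^sup>2" by simp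
      then show "norm ((dot d (Z i \<omega>) (Z j \<omega>) - Xhat \<omega> i j)\<^sup>2) \<le> norm (2 * (?x\<^sup>2 + ?y\<^sup>2) + 2 * C\<^sup>2)"
        unfolding real_norm_def abs_power2 by linarith
    qed
  qed (rule term_meas[OF ij])
  have err_int: "integrable M err"
    unfolding err_def loss_eq gram_eq_dot
    by (intro integrable_mult_right Bochner_Integration.integrable_sum term_int) auto

  define W where "W \<omega> = (\<lambda>i\<in>{..<n}. Z i \<omega>)" for \<omega>
  have W_meas [measurable]: "W \<in> measurable M (\<Pi>\<^sub>M i\<in>{..<n}. vec_space d)"
    unfolding W_def[abs_def] by (intro measurable_restrict Zm) auto
  have joint: "distr M (\<Pi>\<^sub>M i\<in>{..<n}. vec_space d) W = (\<Pi>\<^sub>M i\<in>{..<n}. \<mu>)"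
  proof -
    have "distr M (\<Pi>\<^sub>M i\<in>{..<n}. vec_space d) (\<lambda>\<omega>. \<lambda>i\<in>{..<n}. Z i \<omega>) = (\<Pi>\<^sub>M i\<in>{..<n}. distr M (vec_space d) (Z i))"
      using indep_vars_iff_distr_eq_PiM'[where I = "{..<n}" and M' = "\<lambda>_. vec_space d" and X = Z] indep Zm nd by auto
    also have "\<dots> = (\<Pi>\<^sub>M i\<in>{..<n}. \<mu>)" using distr by (intro PiM_cong) auto
    finally show ?thesis by (simp add: W_def[abs_def])
  qed
  have ball: "measure M (W -` loss_ball n d Y' \<tau> \<inter> space M) \<le> exp (- (?K + 2) * real n * real (min n d))" for Y'
  proof -
    have eq: "emeasure M (W -` loss_ball n d Y' \<tau> \<inter> space M) = emeasure (\<Pi>\<^sub>M i\<in>{..<n}. \<mu>) (loss_ball n d Y' \<tau>)"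
      unfolding joint[symmetric] by (rule emeasure_distr[symmetric]) (auto simp: sets_loss_ball)
    have "ennreal (measure M (W -` loss_ball n d Y' \<tau> \<inter> space M)) \<le> ennreal (exp (- (?K + 2) * real n * real (min n d)))"
      using small[of Y'] unfolding eq[symmetric] emeasure_eq_measure .
    then show ?thesis by (simp only: ennreal_le_iff exp_ge_zero)
  qed

  let ?m = "4 * (real n)\<^sup>2 * p"
  have m0: "?m > 0" using nd p by simp
  define Obs where "Obs i j = {\<omega> \<in> space M. A i j \<omega> \<noteq> None}" for i j
  have Obs_meas [measurable]: "Obs i j \<in> sets M" if "i < n" "j < n" for i j
  proof -
    have "Obs i j = A i j -` (- {None}) \<inter> space M" by (auto simp: Obs_def)
    then show ?thesis using A[OF that] by (auto intro: measurable_sets)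
  qed
  define cnt where "cnt \<omega> = (\<Sum>i<n. \<Sum>j<n. indicator (Obs i j) \<omega> :: real)" for \<omega>
  have cnt_meas [measurable]: "cnt \<in> borel_measurable M"
    unfolding cnt_def by (intro borel_measurable_sum borel_measurable_indicator Obs_meas) auto
  have cnt_eq: "cnt \<omega> = real (num_observed n (observation n A \<omega>))" if "\<omega> \<in> space M" for \<omega>
  proof -
    have "real (num_observed n (observation n A \<omega>)) = (\<Sum>x\<in>{..<n} \<times> {..<n}. if observation n A \<omega> x \<noteq> None then 1 else 0)"
      unfolding num_observed_def by (simp add: sum.inter_filter[symmetric])
    also have "\<dots> = (\<Sum>i<n. \<Sum>j<n. if observation n A \<omega> (i, j) \<noteq> None then 1 else 0)"
      by (simp add: sum.cartesian_product case_prod_beta)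
    also have "\<dots> = cnt \<omega>"
      unfolding cnt_def using that by (intro sum.cong refl) (auto simp: observation_apply Obs_def indicator_def)
    finally show ?thesis by simp
  qed
  have many: "measure M {\<omega> \<in> space M. ?m < cnt \<omega>} \<le> 1 / 4"
  proof -
    have int: "integrable M (indicator (Obs i j) :: _ \<Rightarrow> real)" if "i < n" "j < n" for i j
      using Obs_meas[OF that] by (simp add: integrable_indicator_iff emeasure_eq_measure)
    have "expectation cnt = (\<Sum>i<n. expectation (\<lambda>\<omega>. \<Sum>j<n. indicator (Obs i j) \<omega>))"
      unfolding cnt_def by (intro Bochner_Integration.integral_sum Bochner_Integration.integrable_sum int) auto
    also have "\<dots> = (\<Sum>i<n. \<Sum>j<n. expectation (indicator (Obs i j)))"
      by (rule sum.cong[OF refl], rule Bochner_Integration.integral_sum) (auto intro: int)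
    also have "\<dots> = (\<Sum>i<n. \<Sum>j<n. P i j)"
    proof (rule sum.cong[OF refl], rule sum.cong[OF refl])
      fix i j assume "i \<in> {..<n}" "j \<in> {..<n}"
      then have ij: "i < n" "j < n" by auto
      have "expectation (indicator (Obs i j)) = measure M (Obs i j)" using Obs_meas[OF ij] by simp
      also have "\<dots> = P i j" unfolding Obs_def by (rule P[OF ij])
      finally show "expectation (indicator (Obs i j)) = P i j" .
    qed
    finally have E: "expectation cnt = (real n)\<^sup>2 * p" using Psum by simp
    have "integrable M cnt" unfolding cnt_def by (intro Bochner_Integration.integrable_sum int) auto
    moreover have "cnt \<omega> \<ge> 0" for \<omega> unfolding cnt_def by (intro sum_nonneg) auto
    ultimately have "measure M {\<omega> \<in> space M. ?m \<le> cnt \<omega>} \<le> expectation cnt / ?m"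
      using m0 by (intro integral_Markov_inequality_measure[where A = "{}"]) auto
    also have "\<dots> = 1 / 4" using E nd p by simp
    finally have "measure M {\<omega> \<in> space M. ?m \<le> cnt \<omega>} \<le> 1 / 4" .
    moreover have "measure M {\<omega> \<in> space M. ?m < cnt \<omega>} \<le> measure M {\<omega> \<in> space M. ?m \<le> cnt \<omega>}"
      by (intro finite_measure_mono) auto
    ultimately show ?thesis by simp
  qed

  \<comment> \<open>Outside two events of probability at most \<open>1 / 4\<close> each the loss exceeds \<open>\<tau>\<close>.\<close>
  let ?G = "sparse_patterns n ?m"
  have finG: "finite ?G" unfolding sparse_patterns_def using finite_patterns by simp
  let ?L = "{\<omega> \<in> space M. \<tau> < err \<omega>}" and ?B = "{\<omega> \<in> space M. ?m < cnt \<omega>}"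
    and ?U = "\<Union>a\<in>?G. W -` loss_ball n d (Y a) \<tau> \<inter> space M"
  have Wset [measurable]: "W -` loss_ball n d Y' \<tau> \<inter> space M \<in> sets M" for Y'
    by (rule measurable_sets[OF W_meas sets_loss_ball])
  have Uset [measurable]: "?U \<in> sets M" using finG by (intro sets.finite_UN Wset)
  have cover: "space M \<subseteq> ?L \<union> ?B \<union> ?U"
  proof
    fix \<omega> assume w: "\<omega> \<in> space M"
    let ?a = "observation n A \<omega>"
    have "\<omega> \<in> ?U" if "\<not> \<tau> < err \<omega>" "\<not> ?m < cnt \<omega>"
    proof -
      have "?a \<in> ?G" using that(2) observation_pattern[of n A \<omega>] by (simp add: sparse_patterns_def cnt_eq[OF w])
      moreover have "loss n d (gram d (W \<omega>)) (Y ?a) = err \<omega>"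
        unfolding err_def using Y[OF w] by (intro loss_cong) (auto simp: gram_def W_def)
      then have "W \<omega> \<in> loss_ball n d (Y ?a) \<tau>"
        using that(1) measurable_space[OF W_meas w] by (simp add: loss_ball_def)
      ultimately show ?thesis using w by blast
    qed
    then show "\<omega> \<in> ?L \<union> ?B \<union> ?U" using w by blast
  qed
  have exp_cancel: "exp (k * x * y) * exp (- (k + 2) * x * y) = exp (- 2 * (x * y))" for k x y :: real
    by (simp add: mult_exp_exp algebra_simps)
  have "measure M ?U \<le> (\<Sum>a\<in>?G. measure M (W -` loss_ball n d (Y a) \<tau> \<inter> space M))"
    using finG by (intro finite_measure_subadditive_finite) auto
  also have "\<dots> \<le> (\<Sum>a\<in>?G. exp (- (?K + 2) * real n * real (min n d)))" by (intro sum_mono ball)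
  also have "\<dots> = real (card ?G) * exp (- (?K + 2) * real n * real (min n d))" by simp
  also have "\<dots> \<le> exp (?K * real n * real (min n d)) * exp (- (?K + 2) * real n * real (min n d))"
    by (intro mult_right_mono card_sparse_patterns_bound p c dim) auto
  also have "\<dots> = exp (- 2 * (real n * real (min n d)))" by (rule exp_cancel)
  also have "\<dots> \<le> exp (- 2)"
  proof -
    have "1 * 1 \<le> real n * real (min n d)" using nd by (intro mult_mono) auto
    then show ?thesis by simp
  qed
  also have "\<dots> \<le> 1 / 4"
  proof -
    have "1 + 2 + 2\<^sup>2 / 2 \<le> exp (2::real)" by (rule exp_lower_Taylor_quadratic) simp
    then show ?thesis by (simp add: exp_minus field_simps)
  qed
  finally have U: "measure M ?U \<le> 1 / 4" .
  have [measurable]: "?L \<in> sets M" "?B \<in> sets M" by measurable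
  have "1 = measure M (space M)" by (rule prob_space[symmetric])
  also have "\<dots> \<le> measure M (?L \<union> ?B \<union> ?U)"
    by (rule finite_measure_mono[OF cover]) (intro sets.Un Uset; measurable)
  also have "\<dots> \<le> measure M (?L \<union> ?B) + measure M ?U"
    by (rule measure_Un_le[OF _ Uset]) measurable
  finally have "1 \<le> measure M (?L \<union> ?B) + measure M ?U" .
  moreover have "measure M (?L \<union> ?B) \<le> measure M ?L + measure M ?B"
    by (rule measure_Un_le) measurable
  ultimately have L: "measure M ?L \<ge> 1 / 2" using U many by linarith
  have "\<tau> / 2 \<le> \<tau> * measure M ?L" using L \<tau> by simp
  also have "\<dots> = expectation (\<lambda>\<omega>. \<tau> * indicator ?L \<omega>)" by simp
  also have "\<dots> \<le> expectation err"
  proof (intro integral_mono err_int)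
    show "integrable M (\<lambda>\<omega>. \<tau> * indicator ?L \<omega>)"
      by (intro integrable_mult_right) (simp add: integrable_indicator_iff emeasure_eq_measure)
    show "\<tau> * indicator ?L \<omega> \<le> err \<omega>" for \<omega>
      using \<tau> by (auto simp: indicator_def err_def loss_nonneg)
  qed
  finally show ?thesis unfolding err_def[abs_def] .
qed

theorem corollary2p4:
  fixes c :: real
  assumes "c > 0"
  shows "\<exists>D>0. \<forall>(n::nat) (d::nat) (p::real) (M :: 'w measure)
      (Z :: nat \<Rightarrow> 'w \<Rightarrow> nat \<Rightarrow> real) (P :: nat \<Rightarrow> nat \<Rightarrow> real)
      (A :: nat \<Rightarrow> nat \<Rightarrow> 'w \<Rightarrow> bool option) (Xhat :: 'w \<Rightarrow> nat \<Rightarrow> nat \<Rightarrow> real).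
    n > 0 \<longrightarrow> d > 0 \<longrightarrow> 0 < p \<longrightarrow> p < 1 \<longrightarrow>
    prob_space M \<longrightarrow>
    prob_space.indep_vars M (\<lambda>_. vec_space d) Z {..<n} \<longrightarrow>
    ((\<forall>i<n. distr M (vec_space d) (Z i) = gaussian_law d) \<or>
     n \<ge> 2 \<and> d \<ge> 2 \<and> (\<forall>i<n. distr M (vec_space d) (Z i) = sphere_law d)) \<longrightarrow>
    (\<forall>i<n. \<forall>j<n. A i j \<in> measurable M (count_space UNIV)) \<longrightarrow>
    (\<forall>i<n. \<forall>j<n. measure M {\<omega> \<in> space M. A i j \<omega> \<noteq> None} = P i j) \<longrightarrow>
    (\<Sum>i<n. \<Sum>j<n. P i j) = (real n)\<^sup>2 * p \<longrightarrow>
    real d \<ge> c * real n * (binary_entropy p + p) \<longrightarrow>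
    (\<forall>i<n. \<forall>j<n. (\<lambda>\<omega>. Xhat \<omega> i j) \<in> borel_measurable (obs_algebra M n A)) \<longrightarrow>
    prob_space.expectation M (\<lambda>\<omega>. loss n d (gram d (\<lambda>i. Z i \<omega>)) (Xhat \<omega>)) \<ge> D"
proof -
  have "max (4 / c) 2 + 2 > 0" by (simp add: max_def)
  then obtain \<tau> where \<tau>: "\<tau> > 0" "\<And>n d \<mu> Y. row_law n d \<mu> \<Longrightarrow>
    emeasure (\<Pi>\<^sub>M i\<in>{..<n}. \<mu>) (loss_ball n d Y \<tau>) \<le> ennreal (exp (- (max (4 / c) 2 + 2) * real n * real (min n d)))"
    using gram_loss_ball by blast
  show ?thesis
  proof (intro exI[of _ "\<tau> / 2"] conjI allI impI, goal_cases)
    case 1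
    then show ?case using \<tau> by simp
  next
    case (2 n d p M Z P A Xhat)
    obtain \<mu> where law: "row_law n d \<mu>" and \<mu>: "\<And>i. i < n \<Longrightarrow> distr M (vec_space d) (Z i) = \<mu>"
      using 2 unfolding row_law_def by blast
    show ?case
    proof (rule expected_loss_lower_bound[where A = A and P = P, OF assms \<tau>(1) \<tau>(2)[OF law] law])
      show "measure M {\<omega> \<in> space M. A i j \<omega> \<noteq> None} = P i j" if "i < n" "j < n" for i j
        using 2 that by blast
    qed (use 2 \<mu> in auto)
  qed
qed

end
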